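(* Let $p>2$, let $u_0,u_1\in\mathcal C_0^\infty(\mathbb R^2)$ be real-valued, let $[0,T_{\max})$ be the interval of existence of the maximal mild Sobolev solution $u$ to $u_{tt}-\Delta u-\Delta u_t=|u|^p$ in $\mathbb R^2$ with $(u,u_t)(0,\cdot)=(u_0,u_1)$, and let $0<T<T_{\max}$. Set $w(t,r):=r^{1/2}\mathcal M[u(t,\cdot)](r)$ and $W_{\mathrm{lin}}(t,r):=r^{1/2}\mathcal M[S_0(t)u_0+S_1(t)u_1](r)$. Then, for every $0\leqslant t\leqslant T$ and $r>0$, $$w(t,r)\geqslant W_{\mathrm{lin}}(t,r)+\int_0^t\int_0^\infty D(t-s,r,\rho)\,\rho^{\frac{1-p}{2}}|w(s,\rho)|^p\,d\rho\,ds.$$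
   Context: Circular mean: $\mathcal M[f](r):=\frac1{2\pi}\int_0^{2\pi}f(r\cos\theta,r\sin\theta)\,d\theta$, $r\geqslant0$. For $\zeta\in\mathbb R^2$ and $j\in\{0,1\}$ let $y(t)=\widehat S_j(t,\zeta)$ solve $y''+|\zeta|^2y'+|\zeta|^2y=0$ with $(y(0),y'(0))=(1,0)$ for $j=0$ and $(0,1)$ for $j=1$; $S_j(t)$ is the Fourier multiplier with this symbol (convention $\widehat f(\zeta)=\int e^{-ix\cdot\zeta}f(x)\,dx$). $G_1^{(2)}(t,x)$ is the (radial) kernel on $\mathbb R^2$ with Fourier transform $\widehat S_1(t,\zeta)$, written $G_1^{(2)}(t,r)$ with $r=|x|>0$, i.e. $G_1^{(2)}(t,r)=\frac1{2\pi}\int_0^\infty\widehat S_1(t,\varrho)J_0(r\varrho)\varrho\,d\varrho$. The circularly averaged kernel is $$D(t,r,\rho):=\sqrt{r\rho}\int_0^{2\pi}G_1^{(2)}\bigl(t,\sqrt{r^2+\rho^2-2r\rho\cos\theta}\bigr)\,d\theta,\qquad t,r,\rho>0.$$ A mild Sobolev solution on $[0,T')$ is a function $u\in\mathcal C([0,T'),H^2(\mathbb R^2))\cap\mathcal C^1([0,T'),L^2(\mathbb R^2))$ with $u(t)=S_0(t)u_0+S_1(t)u_1+\int_0^tS_1(t-s)|u(s)|^p\,ds$ in $H^2$ for every $t\in[0,T')$. For $p>2$ and smooth compactly supported data there is a unique maximal one, defined on $[0,T_{\max})$, $T_{\max}\in(0,\infty]$. *)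

theory Defs
  imports "HOL-Analysis.Analysis"
begin

section \<open>Smooth functions, Sobolev spaces and circular means on the plane\<close>

definition partial_deriv :: "2 \<Rightarrow> (real^2 \<Rightarrow> real) \<Rightarrow> real^2 \<Rightarrow> real" where
  "partial_deriv i f = (\<lambda>x. frechet_derivative f (at x) (axis i 1))"

definition smooth_fun :: "(real^2 \<Rightarrow> real) \<Rightarrow> bool" where
  "smooth_fun f \<longleftrightarrow> (\<forall>\<alpha> x. foldr partial_deriv \<alpha> f differentiable (at x))"

definition test_fun :: "(real^2 \<Rightarrow> real) \<Rightarrow> bool" where
  "test_fun f \<longleftrightarrow> smooth_fun f \<and> compact (closure {x. f x \<noteq> 0})"

definition L2_fun :: "(real^2 \<Rightarrow> real) \<Rightarrow> bool" where
  "L2_fun f \<longleftrightarrow> f \<in> borel_measurable lborel \<and> integrable lborel (\<lambda>x. (f x)\<^sup>2)"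

definition L2_norm :: "(real^2 \<Rightarrow> real) \<Rightarrow> real" where
  "L2_norm f = sqrt (LINT x|lborel. (f x)\<^sup>2)"

definition has_weak_deriv :: "2 list \<Rightarrow> (real^2 \<Rightarrow> real) \<Rightarrow> (real^2 \<Rightarrow> real) \<Rightarrow> bool" where
  "has_weak_deriv \<alpha> f g \<longleftrightarrow>
     (\<forall>\<phi>. test_fun \<phi> \<longrightarrow>
        (LINT x|lborel. f x * foldr partial_deriv \<alpha> \<phi> x)
          = (-1) ^ length \<alpha> * (LINT x|lborel. g x * \<phi> x))"

definition H2_fun :: "(real^2 \<Rightarrow> real) \<Rightarrow> bool" where
  "H2_fun f \<longleftrightarrow> L2_fun f \<and>
     (\<forall>\<alpha>. length \<alpha> \<le> 2 \<longrightarrow> (\<exists>g. L2_fun g \<and> has_weak_deriv \<alpha> f g))"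

text \<open>The weak derivative is unique up to a null set, so the norm below does not depend on the
  choice. The index set consists of words rather than multi-indices, so the mixed second
  derivative is counted twice.\<close>

definition weak_deriv :: "2 list \<Rightarrow> (real^2 \<Rightarrow> real) \<Rightarrow> real^2 \<Rightarrow> real" where
  "weak_deriv \<alpha> f = (SOME g. L2_fun g \<and> has_weak_deriv \<alpha> f g)"

definition H2_norm :: "(real^2 \<Rightarrow> real) \<Rightarrow> real" where
  "H2_norm f = sqrt (\<Sum>\<alpha> | length \<alpha> \<le> 2. (L2_norm (weak_deriv \<alpha> f))\<^sup>2)"

definition C0_H2_on :: "real set \<Rightarrow> (real \<Rightarrow> real^2 \<Rightarrow> real) \<Rightarrow> bool" where
  "C0_H2_on I u \<longleftrightarrow> (\<forall>t\<in>I. H2_fun (u t)) \<and>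
     (\<forall>t\<in>I. ((\<lambda>s. H2_norm (\<lambda>x. u s x - u t x)) \<longlongrightarrow> 0) (at t within I))"

definition C1_L2_on :: "real set \<Rightarrow> (real \<Rightarrow> real^2 \<Rightarrow> real) \<Rightarrow> bool" where
  "C1_L2_on I u \<longleftrightarrow> (\<forall>t\<in>I. L2_fun (u t)) \<and>
     (\<exists>v. (\<forall>t\<in>I. L2_fun (v t)) \<and>
       (\<forall>t\<in>I. ((\<lambda>s. L2_norm (\<lambda>x. (u s x - u t x) / (s - t) - v t x)) \<longlongrightarrow> 0) (at t within I)) \<and>
       (\<forall>t\<in>I. ((\<lambda>s. L2_norm (\<lambda>x. v s x - v t x)) \<longlongrightarrow> 0) (at t within I)))"

text \<open>The integral of an \<open>H\<^sup>2\<close>-valued function over a compact interval, as a limit of Riemann sums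
  in the \<open>H\<^sup>2\<close> norm. It is \<^const>\<open>has_integral\<close> with the norm replaced by \<^const>\<open>H2_norm\<close>; for
  continuous integrands it is the Riemann, hence also the Bochner, integral. The value \<open>y\<close> is
  determined up to a null set.\<close>

definition has_H2_integral ::
    "(real \<Rightarrow> real^2 \<Rightarrow> real) \<Rightarrow> (real^2 \<Rightarrow> real) \<Rightarrow> real \<Rightarrow> real \<Rightarrow> bool" where
  "has_H2_integral F y a b \<longleftrightarrow>
     (\<forall>s\<in>{a..b}. H2_fun (F s)) \<and> H2_fun y \<and>
     (\<forall>e>0. \<exists>\<gamma>. gauge \<gamma> \<and>
        (\<forall>P. P tagged_division_of cbox a b \<and> \<gamma> fine P \<longrightarrow>
           H2_norm (\<lambda>x. (\<Sum>(s,K)\<in>P. measure lborel K * F s x) - y x) < e))"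

definition circ_mean :: "(real^2 \<Rightarrow> real) \<Rightarrow> real \<Rightarrow> real" where
  "circ_mean f r = 1 / (2 * pi) *
     (LINT \<theta>:{0..2*pi}|lborel. f (vector [r * cos \<theta>, r * sin \<theta>]))"


section \<open>Fourier multipliers of the strongly damped wave equation\<close>

text \<open>The symbols are radial in \<open>\<zeta>\<close>; the argument \<open>k\<close> below is \<open>|\<zeta>|\<close>.\<close>

definition solves_symbol_ode :: "nat \<Rightarrow> real \<Rightarrow> (real \<Rightarrow> real) \<Rightarrow> bool" where
  "solves_symbol_ode j k y \<longleftrightarrow>
     (\<exists>y'. (\<forall>t. (y has_real_derivative y' t) (at t)) \<and>
           (\<forall>t. (y' has_real_derivative (- k\<^sup>2 * y' t - k\<^sup>2 * y t)) (at t)) \<and>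
           (y 0, y' 0) = (if j = 0 then (1, 0) else (0, 1)))"

definition S_hat :: "nat \<Rightarrow> real \<Rightarrow> real \<Rightarrow> real" where
  "S_hat j t k = (THE y. solves_symbol_ode j k y) t"

definition fourier :: "(real^2 \<Rightarrow> real) \<Rightarrow> real^2 \<Rightarrow> complex" where
  "fourier f \<zeta> = (LINT x|lborel. cis (- (x \<bullet> \<zeta>)) * of_real (f x))"

text \<open>The multiplier is given by the Fourier inversion integral, which is real since the symbol is
  real and even. It is applied only to test functions (\<open>j = 0, 1\<close>) and to \<open>\<bar>u\<bar> powr p\<close> with \<open>u\<close> in
  \<open>H\<^sup>2\<close> and \<open>p > 2\<close> (\<open>j = 1\<close>). The latter lies in \<open>L\<^sup>1 \<inter> L\<^sup>2\<close>, and \<open>S_hat 1 t\<close>, being bounded and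
  of order \<open>k\<^sup>-\<^sup>2\<close> at infinity, is square integrable on the plane; so in both cases the Fourier
  and the inversion integral converge absolutely, and they give the continuous representative.\<close>

definition S_op :: "nat \<Rightarrow> real \<Rightarrow> (real^2 \<Rightarrow> real) \<Rightarrow> real^2 \<Rightarrow> real" where
  "S_op j t f x = Re (1 / (2 * of_real pi)\<^sup>2 *
     (LINT \<zeta>|lborel. cis (x \<bullet> \<zeta>) * of_real (S_hat j t (norm \<zeta>)) * fourier f \<zeta>))"

definition bessel_J0 :: "real \<Rightarrow> real" where
  "bessel_J0 z = (\<Sum>m. (-1) ^ m / (fact m)\<^sup>2 * (z / 2) ^ (2 * m))"

definition kernel_G :: "real \<Rightarrow> real \<Rightarrow> real" where
  "kernel_G t r = 1 / (2 * pi) * (LINT k:{0<..}|lborel. S_hat 1 t k * bessel_J0 (r * k) * k)"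

definition kernel_D :: "real \<Rightarrow> real \<Rightarrow> real \<Rightarrow> real" where
  "kernel_D t r \<rho> = sqrt (r * \<rho>) *
     (LINT \<theta>:{0..2*pi}|lborel. kernel_G t (sqrt (r\<^sup>2 + \<rho>\<^sup>2 - 2 * r * \<rho> * cos \<theta>)))"


section \<open>Mild Sobolev solutions\<close>

text \<open>Elements of \<open>H\<^sup>2\<close> on the plane have a unique continuous representative. Solutions are
  represented by it, so that circular means make sense for every radius.\<close>

definition mild_sobolev_solution ::
    "real \<Rightarrow> (real^2 \<Rightarrow> real) \<Rightarrow> (real^2 \<Rightarrow> real) \<Rightarrow> ereal \<Rightarrow> (real \<Rightarrow> real^2 \<Rightarrow> real) \<Rightarrow> bool" where
  "mild_sobolev_solution p u0 u1 T' u \<longleftrightarrow>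
     (\<forall>t. 0 \<le> t \<and> ereal t < T' \<longrightarrow> continuous_on UNIV (u t)) \<and>
     C0_H2_on {t. 0 \<le> t \<and> ereal t < T'} u \<and>
     C1_L2_on {t. 0 \<le> t \<and> ereal t < T'} u \<and>
     (\<forall>t. 0 \<le> t \<and> ereal t < T' \<longrightarrow>
        has_H2_integral (\<lambda>s. S_op 1 (t - s) (\<lambda>x. \<bar>u s x\<bar> powr p))
          (\<lambda>x. u t x - (S_op 0 t u0 x + S_op 1 t u1 x)) 0 t)"

definition maximal_mild_sobolev_solution ::
    "real \<Rightarrow> (real^2 \<Rightarrow> real) \<Rightarrow> (real^2 \<Rightarrow> real) \<Rightarrow> ereal \<Rightarrow> (real \<Rightarrow> real^2 \<Rightarrow> real) \<Rightarrow> bool" where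
  "maximal_mild_sobolev_solution p u0 u1 Tmax u \<longleftrightarrow>
     0 < Tmax \<and> mild_sobolev_solution p u0 u1 Tmax u \<and>
     \<not> (\<exists>T' v. Tmax < T' \<and> mild_sobolev_solution p u0 u1 T' v \<and>
          (\<forall>t. 0 \<le> t \<and> ereal t < Tmax \<longrightarrow> v t = u t))"

end

theory Submission
  imports Defs "HOL-Probability.Probability" "HOL-Real_Asymp.Real_Asymp"
    "HOL-Computational_Algebra.Polynomial"
begin

text \<open>The inequality follows from Jensen's inequality on circles once the kernel of \<open>S\<^sub>1(t)\<close> is known to
  be nonnegative. Put \<open>\<kappa> = k / 2\<close> and \<open>a\<^sup>2 = 1 - \<kappa>\<^sup>2\<close>. A Gaussian integral gives
  \<open>S\<^sub>1(t, k) = e\<^bsup>-t\<^esup> / (2 sqrt (\<pi> t)) \<integral>\<^sub>0\<^sup>\<infinity> e\<^bsup>-v\<^sup>2/4t\<^esup> (sin \<kappa>v / \<kappa>) (sinh av / a) dv\<close>, and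
  \<open>sinh av / a\<close> solves a Volterra equation with kernel \<open>sin \<kappa>(v - x) / \<kappa>\<close>. Expanding it into its
  Picard iterates and using that \<open>(sin \<kappa>v / \<kappa>) (sin \<kappa>W / \<kappa>)\<close> is \<open>v\<close> times an average of \<open>sin \<kappa>s / \<kappa>\<close> over
  \<open>W - v \<le> s \<le> W + v\<close>, everything is reduced to the positivity of the wave kernel
  \<open>sin (s|\<zeta>|) / |\<zeta>|\<close>, which is \<open>s\<close> times an average of plane waves over a sphere. Convergence
  in \<open>H\<^sup>2\<close> is only used weakly, against mollifiers; Fatou's lemma then yields the Duhamel term
  pointwise as a lower bound, which is all that is needed.\<close>

section \<open>The plane in polar coordinates\<close>

text \<open>Three obstacles shape the development. The symbol is controlled only by k^-2, so Fourier
  inversion on the plane need not converge absolutely. A Gaussian factor is therefore inserted; its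
  transform is again a positive Gaussian, so signs are tested on absolutely convergent integrals and
  survive the limit. That limit rests on the k^(-1/2) decay of J_0, which also yields the harmless
  singularity r^(-1/2) of the kernel. Next, sinh(av)/a grows for k < 2 and oscillates for k > 2. The
  Picard expansion treats both regimes at once; the other factor sin(\<kappa> v)/\<kappa> keeps it
  positive, since the product formula then yields only waves of time s \<ge> 0, whereas sin(\<kappa>
  s)/\<kappa> is odd in s. Finally, u is known only as a curve in Sobolev space and its Duhamel
  integral only through Riemann sums. Joint measurability, boundedness of u(s) and the pointwise
  bound are all recovered from pairings with shrinking bumps. As a non-integrable function has
  integral 0 by convention, the estimates are made with extended nonnegative integrals, and
  integrability is a conclusion.\<close>

abbreviation vec2 :: "real \<Rightarrow> real \<Rightarrow> real^2" where
  "vec2 a b \<equiv> vector [a, b]"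

lemma continuous_on_vec2 [continuous_intros]:
  assumes "continuous_on S f" "continuous_on S g"
  shows "continuous_on S (\<lambda>x. vec2 (f x) (g x))"
proof -
  have eq: "(\<lambda>x. vec2 (f x) (g x)) = (\<lambda>x. (\<chi> i. if i = 1 then f x else g x))"
    by (auto simp: fun_eq_iff vec_eq_iff forall_2)
  show ?thesis
    unfolding eq proof (intro continuous_on_vec_lambda)
    show "continuous_on S (\<lambda>x. if i = 1 then f x else g x)" for i :: 2
      using assms by (cases "i = 1") simp_all
  qed
qed

lemma borel_measurable_vec2 [measurable (raw)]:
  assumes [measurable]: "f \<in> borel_measurable M" "g \<in> borel_measurable M"
  shows "(\<lambda>x. vec2 (f x) (g x)) \<in> borel_measurable M"
proof -
  have "(\<lambda>z::real\<times>real. vec2 (fst z) (snd z)) \<in> borel_measurable borel"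
    by (intro borel_measurable_continuous_onI continuous_intros)
  then have "(\<lambda>z::real\<times>real. vec2 (fst z) (snd z)) \<in> borel_measurable (borel \<Otimes>\<^sub>M borel)"
    by (simp add: borel_prod)
  from measurable_compose[OF measurable_Pair[OF assms] this] show ?thesis by simp
qed

lemma borel_measurable_vec_nth2 [measurable]: "(\<lambda>x::real^2. x $ i) \<in> borel_measurable borel"
  by (intro borel_measurable_continuous_onI continuous_intros)

lemma vec2_eta [simp]: "vec2 (x $ 1) (x $ 2) = x"
  by (simp add: vec_eq_iff forall_2)

lemma inner_vec2: "vec2 a b \<bullet> x = a * x $ 1 + b * x $ 2"
  by (simp add: inner_vec_def sum_2)

lemma norm_vec2: "norm (vec2 a b) = sqrt (a\<^sup>2 + b\<^sup>2)"
  by (simp add: norm_eq_sqrt_inner inner_vec2 power2_eq_square)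

text \<open>Lebesgue measure is determined by its values on open boxes, and the preimage of a box is
  a rectangle. Through this pushforward, Tonelli and Fubini become available coordinate by
  coordinate.\<close>

lemma lborel_plane:
  "distr (lborel \<Otimes>\<^sub>M lborel) borel (\<lambda>z. vec2 (fst z) (snd z)) = (lborel :: (real^2) measure)"
proof (rule lborel_eqI[symmetric])
  fix l u :: "real^2" assume le: "\<And>b. b \<in> Basis \<Longrightarrow> l \<bullet> b \<le> u \<bullet> b"
  have le': "l $ i \<le> u $ i" for i
    using le[of "axis i 1"] by (simp add: inner_axis)
  have vim: "(\<lambda>z. vec2 (fst z) (snd z)) -` box l u \<inter> space (lborel \<Otimes>\<^sub>M lborel)
      = {l$1<..<u$1} \<times> {l$2<..<u$2}"
    by (auto simp: mem_box_cart forall_2 space_pair_measure)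
  have B: "(Basis :: (real^2) set) = {axis 1 1, axis 2 1}"
    by (auto simp: Basis_vec_def UNIV_2)
  have ne: "axis 1 1 \<noteq> (axis 2 1 :: real^2)" by (simp add: axis_eq_axis)
  have "emeasure (distr (lborel \<Otimes>\<^sub>M lborel) borel (\<lambda>z. vec2 (fst z) (snd z))) (box l u)
      = emeasure (lborel \<Otimes>\<^sub>M lborel) ({l$1<..<u$1} \<times> {l$2<..<u$2})"
    by (subst emeasure_distr) (simp_all add: vim)
  also have "\<dots> = ennreal (u$1 - l$1) * ennreal (u$2 - l$2)"
    by (subst lborel.emeasure_pair_measure_Times) (simp_all add: le')
  also have "\<dots> = (\<Prod>b\<in>Basis. (u - l) \<bullet> b)"
    unfolding B using ne le' by (simp add: inner_axis ennreal_mult)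
  finally show "emeasure (distr (lborel \<Otimes>\<^sub>M lborel) borel (\<lambda>z. vec2 (fst z) (snd z))) (box l u)
      = (\<Prod>b\<in>Basis. (u - l) \<bullet> b)" .
qed simp

lemma nn_integral_plane:
  assumes [measurable]: "f \<in> borel_measurable borel"
  shows "(\<integral>\<^sup>+x. f x \<partial>(lborel :: (real^2) measure)) = (\<integral>\<^sup>+a. \<integral>\<^sup>+b. f (vec2 a b) \<partial>lborel \<partial>lborel)"
  by (subst lborel_plane[symmetric]) (simp add: nn_integral_distr lborel.nn_integral_fst[symmetric])

lemma integrable_plane_prod:
  fixes f g :: "real \<Rightarrow> 'a::{real_normed_field, second_countable_topology, banach}"
  assumes "integrable lborel f" "integrable lborel g"
  shows "integrable lborel (\<lambda>x::real^2. f (x$1) * g (x$2))"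
proof -
  have [measurable]: "f \<in> borel_measurable borel" "g \<in> borel_measurable borel"
    using assms by auto
  have 1: "(\<integral>\<^sup>+ x. ennreal (norm (f x)) \<partial>lborel) < \<infinity>" "(\<integral>\<^sup>+ x. ennreal (norm (g x)) \<partial>lborel) < \<infinity>"
    using assms by (auto simp: integrable_iff_bounded)
  have "(\<integral>\<^sup>+x. ennreal (norm (f (x$1) * g (x$2))) \<partial>(lborel :: (real^2) measure))
      = (\<integral>\<^sup>+ x. ennreal (norm (f x)) \<partial>lborel) * (\<integral>\<^sup>+ x. ennreal (norm (g x)) \<partial>lborel)"
    by (subst nn_integral_plane) (simp_all add: norm_mult ennreal_mult nn_integral_cmult nn_integral_multc)
  with 1 show ?thesis
    by (intro integrableI_bounded) (auto simp: ennreal_mult_less_top)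
qed

lemma integral_plane_prod:
  fixes f g :: "real \<Rightarrow> 'a::{real_normed_field, second_countable_topology, banach}"
  assumes "integrable lborel f" "integrable lborel g"
  shows "(LINT x|(lborel :: (real^2) measure). f (x$1) * g (x$2)) = (LINT a|lborel. f a) * (LINT b|lborel. g b)"
proof -
  have [measurable]: "f \<in> borel_measurable borel" "g \<in> borel_measurable borel"
    using assms by auto
  have int: "integrable (lborel \<Otimes>\<^sub>M lborel) (\<lambda>z. f (fst z) * g (snd z))"
    using integrable_plane_prod[OF assms]
    by (subst (asm) lborel_plane[symmetric]) (simp add: integrable_distr_eq)
  have "(LINT x|(lborel :: (real^2) measure). f (x$1) * g (x$2))
      = (LINT z|(lborel \<Otimes>\<^sub>M lborel). f (fst z) * g (snd z))"
    by (subst lborel_plane[symmetric]) (simp add: integral_distr)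
  also have "\<dots> = (LINT a|lborel. LINT b|lborel. f a * g b)"
    using lborel_pair.integral_fst'[OF int] by simp
  finally show ?thesis by simp
qed

definition polar :: "real \<Rightarrow> real \<Rightarrow> real^2" where
  "polar r \<theta> = vec2 (r * cos \<theta>) (r * sin \<theta>)"

lemma polar_nth [simp]: "polar r \<theta> $ 1 = r * cos \<theta>" "polar r \<theta> $ 2 = r * sin \<theta>"
  by (simp_all add: polar_def)

lemma borel_measurable_polar [measurable (raw)]:
  assumes [measurable]: "f \<in> borel_measurable M" "g \<in> borel_measurable M"
  shows "(\<lambda>x. polar (f x) (g x)) \<in> borel_measurable M"
  unfolding polar_def by measurable

lemma continuous_on_polar [continuous_intros]:
  fixes f g :: "'a::t2_space \<Rightarrow> real"
  assumes "continuous_on S f" "continuous_on S g"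
  shows "continuous_on S (\<lambda>x. polar (f x) (g x))"
  unfolding polar_def using assms by (intro continuous_intros)

lemma norm_polar [simp]: "norm (polar r \<theta>) = \<bar>r\<bar>"
proof -
  have "(r * cos \<theta>)\<^sup>2 + (r * sin \<theta>)\<^sup>2 = r\<^sup>2 * ((cos \<theta>)\<^sup>2 + (sin \<theta>)\<^sup>2)"
    by (simp only: power_mult_distrib distrib_left)
  then show ?thesis by (simp add: polar_def norm_vec2)
qed

lemma inner_polar: "polar r \<theta> \<bullet> polar s \<phi> = r * s * cos (\<theta> - \<phi>)"
  by (simp add: inner_vec_def sum_2 cos_diff algebra_simps)

lemma polar_exists: "\<exists>\<theta>\<in>{0..<2*pi}. x = polar (norm x) \<theta>"
proof (cases "x = 0")
  case True
  then show ?thesis by (intro bexI[of _ 0]) (auto simp: vec_eq_iff forall_2)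
next
  case False
  have "(x$1)\<^sup>2 + (x$2)\<^sup>2 = (norm x)\<^sup>2"
    by (simp add: norm_eq_sqrt_inner inner_vec_def sum_2 power2_eq_square)
  then have "(x$1 / norm x)\<^sup>2 + (x$2 / norm x)\<^sup>2 = 1"
    using False by (simp add: power_divide add_divide_distrib[symmetric])
  then obtain \<theta> where "0 \<le> \<theta>" "\<theta> < 2 * pi" "x$1 / norm x = cos \<theta>" "x$2 / norm x = sin \<theta>"
    by (rule sincos_total_2pi)
  then have "x$1 = norm x * cos \<theta>" "x$2 = norm x * sin \<theta>"
    using False by (simp_all add: divide_eq_eq mult.commute)
  then have "x = polar (norm x) \<theta>" unfolding vec_eq_iff forall_2 polar_nth by (rule conjI)
  then show ?thesis
    using \<open>0 \<le> \<theta>\<close> \<open>\<theta> < 2 * pi\<close> by (intro bexI[of _ \<theta>]) auto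
qed

abbreviation polar_domain :: "(real \<times> real) set" where
  "polar_domain \<equiv> {0<..} \<times> {0..2*pi}"

text \<open>The change of variables is an equality of measures, so that it serves both extended and
  Bochner integrals. It is checked on boxes with the area formula for an injective differentiable
  map whose Jacobian is the radius.\<close>

lemma lborel_polar:
  "distr (density (lborel \<Otimes>\<^sub>M lborel) (\<lambda>z. ennreal (fst z) * indicator polar_domain z)) borel
     (\<lambda>z. polar (fst z) (snd z)) = lborel"
proof (rule lborel_eqI[symmetric])
  fix l u :: "real^2" assume le: "\<And>b. b \<in> Basis \<Longrightarrow> l \<bullet> b \<le> u \<bullet> b"
  define S where "S = {x::real^2. 0 < x$1 \<and> 0 < x$2 \<and> x$2 < 2*pi}"
  define g where "g = (\<lambda>x::real^2. polar (x$1) (x$2))"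
  define g' where "g' = (\<lambda>(x::real^2) (h::real^2). vec2 (cos (x$2) * h$1 - x$1 * sin (x$2) * h$2)
                                            (sin (x$2) * h$1 + x$1 * cos (x$2) * h$2))"
  define f where "f = (indicator (box l u) :: real^2 \<Rightarrow> real)"
  have [measurable]: "S \<in> sets borel" unfolding S_def by measurable
  have der: "(g has_derivative g' x) (at x within S)" for x :: "real^2"
  proof (rule has_derivative_at_withinI, rule has_derivative_componentwise_within[THEN iffD2], rule ballI)
    fix i :: "real^2" assume "i \<in> Basis"
    then consider "i = axis 1 1" | "i = axis 2 1" by (auto simp: Basis_vec_def exhaust_2 UNIV_2)
    moreover have "((\<lambda>x::real^2. x$1 * cos (x$2)) has_derivative (\<lambda>h. cos (x$2) * h$1 - x$1 * sin (x$2) * h$2)) (at x)"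
      "((\<lambda>x::real^2. x$1 * sin (x$2)) has_derivative (\<lambda>h. sin (x$2) * h$1 + x$1 * cos (x$2) * h$2)) (at x)"
      by (auto intro!: derivative_eq_intros bounded_linear.has_derivative[OF bounded_linear_vec_nth] simp: fun_eq_iff algebra_simps)
    ultimately show "((\<lambda>x. g x \<bullet> i) has_derivative (\<lambda>h. g' x h \<bullet> i)) (at x)"
      by cases (simp_all add: g_def g'_def inner_axis)
  qed
  have det: "det (matrix (g' x)) = x$1" for x :: "real^2"
  proof -
    have "det (matrix (g' x)) = x$1 * (cos (x$2) * cos (x$2)) + x$1 * (sin (x$2) * sin (x$2))"
      unfolding det_2 matrix_def g'_def by (simp add: axis_def algebra_simps)
    also have "\<dots> = x$1 * ((cos (x$2))\<^sup>2 + (sin (x$2))\<^sup>2)"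
      by (simp only: power2_eq_square distrib_left)
    finally show ?thesis by simp
  qed
  have inj: "inj_on g S"
  proof (rule inj_onI)
    fix x y assume xy: "x \<in> S" "y \<in> S" "g x = g y"
    then have 1: "x$1 = y$1" using norm_polar[of "x$1" "x$2"] norm_polar[of "y$1" "y$2"]
      by (simp add: g_def S_def)
    have "polar (x$1) (x$2) $ i = polar (y$1) (y$2) $ i" for i using xy by (simp add: g_def)
    from this[of 1] this[of 2] have "cos (x$2) = cos (y$2)" "sin (x$2) = sin (y$2)"
      using xy 1 by (auto simp: S_def)
    then have "cos (x$2 - y$2) = 1" by (simp add: cos_diff power2_eq_square[symmetric])
    then obtain n :: int where n: "x$2 - y$2 = of_int n * 2 * pi" using cos_one_2pi_int by blast
    have "\<bar>of_int n * (2 * pi)\<bar> < 1 * (2 * pi)" using xy n by (auto simp: S_def)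
    then have "\<bar>real_of_int n\<bar> < 1" by (simp add: abs_mult)
    then have "n = 0" by linarith
    then have "x$2 = y$2" using n by simp
    with 1 show "x = y" by (simp add: vec_eq_iff forall_2)
  qed
  \<comment> \<open>On the open strip \<open>S\<close> the map is injective but misses the origin
    and the half-line of angle 0; both lie in a null line.\<close>
  have gS: "- (g ` S) \<subseteq> {x. x$2 = 0}"
  proof safe
    fix x assume x: "x \<notin> g ` S"
    obtain \<theta> where \<theta>: "0 \<le> \<theta>" "\<theta> < 2*pi" "x = polar (norm x) \<theta>"
      using polar_exists[of x] by auto
    show "x$2 = 0"
    proof (rule ccontr)
      assume "x$2 \<noteq> 0"
      then have "norm x \<noteq> 0" "sin \<theta> \<noteq> 0" using \<theta>(3) by (metis mult_zero_left polar_nth(2) , metis mult_zero_right polar_nth(2))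
      then have "0 < norm x" "0 < \<theta>" using \<theta>(1) by (auto simp: less_le)
      then have "vec2 (norm x) \<theta> \<in> S" "g (vec2 (norm x) \<theta>) = x"
        using \<theta> by (auto simp: S_def g_def)
      with x show False by (metis imageI)
    qed
  qed
  have null: "AE x in lborel. (x::real^2)$2 \<noteq> c" for c
    using AE_lborel_inner_neq[of "axis 2 1 :: real^2" c] by (simp add: inner_axis)
  \<comment> \<open>The area formula is applied to the part of the strip that lands in the box, and
    its image is the box up to that null line.\<close>
  define S' where "S' = {x\<in>S. g x \<in> box l u}"
  have [measurable]: "S' \<in> sets borel" unfolding S'_def g_def by measurable
  have S': "S' \<in> sets lebesgue" by simp
  have img: "g ` S' = box l u \<inter> g ` S" by (auto simp: S'_def)
  have neg: "negligible {x::real^2. x$2 = 0}"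
    using negligible_standard_hyperplane_cart by blast
  have m1: "g ` S' \<in> lmeasurable \<and> measure lebesgue (g ` S') = measure lebesgue (box l u)"
  proof -
    have "sym_diff (box l u) (g ` S') \<subseteq> {x. x$2 = 0}" using gS img by auto
    then have "negligible (sym_diff (box l u) (g ` S'))" using neg negligible_subset by blast
    then show ?thesis
      using lmeasurable_negligible_symdiff[of "box l u" "g ` S'"] measure_negligible_symdiff[of "box l u" "g ` S'"]
      by simp
  qed
  have "((\<lambda>x. \<bar>det (matrix (g' x))\<bar>) has_integral measure lebesgue (box l u)) S'"
  proof (subst has_measure_differentiable_image[symmetric, OF S'])
    show "(g has_derivative g' x) (at x within S')" for x
      by (rule has_derivative_subset[OF der]) (simp add: S'_def)
    show "inj_on g S'" using inj by (rule inj_on_subset) (auto simp: S'_def)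
  qed (rule m1)
  then have "((\<lambda>x. if x \<in> S' then \<bar>x$1\<bar> else 0) has_integral measure lborel (box l u)) UNIV"
    by (subst has_integral_restrict_UNIV) (simp add: det)
  from nn_integral_has_integral_lborel[OF _ _ this]
  have I: "(\<integral>\<^sup>+x. ennreal (if x \<in> S' then \<bar>x$1\<bar> else 0) \<partial>lborel) = ennreal (measure lborel (box l u))"
    by simp
  have "emeasure (distr (density (lborel \<Otimes>\<^sub>M lborel) (\<lambda>z. ennreal (fst z) * indicator polar_domain z)) borel
     (\<lambda>z. polar (fst z) (snd z))) (box l u)
     = (\<integral>\<^sup>+z. ennreal (fst z) * indicator polar_domain z * indicator (box l u) (polar (fst z) (snd z)) \<partial>(lborel \<Otimes>\<^sub>M lborel))"
  proof -
    have "(\<lambda>z. polar (fst z) (snd z)) -` box l u \<inter> space (lborel \<Otimes>\<^sub>M lborel) \<in> sets (lborel \<Otimes>\<^sub>M lborel)"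
      by (rule measurable_sets[of _ _ borel]) simp_all
    then show ?thesis
      by (subst emeasure_distr)
         (auto simp: emeasure_density space_pair_measure intro!: nn_integral_cong split: split_indicator)
  qed
  also have "\<dots> = (\<integral>\<^sup>+x. ennreal (x$1) * indicator polar_domain (x$1, x$2) * indicator (box l u) (g x) \<partial>(lborel :: (real^2) measure))"
    by (subst lborel_plane[symmetric]) (simp add: nn_integral_distr g_def)
  also have "\<dots> = (\<integral>\<^sup>+x. ennreal (if x \<in> S' then \<bar>x$1\<bar> else 0) \<partial>lborel)"
    by (rule nn_integral_cong_AE, use null[of 0] null[of "2*pi"] in eventually_elim)
      (auto simp: S'_def S_def split: split_indicator)
  finally have "emeasure (distr (density (lborel \<Otimes>\<^sub>M lborel) (\<lambda>z. ennreal (fst z) * indicator polar_domain z)) borel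
     (\<lambda>z. polar (fst z) (snd z))) (box l u) = ennreal (measure lborel (box l u))"
    unfolding I .
  also have "\<dots> = emeasure lborel (box l u)" by (rule emeasure_eq_ennreal_measure[symmetric]) (metis emeasure_lborel_box_finite infinity_ennreal_def less_irrefl)
  finally show "emeasure (distr (density (lborel \<Otimes>\<^sub>M lborel) (\<lambda>z. ennreal (fst z) * indicator polar_domain z)) borel
     (\<lambda>z. polar (fst z) (snd z))) (box l u) = (\<Prod>b\<in>Basis. (u - l) \<bullet> b)"
    using le by (simp add: emeasure_lborel_box)
qed simp

lemma nn_integral_polar:
  assumes [measurable]: "f \<in> borel_measurable borel"
  shows "(\<integral>\<^sup>+x. f x \<partial>(lborel :: (real^2) measure))
    = (\<integral>\<^sup>+\<rho>\<in>{0<..}. ennreal \<rho> * (\<integral>\<^sup>+\<theta>\<in>{0..2*pi}. f (polar \<rho> \<theta>) \<partial>lborel) \<partial>lborel)"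
proof -
  have "(\<integral>\<^sup>+x. f x \<partial>(lborel :: (real^2) measure))
    = (\<integral>\<^sup>+z. ennreal (fst z) * indicator polar_domain z * f (polar (fst z) (snd z)) \<partial>(lborel \<Otimes>\<^sub>M lborel))"
    by (subst lborel_polar[symmetric]) (simp add: nn_integral_distr nn_integral_density)
  also have "\<dots> = (\<integral>\<^sup>+\<rho>. \<integral>\<^sup>+\<theta>. ennreal \<rho> * indicator polar_domain (\<rho>, \<theta>) * f (polar \<rho> \<theta>) \<partial>lborel \<partial>lborel)"
    by (subst lborel.nn_integral_fst[symmetric]) simp_all
  also have "\<dots> = (\<integral>\<^sup>+\<rho>\<in>{0<..}. ennreal \<rho> * (\<integral>\<^sup>+\<theta>\<in>{0..2*pi}. f (polar \<rho> \<theta>) \<partial>lborel) \<partial>lborel)"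
    by (subst nn_integral_cmult[symmetric], simp, subst nn_integral_multc[symmetric], simp)
       (auto intro!: nn_integral_cong split: split_indicator)
  finally show ?thesis .
qed

lemma integral_polar:
  fixes f :: "real^2 \<Rightarrow> real"
  assumes "integrable lborel f"
  shows "(LINT x|lborel. f x) = (LINT \<rho>:{0<..}|lborel. \<rho> * (LINT \<theta>:{0..2*pi}|lborel. f (polar \<rho> \<theta>)))"
proof -
  have [measurable]: "f \<in> borel_measurable borel" using assms by auto
  let ?d = "\<lambda>z. fst z * indicator polar_domain z :: real"
  have d: "ennreal (fst z) * indicator polar_domain z = ennreal (?d z)" for z :: "real \<times> real"
    by (auto split: split_indicator)
  have d0: "0 \<le> ?d z" for z :: "real \<times> real" by (auto split: split_indicator)
  have L: "lborel = distr (density (lborel \<Otimes>\<^sub>M lborel) (\<lambda>z. ennreal (?d z))) borel (\<lambda>z. polar (fst z) (snd z))"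
    using lborel_polar unfolding d by simp
  have int: "integrable (lborel \<Otimes>\<^sub>M lborel) (\<lambda>z. ?d z * f (polar (fst z) (snd z)))"
    using assms unfolding L using d0 by (simp add: integrable_distr_eq integrable_density)
  have "(LINT x|lborel. f x) = (LINT z|(lborel \<Otimes>\<^sub>M lborel). ?d z * f (polar (fst z) (snd z)))"
    using d0 by (subst L) (simp add: integral_distr integral_density)
  also have "\<dots> = (LINT \<rho>|lborel. LINT \<theta>|lborel. ?d (\<rho>, \<theta>) * f (polar \<rho> \<theta>))"
    using lborel_pair.integral_fst'[OF int] by simp
  also have "\<dots> = (LINT \<rho>:{0<..}|lborel. \<rho> * (LINT \<theta>:{0..2*pi}|lborel. f (polar \<rho> \<theta>)))"
  proof -
    have "(LINT \<theta>|lborel. ?d (\<rho>, \<theta>) * f (polar \<rho> \<theta>))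
        = indicator {0<..} \<rho> * (\<rho> * (LINT \<theta>|lborel. indicator {0..2*pi} \<theta> * f (polar \<rho> \<theta>)))" for \<rho>
      by (cases "0 < \<rho>") (simp_all add: mult_ac indicator_times flip: integral_mult_right_zero)
    then show ?thesis by (simp add: set_lebesgue_integral_def)
  qed
  finally show ?thesis .
qed

text \<open>The shifted interval is cut at 0 and its negative part is moved by one period. The
  values are extended nonnegative reals because the kernel is not known to be integrable on a circle
  where this is applied.\<close>

lemma nn_integral_circle_shift:
  fixes h :: "real \<Rightarrow> ennreal"
  assumes [measurable]: "h \<in> borel_measurable borel"
    and per: "\<And>\<theta>. h (\<theta> + 2*pi) = h \<theta>" and \<psi>: "0 \<le> \<psi>" "\<psi> \<le> 2*pi"
  shows "(\<integral>\<^sup>+\<theta>\<in>{0..2*pi}. h (\<theta> - \<psi>) \<partial>lborel) = (\<integral>\<^sup>+\<theta>\<in>{0..2*pi}. h \<theta> \<partial>lborel)"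
proof -
  have shift: "(\<integral>\<^sup>+\<theta>. f (\<theta> + c) \<partial>lborel) = (\<integral>\<^sup>+\<theta>. f \<theta> \<partial>lborel)" if "f \<in> borel_measurable borel" for f :: "real \<Rightarrow> ennreal" and c
    using nn_integral_real_affine[of f 1 c] that by (simp add: add.commute)
  have ae: "AE \<theta> in lborel. \<theta> \<noteq> c" for c :: real by (rule AE_lborel_singleton)
  have "(\<integral>\<^sup>+\<theta>\<in>{0..2*pi}. h (\<theta> - \<psi>) \<partial>lborel) = (\<integral>\<^sup>+\<theta>\<in>{-\<psi>..2*pi-\<psi>}. h \<theta> \<partial>lborel)"
    by (subst shift[of "\<lambda>\<theta>. h \<theta> * indicator {-\<psi>..2*pi-\<psi>} \<theta>" "-\<psi>", symmetric])
       (auto intro!: nn_integral_cong split: split_indicator)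
  also have "\<dots> = (\<integral>\<^sup>+\<theta>. h \<theta> * indicator {-\<psi>..<0} \<theta> + h \<theta> * indicator {0..2*pi-\<psi>} \<theta> \<partial>lborel)"
    using \<psi> by (intro nn_integral_cong) (auto split: split_indicator)
  also have "\<dots> = (\<integral>\<^sup>+\<theta>. h \<theta> * indicator {-\<psi>..<0} \<theta> \<partial>lborel) + (\<integral>\<^sup>+\<theta>. h \<theta> * indicator {0..2*pi-\<psi>} \<theta> \<partial>lborel)"
    by (rule nn_integral_add) simp_all
  also have "(\<integral>\<^sup>+\<theta>. h \<theta> * indicator {-\<psi>..<0} \<theta> \<partial>lborel) = (\<integral>\<^sup>+\<theta>. h \<theta> * indicator {2*pi-\<psi>..<2*pi} \<theta> \<partial>lborel)"
    by (subst shift[of "\<lambda>\<theta>. h \<theta> * indicator {2*pi-\<psi>..<2*pi} \<theta>" "2*pi", symmetric])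
       (auto intro!: nn_integral_cong simp: per split: split_indicator)
  also have "\<dots> + (\<integral>\<^sup>+\<theta>. h \<theta> * indicator {0..2*pi-\<psi>} \<theta> \<partial>lborel)
      = (\<integral>\<^sup>+\<theta>. h \<theta> * indicator {2*pi-\<psi>..<2*pi} \<theta> + h \<theta> * indicator {0..2*pi-\<psi>} \<theta> \<partial>lborel)"
    by (rule nn_integral_add[symmetric]) simp_all
  also have "\<dots> = (\<integral>\<^sup>+\<theta>\<in>{0..2*pi}. h \<theta> \<partial>lborel)"
    by (rule nn_integral_cong_AE, use ae[of "2*pi"] ae[of "2*pi - \<psi>"] in eventually_elim)
       (use \<psi> in \<open>auto split: split_indicator\<close>)
  finally show ?thesis .
qed

section \<open>Gaussian integrals and the Bessel function\<close>

lemma integrable_std_gauss_cexp: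
  fixes b :: real
  shows "integrable lborel (\<lambda>x::real. complex_of_real (exp (- x\<^sup>2 / 2)) * exp (\<i> * of_real b * of_real x))"
proof -
  have "integrable lborel (\<lambda>x. sqrt (2 * pi) * std_normal_density x)"
    by (intro integrable_mult_right integrable_normal_density) simp
  then have "integrable lborel (\<lambda>x::real. exp (- x\<^sup>2 / 2))"
    by (simp add: std_normal_density_def)
  then show ?thesis
    by (rule Bochner_Integration.integrable_bound) (auto simp: norm_mult)
qed

text \<open>Up to normalisation this is the characteristic function of the standard normal
  distribution.\<close>

lemma integral_std_gauss_cexp:
  "(LINT x|lborel. complex_of_real (exp (- x\<^sup>2 / 2)) * exp (\<i> * of_real b * of_real x))
    = of_real (sqrt (2 * pi) * exp (- b\<^sup>2 / 2))"
proof -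
  have "complex_of_real (exp (- b\<^sup>2 / 2)) = char std_normal_distribution b"
    by (simp add: char_std_normal_distribution)
  also have "\<dots> = (LINT x|lborel. of_real (std_normal_density x) * exp (\<i> * of_real (b * x)))"
    unfolding char_def by (subst integral_density) (simp_all add: scaleR_conv_of_real)
  also have "\<dots> = (LINT x|lborel. of_real (1 / sqrt (2 * pi)) * (complex_of_real (exp (- x\<^sup>2 / 2)) * exp (\<i> * of_real b * of_real x)))"
    by (simp add: std_normal_density_def mult_ac)
  also have "\<dots> = of_real (1 / sqrt (2 * pi)) * (LINT x|lborel. complex_of_real (exp (- x\<^sup>2 / 2)) * exp (\<i> * of_real b * of_real x))"
    by (rule integral_mult_right_zero)
  finally show ?thesis by (simp add: field_simps)
qed

text \<open>Completing the square with the real part of c only: a real affine substitution removes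
  \<open>Re c\<close>, and the characteristic function of the normal distribution deals with
  \<open>Im c\<close>, so no contour is shifted.\<close>

lemma gauss_cexp:
  fixes c :: complex
  assumes t: "0 < t"
  shows "integrable lborel (\<lambda>v::real. of_real (exp (- v\<^sup>2 / (4 * t))) * exp (c * of_real v))"
    and "(LINT v|lborel. of_real (exp (- v\<^sup>2 / (4 * t))) * exp (c * of_real v))
      = of_real (sqrt (4 * pi * t)) * exp (of_real t * c\<^sup>2)"
proof -
  define f where "f = (\<lambda>v::real. of_real (exp (- v\<^sup>2 / (4 * t))) * exp (c * of_real v))"
  define a b where "a = Re c" and "b = Im c"
  \<comment> \<open>\<open>K\<close> collects what does not depend on x after v = 2ta + sqrt(2t)
    x.\<close>
  define K where "K = exp (of_real (t * a\<^sup>2) + \<i> * of_real (2 * t * a * b))"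
  have c: "c = of_real a + \<i> * of_real b" by (simp add: a_def b_def complex_eq)
  have s: "sqrt (2 * t) * sqrt (2 * t) = 2 * t" using t by simp
  have sq: "(2 * t * a + sqrt (2 * t) * x)\<^sup>2 = 4 * t\<^sup>2 * a\<^sup>2 + 4 * t * a * sqrt (2 * t) * x + 2 * t * x\<^sup>2" for x
    using s by (simp add: power2_sum power_mult_distrib algebra_simps power2_eq_square)
  have ex: "- (2 * t * a + sqrt (2 * t) * x)\<^sup>2 / (4 * t) + a * (2 * t * a + sqrt (2 * t) * x)
      = t * a\<^sup>2 - x\<^sup>2 / 2" for x
    unfolding sq using t by (simp add: field_simps power2_eq_square)
  have f: "f (2 * t * a + sqrt (2 * t) * x)
      = K * (of_real (exp (- x\<^sup>2 / 2)) * exp (\<i> * of_real (b * sqrt (2 * t)) * of_real x))" for x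
  proof -
    have "f (2 * t * a + sqrt (2 * t) * x)
        = exp (of_real (- (2 * t * a + sqrt (2 * t) * x)\<^sup>2 / (4 * t) + a * (2 * t * a + sqrt (2 * t) * x))
            + \<i> * of_real (b * (2 * t * a + sqrt (2 * t) * x)))"
      unfolding f_def c exp_of_real[symmetric] exp_add[symmetric] by (simp add: algebra_simps)
    also have "\<dots> = exp (of_real (t * a\<^sup>2 - x\<^sup>2 / 2) + \<i> * of_real (b * (2 * t * a + sqrt (2 * t) * x)))"
      unfolding ex ..
    also have "\<dots> = K * (of_real (exp (- x\<^sup>2 / 2)) * exp (\<i> * of_real (b * sqrt (2 * t)) * of_real x))"
      unfolding K_def exp_of_real[symmetric] exp_add[symmetric] by (simp add: algebra_simps)
    finally show ?thesis .
  qed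
  have ne: "sqrt (2 * t) \<noteq> 0" using t by simp
  have "integrable lborel (\<lambda>x. f (2 * t * a + sqrt (2 * t) * x))"
    unfolding f by (intro integrable_mult_right integrable_std_gauss_cexp)
  then show "integrable lborel f"
    using lborel_integrable_real_affine_iff[OF ne] by blast
  have "(LINT v|lborel. f v) = \<bar>sqrt (2 * t)\<bar> *\<^sub>R (LINT x|lborel. f (2 * t * a + sqrt (2 * t) * x))"
    by (rule lborel_integral_real_affine[OF ne])
  also have "\<dots> = of_real (sqrt (2 * t)) * (K * of_real (sqrt (2 * pi) * exp (- (b * sqrt (2 * t))\<^sup>2 / 2)))"
    unfolding f integral_mult_right_zero integral_std_gauss_cexp using t by (simp add: scaleR_conv_of_real)
  also have "\<dots> = of_real (sqrt (2 * t) * sqrt (2 * pi)) * (K * exp (- of_real (t * b\<^sup>2)))"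
    using t by (simp add: power_mult_distrib exp_of_real[symmetric] mult.commute)
  also have "sqrt (2 * t) * sqrt (2 * pi) = sqrt (4 * pi * t)"
    by (simp add: real_sqrt_mult[symmetric] mult_ac)
  also have "K * exp (- of_real (t * b\<^sup>2)) = exp (of_real t * c\<^sup>2)"
    unfolding K_def c exp_add[symmetric]
    by (simp add: power2_sum power_mult_distrib algebra_simps)
  finally show "(LINT v|lborel. f v) = of_real (sqrt (4 * pi * t)) * exp (of_real t * c\<^sup>2)" .
qed

lemma cis_inner_plane: "cis (x \<bullet> \<zeta>) = exp (\<i> * of_real (x$1) * of_real (\<zeta>$1)) * exp (\<i> * of_real (x$2) * of_real (\<zeta>$2))"
  for x \<zeta> :: "real^2"
  by (simp add: cis_conv_exp inner_vec_def sum_2 exp_add[symmetric] algebra_simps)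

lemma exp_norm_plane: "exp (- (\<epsilon> * (norm \<zeta>)\<^sup>2 / 2)) = exp (- (\<zeta>$1)\<^sup>2 / (4 * (1 / (2 * \<epsilon>)))) * exp (- (\<zeta>$2)\<^sup>2 / (4 * (1 / (2 * \<epsilon>))))"
  for \<zeta> :: "real^2" and \<epsilon> :: real
proof -
  have "(norm \<zeta>)\<^sup>2 = (\<zeta>$1)\<^sup>2 + (\<zeta>$2)\<^sup>2"
    by (simp add: norm_eq_sqrt_inner inner_vec_def sum_2 power2_eq_square)
  then show ?thesis by (simp add: exp_add[symmetric] field_simps)
qed

lemma gauss_plane_cis:
  fixes x :: "real^2"
  assumes \<epsilon>: "0 < \<epsilon>"
  shows "integrable lborel (\<lambda>\<zeta>::real^2. cis (x \<bullet> \<zeta>) * of_real (exp (- (\<epsilon> * (norm \<zeta>)\<^sup>2 / 2))))"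
    and "(LINT \<zeta>|lborel. cis (x \<bullet> \<zeta>) * of_real (exp (- (\<epsilon> * (norm \<zeta>)\<^sup>2 / 2))))
      = of_real (2 * pi / \<epsilon> * exp (- ((norm x)\<^sup>2 / (2 * \<epsilon>))))"
proof -
  \<comment> \<open>With this t the weight exp(-v^2/(4t)) of \<open>gauss_cexp\<close> is
    exp(-\<epsilon> v^2/2).\<close>
  define t where "t = 1 / (2 * \<epsilon>)"
  have t: "0 < t" using \<epsilon> by (simp add: t_def)
  let ?f = "\<lambda>a v::real. of_real (exp (- v\<^sup>2 / (4 * t))) * exp (\<i> * of_real a * of_real v) :: complex"
  have eq: "cis (x \<bullet> \<zeta>) * of_real (exp (- (\<epsilon> * (norm \<zeta>)\<^sup>2 / 2))) = ?f (x$1) (\<zeta>$1) * ?f (x$2) (\<zeta>$2)" for \<zeta> :: "real^2"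
    unfolding cis_inner_plane exp_norm_plane t_def[symmetric] by simp
  note g = gauss_cexp[OF t]
  show "integrable lborel (\<lambda>\<zeta>::real^2. cis (x \<bullet> \<zeta>) * of_real (exp (- (\<epsilon> * (norm \<zeta>)\<^sup>2 / 2))))"
    unfolding eq by (intro integrable_plane_prod g)
  have nx: "(norm x)\<^sup>2 = (x$1)\<^sup>2 + (x$2)\<^sup>2"
    by (simp add: norm_eq_sqrt_inner inner_vec_def sum_2 power2_eq_square)
  have "(LINT \<zeta>|lborel. cis (x \<bullet> \<zeta>) * of_real (exp (- (\<epsilon> * (norm \<zeta>)\<^sup>2 / 2))))
      = (of_real (sqrt (4 * pi * t)) * exp (of_real t * (\<i> * of_real (x$1))\<^sup>2))
        * (of_real (sqrt (4 * pi * t)) * exp (of_real t * (\<i> * of_real (x$2))\<^sup>2))"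
    unfolding eq by (subst integral_plane_prod) (intro g, intro g, simp only: g)
  also have "\<dots> = of_real (sqrt (4 * pi * t) * sqrt (4 * pi * t)) * exp (of_real (- (t * ((x$1)\<^sup>2 + (x$2)\<^sup>2))))"
    by (simp only: power_mult_distrib i_squared of_real_mult mult_exp_exp[symmetric] of_real_add of_real_minus of_real_power)
       (simp add: exp_add[symmetric] distrib_left mult_ac del: of_real_mult)
  also have "sqrt (4 * pi * t) * sqrt (4 * pi * t) = 2 * pi / \<epsilon>"
    using \<epsilon> by (simp add: t_def)
  also have "exp (of_real (- (t * ((x$1)\<^sup>2 + (x$2)\<^sup>2)))) = (of_real (exp (- ((norm x)\<^sup>2 / (2 * \<epsilon>)))) :: complex)"
    unfolding nx exp_of_real by (simp add: t_def)
  finally show "(LINT \<zeta>|lborel. cis (x \<bullet> \<zeta>) * of_real (exp (- (\<epsilon> * (norm \<zeta>)\<^sup>2 / 2))))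
      = of_real (2 * pi / \<epsilon> * exp (- ((norm x)\<^sup>2 / (2 * \<epsilon>))))" by simp
qed

lemma gauss_plane_cos:
  fixes x :: "real^2"
  assumes \<epsilon>: "0 < \<epsilon>"
  shows "integrable lborel (\<lambda>\<zeta>::real^2. cos (x \<bullet> \<zeta>) * exp (- (\<epsilon> * (norm \<zeta>)\<^sup>2 / 2)))"
    and "(LINT \<zeta>|lborel. cos (x \<bullet> \<zeta>) * exp (- (\<epsilon> * (norm \<zeta>)\<^sup>2 / 2)))
      = 2 * pi / \<epsilon> * exp (- ((norm x)\<^sup>2 / (2 * \<epsilon>)))"
proof -
  have eq: "cos (x \<bullet> \<zeta>) * exp (- (\<epsilon> * (norm \<zeta>)\<^sup>2 / 2))
      = Re (cis (x \<bullet> \<zeta>) * of_real (exp (- (\<epsilon> * (norm \<zeta>)\<^sup>2 / 2))))" for \<zeta> :: "real^2"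
    by simp
  show "integrable lborel (\<lambda>\<zeta>::real^2. cos (x \<bullet> \<zeta>) * exp (- (\<epsilon> * (norm \<zeta>)\<^sup>2 / 2)))"
    unfolding eq by (intro integrable_Re gauss_plane_cis assms)
  show "(LINT \<zeta>|lborel. cos (x \<bullet> \<zeta>) * exp (- (\<epsilon> * (norm \<zeta>)\<^sup>2 / 2)))
      = 2 * pi / \<epsilon> * exp (- ((norm x)\<^sup>2 / (2 * \<epsilon>)))"
    unfolding eq by (subst integral_Re[OF gauss_plane_cis(1)[OF \<epsilon>]]) (simp only: gauss_plane_cis(2)[OF \<epsilon>] Re_complex_of_real)
qed

text \<open>Since |h| \<le> 1, the terms are dominated by the summable constants |c n| on a bounded
  interval, so sum and integral may be exchanged.\<close>

lemma power_series_integral_sums: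
  fixes c :: "nat \<Rightarrow> real" and h :: "real \<Rightarrow> real"
  assumes h: "continuous_on {l..u} h" "\<And>x. x \<in> {l..u} \<Longrightarrow> \<bar>h x\<bar> \<le> 1"
    and c: "summable (\<lambda>n. \<bar>c n\<bar>)" and lu: "l \<le> u"
  shows "(\<lambda>n. c n * (LINT x:{l..u}|lborel. h x ^ n)) sums (LINT x:{l..u}|lborel. (\<Sum>n. c n * h x ^ n))"
proof -
  let ?f = "\<lambda>n x. indicator {l..u} x * (c n * h x ^ n)"
  have int: "integrable lborel (?f n)" for n
    using borel_integrable_atLeastAtMost'[of l u "\<lambda>x. c n * h x ^ n"] h(1)
    by (simp add: set_integrable_def continuous_on_power continuous_on_mult_left)
  have bd: "norm (?f n x) \<le> indicator {l..u} x * \<bar>c n\<bar>" for n x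
    using h(2)[of x] by (auto simp: abs_mult power_abs intro!: mult_left_le power_le_one split: split_indicator)
  have "(\<lambda>n. LINT x|lborel. ?f n x) sums (LINT x|lborel. (\<Sum>n. ?f n x))"
  proof (rule sums_integral[OF int])
    show "AE x in lborel. summable (\<lambda>n. norm (?f n x))"
      by (intro AE_I2 summable_comparison_test'[OF summable_mult[OF c], of 0]) (use bd in simp)
    have "(LINT x|lborel. norm (?f n x)) \<le> (LINT x|lborel. indicator {l..u} x * \<bar>c n\<bar>)" for n
      by (intro integral_mono integrable_norm int bd integrable_mult_left integrable_real_indicator)
         (auto simp: emeasure_lborel_Icc_eq)
    also have "(LINT x|lborel. indicator {l..u} x * \<bar>c n\<bar>) = (u - l) * \<bar>c n\<bar>" for n
      using lu by simp
    finally show "summable (\<lambda>n. LINT x|lborel. norm (?f n x))"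
      by (intro summable_comparison_test'[OF summable_mult[OF c, of "u - l"], of 0]) simp
  qed
  moreover have "(LINT x|lborel. ?f n x) = c n * (LINT x:{l..u}|lborel. h x ^ n)" for n
    by (simp add: set_lebesgue_integral_def mult.left_commute flip: integral_mult_right_zero)
  moreover have "(\<Sum>n. ?f n x) = indicator {l..u} x *\<^sub>R (\<Sum>n. c n * h x ^ n)" for x
    by (auto split: split_indicator)
  ultimately show ?thesis by (simp add: set_lebesgue_integral_def)
qed

section \<open>Elementary integrals, integral representations and decay of J_0\<close>

lemma set_integral_FTC_real:
  fixes F f :: "real \<Rightarrow> real"
  assumes "a \<le> b" "\<And>x. (F has_real_derivative f x) (at x)" "continuous_on UNIV f"
  shows "(LINT x:{a..b}|lborel. f x) = F b - F a"
  unfolding set_lebesgue_integral_def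
  using assms by (intro integral_FTC_atLeastAtMost)
    (auto simp: has_real_derivative_iff_has_vector_derivative[symmetric] intro: has_field_derivative_at_within continuous_on_subset)

text \<open>Wallis recursion: cos^(2m+1) sin vanishes at both ends, and its derivative is (2m+2)
  cos^(2m+2) - (2m+1) cos^(2m).\<close>

lemma integral_cos_power: "(LINT \<theta>:{0..2*pi}|lborel. ((cos \<theta>)\<^sup>2) ^ m) = 2 * pi * fact (2*m) / (4 ^ m * (fact m)\<^sup>2)"
proof (induction m)
  case 0
  then show ?case by (simp add: set_lebesgue_integral_def)
next
  case (Suc m)
  have solve: "X = b / a * Y" if "a * X = b * Y" "a \<noteq> 0" for a b X Y :: real
    using that by (simp add: field_simps)
  have I: "set_integrable lborel {0..2*pi} (\<lambda>\<theta>. a * ((cos \<theta>)\<^sup>2) ^ k)" for k a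
    by (intro borel_integrable_atLeastAtMost' continuous_intros)
  have "(LINT \<theta>:{0..2*pi}|lborel. (2*m+2) * ((cos \<theta>)\<^sup>2) ^ (Suc m) - (2*m+1) * ((cos \<theta>)\<^sup>2) ^ m)
      = cos (2*pi) ^ (2*m+1) * sin (2*pi) - cos 0 ^ (2*m+1) * sin 0"
  proof (rule set_integral_FTC_real)
    fix x :: real
    have "((\<lambda>x. cos x ^ (2*m+1) * sin x) has_real_derivative
        (2*m+1) * cos x ^ (2*m) * (- sin x) * sin x + cos x ^ (2*m+1) * cos x) (at x)"
      using DERIV_mult[OF DERIV_power_Suc[OF DERIV_cos[of x], of "2*m"] DERIV_sin] by (simp add: algebra_simps)
    also have "(2*m+1) * cos x ^ (2*m) * (- sin x) * sin x + cos x ^ (2*m+1) * cos x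
        = (2*m+2) * ((cos x)\<^sup>2) ^ (Suc m) - (2*m+1) * ((cos x)\<^sup>2) ^ m"
    proof -
      define C where "C = cos x ^ (2*m)"
      have gen: "k * C * (- s) * s + C * c * c = (k + 1) * (C * c\<^sup>2) - k * C"
        if "s * s = 1 - c * c" for k s c :: real
      proof -
        have "k * C * (- s) * s + C * c * c = - (k * C * (1 - c * c)) + C * c * c" by (simp add: that[symmetric])
        also have "\<dots> = (k + 1) * (C * c\<^sup>2) - k * C" by (simp add: algebra_simps power2_eq_square)
        finally show ?thesis .
      qed
      have "sin x * sin x = 1 - cos x * cos x" using sin_cos_squared_add3[of x] by linarith
      from gen[OF this, of "real (2*m+1)"]
      have "(2*m+1) * C * (- sin x) * sin x + C * cos x * cos x = (2*m+2) * (C * (cos x)\<^sup>2) - (2*m+1) * C"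
        by (simp add: add_ac)
      moreover have "((cos x)\<^sup>2) ^ m = C" "((cos x)\<^sup>2) ^ Suc m = C * (cos x)\<^sup>2" "cos x ^ (2*m+1) = C * cos x"
        by (simp_all add: C_def flip: power_mult)
      ultimately show ?thesis by (simp only: C_def[symmetric])
    qed
    finally show "((\<lambda>x. cos x ^ (2*m+1) * sin x) has_real_derivative (2*m+2) * ((cos x)\<^sup>2) ^ (Suc m) - (2*m+1) * ((cos x)\<^sup>2) ^ m) (at x)" .
  qed (auto intro!: continuous_intros)
  then have "(2*m+2) * (LINT \<theta>:{0..2*pi}|lborel. ((cos \<theta>)\<^sup>2) ^ (Suc m)) = (2*m+1) * (LINT \<theta>:{0..2*pi}|lborel. ((cos \<theta>)\<^sup>2) ^ m)"
    by (subst (asm) set_integral_diff(2)[OF I I]) simp_all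
  then have "(LINT \<theta>:{0..2*pi}|lborel. ((cos \<theta>)\<^sup>2) ^ (Suc m)) = (2*m+1) / (2*m+2) * (2 * pi * fact (2*m) / (4 ^ m * (fact m)\<^sup>2))"
    unfolding Suc.IH by (rule solve) simp
  also have "\<dots> = 2 * pi * fact (2*Suc m) / (4 ^ Suc m * (fact (Suc m))\<^sup>2)"
    by (simp add: divide_simps power2_eq_square) (simp add: algebra_simps)
  finally show ?case .
qed

text \<open>The recursion comes from x (1 - x^2)^(m+1), which vanishes at -1 and 1.\<close>

lemma integral_one_minus_square_power:
  "(LINT x:{-1..1::real}|lborel. (1 - x\<^sup>2) ^ m) = 2 * 4 ^ m * (fact m)\<^sup>2 / fact (2*m+1)"
proof (induction m)
  case 0
  then show ?case by (simp add: set_lebesgue_integral_def)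
next
  case (Suc m)
  have solve: "X = b / a * Y" if "a * X = b * Y" "a \<noteq> 0" for a b X Y :: real
    using that by (simp add: field_simps)
  have I: "set_integrable lborel {-1..1} (\<lambda>x::real. a * (1 - x\<^sup>2) ^ k)" for k a
    by (intro borel_integrable_atLeastAtMost' continuous_intros)
  have "(LINT x:{-1..1}|lborel. (2*m+3) * (1 - x\<^sup>2) ^ (Suc m) - 2*(m+1) * (1 - x\<^sup>2) ^ m)
      = 1 * (1 - 1\<^sup>2) ^ Suc m - (- 1) * (1 - (-1)\<^sup>2) ^ Suc m"
  proof (rule set_integral_FTC_real)
    fix x :: real
    have "((\<lambda>x. x * (1 - x\<^sup>2) ^ Suc m) has_real_derivative
        (1 - x\<^sup>2) ^ Suc m + x * ((1 + real m) * (1 - x\<^sup>2) ^ m * (- (2 * x)))) (at x)"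
    proof (rule DERIV_cong)
      have "((\<lambda>x::real. 1 - x\<^sup>2) has_real_derivative - (2 * x)) (at x)" by (auto intro!: derivative_eq_intros)
      from DERIV_mult[OF DERIV_ident DERIV_power_Suc[OF this, of m]]
      show "((\<lambda>x. x * (1 - x\<^sup>2) ^ Suc m) has_real_derivative
          1 * (1 - x\<^sup>2) ^ Suc m + (1 + of_nat m) * (- (2 * x) * (1 - x\<^sup>2) ^ m) * x) (at x)" .
    qed simp
    also have "(1 - x\<^sup>2) ^ Suc m + x * ((1 + real m) * (1 - x\<^sup>2) ^ m * (- (2 * x)))
        = (2*m+3) * (1 - x\<^sup>2) ^ (Suc m) - 2*(m+1) * (1 - x\<^sup>2) ^ m"
      by (simp add: power2_eq_square algebra_simps)
    finally show "((\<lambda>x. x * (1 - x\<^sup>2) ^ Suc m) has_real_derivative (2*m+3) * (1 - x\<^sup>2) ^ (Suc m) - 2*(m+1) * (1 - x\<^sup>2) ^ m) (at x)" .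
  qed (auto intro!: continuous_intros)
  then have "(2*m+3) * (LINT x:{-1..1}|lborel. (1 - x\<^sup>2) ^ (Suc m)) = 2*(m+1) * (LINT x:{-1..1}|lborel. (1 - x\<^sup>2) ^ m)"
    by (subst (asm) set_integral_diff(2)[OF I I]) simp_all
  then have "(LINT x:{-1..1}|lborel. (1 - x\<^sup>2) ^ (Suc m)) = 2*(m+1) / (2*m+3) * (2 * 4 ^ m * (fact m)\<^sup>2 / fact (2*m+1))"
    unfolding Suc.IH by (rule solve) simp
  also have "\<dots> = 2 * 4 ^ Suc m * (fact (Suc m))\<^sup>2 / fact (2*Suc m+1)"
    by (simp add: divide_simps power2_eq_square) (simp add: algebra_simps)
  finally show ?case .
qed

text \<open>Coefficients of J_0 as an entire function of q = (z/2)^2, the variable in which Bessel's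
  equation reads q B'' + B' + B = 0.\<close>

definition J0_coeff :: "nat \<Rightarrow> real" where "J0_coeff m = (-1) ^ m / (fact m)\<^sup>2"

lemma summable_J0_abs: "summable (\<lambda>m. \<bar>J0_coeff m * q ^ m\<bar>)"
proof (rule summable_comparison_test'[OF summable_norm_exp[of q], of 0])
  fix m :: nat
  have "1 \<le> (fact m :: real)" by simp
  then have "inverse ((fact m)\<^sup>2) \<le> (inverse (fact m) :: real)"
    by (intro le_imp_inverse_le) (simp_all add: power2_eq_square)
  then show "norm \<bar>J0_coeff m * q ^ m\<bar> \<le> norm (q ^ m /\<^sub>R fact m)"
    using mult_right_mono[of "inverse ((fact m)\<^sup>2)" "inverse (fact m)" "\<bar>q\<bar> ^ m"]
    by (simp add: J0_coeff_def abs_mult power_abs divide_inverse mult.commute)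
qed

lemma summable_J0: "summable (\<lambda>m. J0_coeff m * q ^ m)"
  using summable_J0_abs by (rule summable_rabs_cancel)

lemma bessel_J0_eq: "bessel_J0 z = (\<Sum>m. J0_coeff m * ((z / 2)\<^sup>2) ^ m)"
  by (simp add: bessel_J0_def J0_coeff_def power_mult)

text \<open>The cosine series is integrated term by term. Consequently J_0(|x||y|) is the mean of
  plane waves over a circle, which is how the positivity argument and the bound |J_0| \<le> 1 use
  it.\<close>

lemma bessel_J0_integral: "(LINT \<theta>:{0..2*pi}|lborel. cos (z * cos \<theta>)) = 2 * pi * bessel_J0 z"
proof -
  define c where "c = (\<lambda>m. (-1) ^ m * z ^ (2*m) / fact (2*m))"
  have sc: "(\<lambda>m. (-1) ^ m / fact (2*m) * w ^ (2*m)) sums cos w" for w :: real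
  proof -
    have "(\<lambda>m. \<Sum>i = m*2..<m*2+2. cos_coeff i * w ^ i) sums cos w"
      using cos_converges[of w] by (intro sums_group) (auto simp: real_scaleR_def)
    then show ?thesis by (simp add: cos_coeff_def mult.commute)
  qed
  have abs: "summable (\<lambda>m. \<bar>c m\<bar>)"
  proof -
    have "summable (\<lambda>n. norm (z ^ n /\<^sub>R fact n))" by (rule summable_norm_exp)
    then have "summable (\<lambda>m. \<Sum>i = m*2..<m*2+2. norm (z ^ i /\<^sub>R fact i))"
      by (rule sums_summable[OF sums_group[OF summable_sums]]) simp
    then show ?thesis
      by (rule summable_comparison_test'[of _ 0])
         (simp add: c_def abs_mult power_abs divide_inverse mult.commute)
  qed
  have "(\<lambda>m. c m * (LINT \<theta>:{0..2*pi}|lborel. ((cos \<theta>)\<^sup>2) ^ m)) sums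
      (LINT \<theta>:{0..2*pi}|lborel. (\<Sum>m. c m * ((cos \<theta>)\<^sup>2) ^ m))"
    by (intro power_series_integral_sums abs continuous_intros) (auto simp: abs_square_le_1)
  moreover have "(\<Sum>m. c m * ((cos \<theta>)\<^sup>2) ^ m) = cos (z * cos \<theta>)" for \<theta>
    using sc[of "z * cos \<theta>"] by (simp add: sums_iff c_def power_mult_distrib mult_ac flip: power_mult)
  moreover have "c m * (LINT \<theta>:{0..2*pi}|lborel. ((cos \<theta>)\<^sup>2) ^ m) = 2 * pi * (J0_coeff m * ((z / 2)\<^sup>2) ^ m)" for m
    unfolding integral_cos_power c_def J0_coeff_def
    by (simp add: power_divide mult_ac power_even_eq flip: power_mult)
  ultimately have "(\<lambda>m. 2 * pi * (J0_coeff m * ((z / 2)\<^sup>2) ^ m)) sums (LINT \<theta>:{0..2*pi}|lborel. cos (z * cos \<theta>))"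
    by simp
  then show ?thesis
    unfolding bessel_J0_eq by (metis sums_unique suminf_mult summable_J0)
qed

lemma abs_bessel_J0_le_1: "\<bar>bessel_J0 z\<bar> \<le> 1"
proof -
  have "set_integrable lborel {0..2*pi} (\<lambda>\<theta>. cos (z * cos \<theta>))"
    by (intro borel_integrable_atLeastAtMost' continuous_intros)
  then have I: "integrable lborel (\<lambda>\<theta>. indicat_real {0..2 * pi} \<theta> * cos (z * cos \<theta>))"
    by (simp add: set_integrable_def)
  have "\<bar>2 * pi * bessel_J0 z\<bar> \<le> (LINT \<theta>:{0..2*pi}|lborel. (1::real))"
    unfolding bessel_J0_integral[symmetric] set_lebesgue_integral_def
    by (rule integral_abs_bound[THEN order_trans], rule integral_mono)
       (auto intro!: integrable_abs I split: split_indicator)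
  also have "\<dots> = 2 * pi" by (simp add: set_lebesgue_integral_def)
  finally show ?thesis by (simp add: abs_mult)
qed

text \<open>Slice the unit sphere by height x: by Archimedes dx is its surface measure up to a
  constant, and the slice of radius sqrt(1 - x^2) contributes a J_0. The factor z on the left
  includes the case z = 0.\<close>

lemma sinc_eq_integral_J0: "z * (LINT x:{-1..1}|lborel. bessel_J0 (z * sqrt (1 - x\<^sup>2))) = 2 * sin z"
proof -
  define c where "c = (\<lambda>m. J0_coeff m * ((z / 2)\<^sup>2) ^ m)"
  have "(\<lambda>m. c m * (LINT x:{-1..1}|lborel. (1 - x\<^sup>2) ^ m)) sums (LINT x:{-1..1}|lborel. (\<Sum>m. c m * (1 - x\<^sup>2) ^ m))"
    using summable_J0_abs[of "(z/2)\<^sup>2"]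
    by (intro power_series_integral_sums continuous_intros) (auto simp: abs_square_le_1 c_def)
  also have "(LINT x:{-1..1}|lborel. (\<Sum>m. c m * (1 - x\<^sup>2) ^ m)) = (LINT x:{-1..1}|lborel. bessel_J0 (z * sqrt (1 - x\<^sup>2)))"
  proof (intro set_lebesgue_integral_cong allI impI)
    fix x :: real assume "x \<in> {-1..1}"
    then have "x\<^sup>2 \<le> 1" by (auto simp: abs_square_le_1 abs_le_iff)
    then have eq: "(z * sqrt (1 - x\<^sup>2) / 2)\<^sup>2 = (z / 2)\<^sup>2 * (1 - x\<^sup>2)"
      by (simp add: power_mult_distrib power_divide)
    show "(\<Sum>m. c m * (1 - x\<^sup>2) ^ m) = bessel_J0 (z * sqrt (1 - x\<^sup>2))"
      unfolding bessel_J0_eq eq c_def by (simp only: power_mult_distrib[of "(z / 2)\<^sup>2"] mult.assoc)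
  qed simp
  finally have A: "(\<lambda>m. z * (c m * (LINT x:{-1..1}|lborel. (1 - x\<^sup>2) ^ m))) sums (z * (LINT x:{-1..1}|lborel. bessel_J0 (z * sqrt (1 - x\<^sup>2))))"
    by (rule sums_mult)
  have B: "z * (c m * (LINT x:{-1..1}|lborel. (1 - x\<^sup>2) ^ m)) = 2 * ((-1) ^ m / fact (2*m+1) * z ^ (2*m+1))" for m
  proof -
    have "((z / 2)\<^sup>2) ^ m * 4 ^ m = z ^ (2*m)"
      by (simp add: power_mult power_divide)
    then have "z * (c m * (LINT x:{-1..1}|lborel. (1 - x\<^sup>2) ^ m)) = 2 * ((-1) ^ m / fact (2*m+1) * (z * z ^ (2*m)))"
      unfolding integral_one_minus_square_power c_def J0_coeff_def by (simp add: mult_ac)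
    then show ?thesis by simp
  qed
  have C: "(\<lambda>m. 2 * ((-1) ^ m / fact (2*m+1) * z ^ (2*m+1))) sums (2 * sin z)"
  proof -
    have "(\<lambda>m. \<Sum>i = m*2..<m*2+2. sin_coeff i * z ^ i) sums sin z"
      using sin_converges[of z] by (intro sums_group) (auto simp: real_scaleR_def)
    then have "(\<lambda>m. (-1) ^ m / fact (2*m+1) * z ^ (2*m+1)) sums sin z"
      by (simp add: sin_coeff_def mult.commute)
    then show ?thesis by (rule sums_mult)
  qed
  show ?thesis by (rule sums_unique2[OF A[unfolded B] C])
qed

text \<open>With \<open>a = J\<^sub>0\<close> and \<open>b = J\<^sub>0'\<close> the energy \<open>z (a\<^sup>2 + b\<^sup>2) + a b + a\<^sup>2 / (2 z)\<close> of the
  Liouville normal form of Bessel's equation is nonincreasing.\<close>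

lemma bessel_J0_decay: "\<exists>C>0. \<forall>z>0. \<bar>bessel_J0 z\<bar> \<le> C / sqrt z"
proof -
  define B0 where "B0 = (\<lambda>q. \<Sum>n. J0_coeff n * q ^ n)"
  define B1 where "B1 = (\<lambda>q. \<Sum>n. diffs J0_coeff n * q ^ n)"
  define B2 where "B2 = (\<lambda>q. \<Sum>n. diffs (diffs J0_coeff) n * q ^ n)"
  have s0: "summable (\<lambda>n. J0_coeff n * q ^ n)" for q by (rule summable_J0)
  have s1: "summable (\<lambda>n. diffs J0_coeff n * q ^ n)" for q by (rule termdiff_converges_all[OF s0])
  have s2: "summable (\<lambda>n. diffs (diffs J0_coeff) n * q ^ n)" for q by (rule termdiff_converges_all[OF s1])
  have d0: "(B0 has_real_derivative B1 q) (at q)" for q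
    unfolding B0_def B1_def by (rule termdiffs_strong_converges_everywhere[OF s0])
  have d1: "(B1 has_real_derivative B2 q) (at q)" for q
    unfolding B1_def B2_def by (rule termdiffs_strong_converges_everywhere[OF s1])
  have ode: "q * B2 q = - B1 q - B0 q" for q
  proof -
    \<comment> \<open>Bessel's equation in the variable q, coefficient by coefficient.\<close>
    have c: "real n * diffs J0_coeff n + diffs J0_coeff n + J0_coeff n = 0" for n
      by (simp add: diffs_def J0_coeff_def divide_simps power2_eq_square) (simp add: algebra_simps)
    have "(\<lambda>n. diffs (diffs J0_coeff) n * q ^ n) sums B2 q"
      using s2 unfolding B2_def by (rule summable_sums)
    then have "(\<lambda>n. q * (diffs (diffs J0_coeff) n * q ^ n)) sums (q * B2 q)" by (rule sums_mult)
    then have "(\<lambda>n. real (Suc n) * diffs J0_coeff (Suc n) * q ^ Suc n) sums (q * B2 q)"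
      by (simp add: diffs_def mult_ac)
    then have 1: "(\<lambda>n. real n * diffs J0_coeff n * q ^ n) sums (q * B2 q)"
      using sums_Suc_iff[of "\<lambda>n. real n * diffs J0_coeff n * q ^ n" "q * B2 q"] by simp
    have "(\<lambda>n. real n * diffs J0_coeff n * q ^ n + diffs J0_coeff n * q ^ n + J0_coeff n * q ^ n) sums (q * B2 q + B1 q + B0 q)"
      using s0 s1 unfolding B1_def B0_def by (intro sums_add 1 summable_sums)
    moreover have "real n * diffs J0_coeff n * q ^ n + diffs J0_coeff n * q ^ n + J0_coeff n * q ^ n = 0" for n
      using c[of n] by (simp only: distrib_right[symmetric] mult_zero_left)
    ultimately have "(\<lambda>n. 0) sums (q * B2 q + B1 q + B0 q)" by simp
    then show ?thesis by (simp add: sums_iff)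
  qed
  define a where "a = (\<lambda>z::real. B0 (z\<^sup>2 / 4))"
  define b where "b = (\<lambda>z::real. z / 2 * B1 (z\<^sup>2 / 4))"
  have a: "bessel_J0 z = a z" for z by (simp add: bessel_J0_eq a_def B0_def power_divide)
  have da: "(a has_real_derivative b z) (at z)" for z
    unfolding a_def b_def by (rule DERIV_cong, rule DERIV_chain2[OF d0], rule derivative_intros)+ (auto intro!: derivative_eq_intros)
  have db: "(b has_real_derivative - b z / z - a z) (at z)" if "z > 0" for z
  proof -
    have "(b has_real_derivative (1/2 * B1 (z\<^sup>2/4) + z / 2 * (B2 (z\<^sup>2/4) * (z / 2)))) (at z)"
      unfolding b_def by (auto intro!: derivative_eq_intros DERIV_chain2[OF d1])
    moreover have "1/2 * B1 (z\<^sup>2/4) + z / 2 * (B2 (z\<^sup>2/4) * (z / 2)) = - b z / z - a z"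
    proof -
      have "z / 2 * (B2 (z\<^sup>2/4) * (z / 2)) = z\<^sup>2/4 * B2 (z\<^sup>2/4)" by (simp add: power2_eq_square)
      moreover have "b z / z = 1/2 * B1 (z\<^sup>2/4)" using that by (simp add: b_def)
      ultimately show ?thesis unfolding ode by (simp only: a_def)
    qed
    ultimately show ?thesis by simp
  qed
  define E where "E = (\<lambda>z. z * ((a z)\<^sup>2 + (b z)\<^sup>2) + a z * b z + (a z)\<^sup>2 / (2 * z))"
  have dE: "(E has_real_derivative - (a z)\<^sup>2 / (2 * z\<^sup>2)) (at z)" if "z > 0" for z
  proof -
    have "(E has_real_derivative
        (1 * ((a z)\<^sup>2 + (b z)\<^sup>2) + z * (2 * a z * b z + 2 * b z * (- b z / z - a z)))
        + (b z * b z + a z * (- b z / z - a z))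
        + ((2 * a z * b z) * (2 * z) - (a z)\<^sup>2 * 2) / (2 * z)\<^sup>2) (at z)"
      unfolding E_def using that
      by (auto intro!: derivative_eq_intros da db simp: power2_eq_square)
    moreover have "(1 * ((a z)\<^sup>2 + (b z)\<^sup>2) + z * (2 * a z * b z + 2 * b z * (- b z / z - a z)))
        + (b z * b z + a z * (- b z / z - a z))
        + ((2 * a z * b z) * (2 * z) - (a z)\<^sup>2 * 2) / (2 * z)\<^sup>2 = - (a z)\<^sup>2 / (2 * z\<^sup>2)"
      using that by (simp add: field_simps power2_eq_square)
    ultimately show ?thesis by simp
  qed
  have mono: "E z \<le> E 1" if "1 \<le> z" for z
  proof (rule DERIV_nonpos_imp_nonincreasing[OF that])
    fix x :: real assume "1 \<le> x"
    then show "\<exists>y. (E has_real_derivative y) (at x) \<and> y \<le> 0"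
      using dE[of x] by (intro exI[of _ "- (a x)\<^sup>2 / (2 * x\<^sup>2)"]) simp
  qed
  \<comment> \<open>The square of 2zb + a absorbs the mixed term ab of the energy, so z a^2 alone is
    left as a lower bound.\<close>
  have low: "z * (a z)\<^sup>2 \<le> E z" if "1 \<le> z" for z
  proof -
    have "0 \<le> (2 * z * b z + a z)\<^sup>2 / (4 * z)" using that by simp
    also have "\<dots> = z * (b z)\<^sup>2 + a z * b z + (a z)\<^sup>2 / (4 * z)"
      using that by (simp add: field_simps power2_eq_square)
    also have "\<dots> \<le> z * (b z)\<^sup>2 + a z * b z + (a z)\<^sup>2 / (2 * z)"
      using that by (intro add_left_mono divide_left_mono) auto
    finally show ?thesis by (simp add: E_def algebra_simps)
  qed
  \<comment> \<open>The energy controls z \<ge> 1; for z \<le> 1 the trivial bound |J_0| \<le> 1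
    suffices because there 1 \<le> 1/sqrt z.\<close>
  define C where "C = max 1 (sqrt (E 1))"
  have "\<bar>bessel_J0 z\<bar> \<le> C / sqrt z" if "z > 0" for z
  proof (cases "z \<le> 1")
    case True
    have "\<bar>bessel_J0 z\<bar> \<le> 1" by (rule abs_bessel_J0_le_1)
    also have "1 \<le> C / sqrt z" using True that by (simp add: C_def le_divide_eq max.coboundedI1)
    finally show ?thesis .
  next
    case False
    then have "z * (a z)\<^sup>2 \<le> E 1" using low[of z] mono[of z] by simp
    then have "sqrt (z * (a z)\<^sup>2) \<le> sqrt (E 1)" by (rule real_sqrt_le_mono)
    then have "sqrt z * \<bar>a z\<bar> \<le> C" by (simp add: real_sqrt_mult C_def)
    then show ?thesis using that by (simp add: a le_divide_eq mult.commute)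
  qed
  moreover have "C > 0" by (simp add: C_def)
  ultimately show ?thesis by blast
qed

lemma continuous_on_bessel_J0: "continuous_on UNIV bessel_J0"
proof -
  have "isCont (\<lambda>q. \<Sum>n. J0_coeff n * q ^ n) q" for q
    using termdiffs_strong_converges_everywhere[OF summable_J0] by (rule DERIV_isCont)
  then have "continuous_on UNIV (\<lambda>q. \<Sum>n. J0_coeff n * q ^ n)"
    by (simp add: continuous_on_eq_continuous_at)
  from continuous_on_compose2[OF this, of UNIV "\<lambda>z. (z/2)\<^sup>2"] show ?thesis
    by (simp add: bessel_J0_eq[abs_def] continuous_on_power continuous_on_divide)
qed

lemma borel_measurable_bessel_J0 [measurable]: "bessel_J0 \<in> borel_measurable borel"
  by (rule borel_measurable_continuous_onI[OF continuous_on_bessel_J0])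

section \<open>The symbol of the propagator\<close>

text \<open>The solution of y'' = X y with y(0) = 0 and y'(0) = 1, kept real for every sign of X.
  Both the symbol and sinh(av)/a are instances. Its derivative is \<open>coshc\<close>.\<close>

definition sinhc :: "real \<Rightarrow> real \<Rightarrow> real" where
  "sinhc X t = (if X < 0 then sin (sqrt (-X) * t) / sqrt (-X) else if X = 0 then t else sinh (sqrt X * t) / sqrt X)"

definition coshc :: "real \<Rightarrow> real \<Rightarrow> real" where
  "coshc X t = (if X < 0 then cos (sqrt (-X) * t) else cosh (sqrt X * t))"

lemma borel_measurable_sinhc [measurable (raw)]:
  assumes [measurable]: "f \<in> borel_measurable M" "g \<in> borel_measurable M"
  shows "(\<lambda>x. sinhc (f x) (g x)) \<in> borel_measurable M"
  unfolding sinhc_def sinh_field_def by measurable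

lemma sinhc_deriv: "(sinhc X has_real_derivative coshc X t) (at t)"
proof -
  consider "X < 0" | "X = 0" | "X > 0" by linarith
  then show ?thesis
  proof cases
    case 1
    then have "sinhc X = (\<lambda>t. sin (sqrt (-X) * t) / sqrt (-X))" by (simp add: sinhc_def fun_eq_iff)
    moreover have "((\<lambda>t. sin (m * t) / m) has_real_derivative cos (m * t)) (at t)" if "m \<noteq> 0" for m :: real
      using that by (auto intro!: derivative_eq_intros)
    ultimately show ?thesis using 1 by (simp add: coshc_def)
  next
    case 2
    then have "sinhc X = (\<lambda>t. t)" by (simp add: sinhc_def fun_eq_iff)
    then show ?thesis using 2 by (auto intro!: derivative_eq_intros simp: coshc_def)
  next
    case 3
    then have "sinhc X = (\<lambda>t. sinh (sqrt X * t) / sqrt X)" by (simp add: sinhc_def fun_eq_iff)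
    moreover have "((\<lambda>t. sinh (m * t) / m) has_real_derivative cosh (m * t)) (at t)" if "m \<noteq> 0" for m :: real
      using that by (auto intro!: derivative_eq_intros)
    ultimately show ?thesis using 3 by (simp add: coshc_def)
  qed
qed

lemma coshc_deriv: "(coshc X has_real_derivative X * sinhc X t) (at t)"
proof -
  consider "X < 0" | "X = 0" | "X > 0" by linarith
  then show ?thesis
  proof cases
    case 1
    have "sqrt (-X) = (-X) / sqrt (-X)" by (rule real_div_sqrt[symmetric]) (use 1 in simp)
    then have "sin (sqrt (-X) * t) * sqrt (-X) = sin (sqrt (-X) * t) * ((-X) / sqrt (-X))" by simp
    moreover have "coshc X = (\<lambda>t. cos (sqrt (-X) * t))" using 1 by (simp add: coshc_def fun_eq_iff)
    moreover have "((\<lambda>t. cos (sqrt (-X) * t)) has_real_derivative - (sin (sqrt (-X) * t) * sqrt (-X))) (at t)"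
      by (auto intro!: derivative_eq_intros)
    ultimately show ?thesis using 1 by (simp add: sinhc_def mult_ac)
  next
    case 2
    then have "coshc X = (\<lambda>t. 1)" by (simp add: coshc_def fun_eq_iff)
    then show ?thesis using 2 by (auto intro!: derivative_eq_intros simp: sinhc_def)
  next
    case 3
    have "sqrt X = X / sqrt X" by (rule real_div_sqrt[symmetric]) (use 3 in simp)
    then have "sinh (sqrt X * t) * sqrt X = sinh (sqrt X * t) * (X / sqrt X)" by simp
    moreover have "coshc X = (\<lambda>t. cosh (sqrt X * t))" using 3 by (simp add: coshc_def fun_eq_iff)
    moreover have "((\<lambda>t. cosh (sqrt X * t)) has_real_derivative (sinh (sqrt X * t) * sqrt X)) (at t)"
      by (auto intro!: derivative_eq_intros)
    ultimately show ?thesis using 3 by (simp add: sinhc_def mult_ac)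
  qed
qed

lemma sinhc_0 [simp]: "sinhc X 0 = 0" and coshc_0 [simp]: "coshc X 0 = 1"
  by (simp_all add: sinhc_def coshc_def)

lemma constant_if_deriv_0:
  fixes f :: "real \<Rightarrow> real"
  assumes "\<And>t. (f has_real_derivative 0) (at t)"
  shows "f t = f 0"
  using DERIV_isconst_all[of f] assms by blast

lemma coshc_sinhc_identity: "(coshc X t)\<^sup>2 - X * (sinhc X t)\<^sup>2 = 1"
proof -
  have "(coshc X t)\<^sup>2 - X * (sinhc X t)\<^sup>2 = (coshc X 0)\<^sup>2 - X * (sinhc X 0)\<^sup>2"
    by (rule constant_if_deriv_0)
       (auto intro!: derivative_eq_intros sinhc_deriv coshc_deriv simp: power2_eq_square)
  then show ?thesis by simp
qed

text \<open>Two combinations of y and y' with \<open>sinhc\<close> and \<open>coshc\<close> have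
  derivative 0; as a linear system for y they have determinant 1 by
  \<open>coshc_sinhc_identity\<close>.\<close>

lemma sinhc_unique:
  assumes y: "\<And>t. (y has_real_derivative y' t) (at t)"
    and y': "\<And>t. (y' has_real_derivative X * y t) (at t)"
    and init: "y 0 = 0" "y' 0 = 1"
  shows "y t = sinhc X t"
proof -
  have "coshc X t * y' t - X * (sinhc X t * y t) = coshc X 0 * y' 0 - X * (sinhc X 0 * y 0)"
    by (rule constant_if_deriv_0)
       (auto intro!: derivative_eq_intros sinhc_deriv coshc_deriv y y' simp: algebra_simps)
  then have 1: "coshc X t * y' t - X * (sinhc X t * y t) = 1" by (simp add: init)
  have "coshc X t * y t - sinhc X t * y' t = coshc X 0 * y 0 - sinhc X 0 * y' 0"
    by (rule constant_if_deriv_0)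
       (auto intro!: derivative_eq_intros sinhc_deriv coshc_deriv y y' simp: algebra_simps)
  then have 2: "coshc X t * y t - sinhc X t * y' t = 0" by (simp add: init)
  have "y t = ((coshc X t)\<^sup>2 - X * (sinhc X t)\<^sup>2) * y t" by (simp add: coshc_sinhc_identity)
  also have "\<dots> = coshc X t * (coshc X t * y t - sinhc X t * y' t) + sinhc X t * (coshc X t * y' t - X * (sinhc X t * y t))"
    by (simp add: algebra_simps power2_eq_square)
  finally show ?thesis by (simp add: 1 2)
qed

text \<open>The substitution y = exp(-k^2 t/2) z removes the first-order term and leaves z'' =
  (k^4/4 - k^2) z.\<close>

lemma solves_symbol_ode_1:
  "solves_symbol_ode 1 k (\<lambda>t. exp (- (k\<^sup>2 * t / 2)) * sinhc (k^4 / 4 - k\<^sup>2) t)"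
proof -
  define X where "X = k^4 / 4 - k\<^sup>2"
  define E where "E = (\<lambda>t. exp (- (k\<^sup>2 * t / 2)))"
  have X: "X = k\<^sup>2 / 2 * (k\<^sup>2 / 2) - k\<^sup>2"
    by (simp add: X_def power4_eq_xxxx power2_eq_square)
  have E: "(E has_real_derivative (- (k\<^sup>2 / 2) * E t)) (at t)" for t
    unfolding E_def by (auto intro!: derivative_eq_intros)
  have 1: "((\<lambda>t. E t * sinhc X t) has_real_derivative (E t * (coshc X t - k\<^sup>2 / 2 * sinhc X t))) (at t)" for t
    by (auto intro!: derivative_eq_intros E sinhc_deriv simp: algebra_simps)
  have 2: "((\<lambda>t. E t * (coshc X t - k\<^sup>2 / 2 * sinhc X t)) has_real_derivative
      (- k\<^sup>2 * (E t * (coshc X t - k\<^sup>2 / 2 * sinhc X t)) - k\<^sup>2 * (E t * sinhc X t))) (at t)" for t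
  proof (rule DERIV_cong)
    show "((\<lambda>t. E t * (coshc X t - k\<^sup>2 / 2 * sinhc X t)) has_real_derivative
      (- (k\<^sup>2 / 2) * E t) * (coshc X t - k\<^sup>2 / 2 * sinhc X t) + (X * sinhc X t - k\<^sup>2 / 2 * coshc X t) * E t) (at t)"
      by (intro DERIV_mult E DERIV_diff coshc_deriv DERIV_cmult sinhc_deriv)
    show "(- (k\<^sup>2 / 2) * E t) * (coshc X t - k\<^sup>2 / 2 * sinhc X t) + (X * sinhc X t - k\<^sup>2 / 2 * coshc X t) * E t
      = (- k\<^sup>2 * (E t * (coshc X t - k\<^sup>2 / 2 * sinhc X t)) - k\<^sup>2 * (E t * sinhc X t))"
      unfolding X by (simp add: algebra_simps)
  qed
  show ?thesis
    unfolding solves_symbol_ode_def X_def[symmetric] E_def[symmetric]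
    by (rule exI[of _ "\<lambda>t. E t * (coshc X t - k\<^sup>2 / 2 * sinhc X t)"]) (use 1 2 in \<open>auto simp: E_def\<close>)
qed

text \<open>The same substitution read backwards. Uniqueness is what gives the definite description
  in \<open>S_hat\<close> its meaning.\<close>

lemma solves_symbol_ode_1_unique:
  assumes "solves_symbol_ode 1 k y"
  shows "y = (\<lambda>t. exp (- (k\<^sup>2 * t / 2)) * sinhc (k^4 / 4 - k\<^sup>2) t)"
proof
  fix t
  define X where "X = k^4 / 4 - k\<^sup>2"
  define E where "E = (\<lambda>t. exp (k\<^sup>2 * t / 2))"
  have X: "X = k\<^sup>2 / 2 * (k\<^sup>2 / 2) - k\<^sup>2"
    by (simp add: X_def power4_eq_xxxx power2_eq_square)
  from assms obtain y' where y: "\<And>t. (y has_real_derivative y' t) (at t)"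
    "\<And>t. (y' has_real_derivative (- k\<^sup>2 * y' t - k\<^sup>2 * y t)) (at t)" "y 0 = 0" "y' 0 = 1"
    unfolding solves_symbol_ode_def by auto
  have E: "(E has_real_derivative (k\<^sup>2 / 2 * E t)) (at t)" for t
    unfolding E_def by (auto intro!: derivative_eq_intros)
  have "E t * y t = sinhc X t"
  proof (rule sinhc_unique[where y' = "\<lambda>t. E t * (y' t + k\<^sup>2 / 2 * y t)"])
    show "((\<lambda>t. E t * y t) has_real_derivative (E t * (y' t + k\<^sup>2 / 2 * y t))) (at t)" for t
      by (auto intro!: derivative_eq_intros E y simp: algebra_simps)
    show "((\<lambda>t. E t * (y' t + k\<^sup>2 / 2 * y t)) has_real_derivative X * (E t * y t)) (at t)" for t
    proof (rule DERIV_cong)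
      show "((\<lambda>t. E t * (y' t + k\<^sup>2 / 2 * y t)) has_real_derivative
        k\<^sup>2 / 2 * E t * (y' t + k\<^sup>2 / 2 * y t) + ((- k\<^sup>2 * y' t - k\<^sup>2 * y t) + k\<^sup>2 / 2 * y' t) * E t) (at t)"
        by (intro DERIV_mult E DERIV_add DERIV_cmult y)
      show "k\<^sup>2 / 2 * E t * (y' t + k\<^sup>2 / 2 * y t) + ((- k\<^sup>2 * y' t - k\<^sup>2 * y t) + k\<^sup>2 / 2 * y' t) * E t = X * (E t * y t)"
        unfolding X by (simp add: algebra_simps)
    qed
  qed (simp_all add: y E_def)
  then show "y t = exp (- (k\<^sup>2 * t / 2)) * sinhc (k^4 / 4 - k\<^sup>2) t"
    by (simp add: E_def X_def exp_minus field_simps)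
qed

lemma S_hat_1: "S_hat 1 t k = exp (- (k\<^sup>2 * t / 2)) * sinhc (k^4 / 4 - k\<^sup>2) t"
proof -
  have "(THE y. solves_symbol_ode 1 k y) = (\<lambda>t. exp (- (k\<^sup>2 * t / 2)) * sinhc (k^4 / 4 - k\<^sup>2) t)"
    using solves_symbol_ode_1 solves_symbol_ode_1_unique by (rule the_equality)
  then show ?thesis unfolding S_hat_def by simp
qed

lemma borel_measurable_S_hat_1 [measurable (raw)]:
  assumes [measurable]: "f \<in> borel_measurable M" "g \<in> borel_measurable M"
  shows "(\<lambda>x. S_hat (Suc 0) (f x) (g x)) \<in> borel_measurable M"
  unfolding S_hat_1[simplified] by measurable

lemma S_hat_1_0 [simp]: "S_hat (Suc 0) 0 k = 0"
  using S_hat_1[of 0 k] by simp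

section \<open>Growth in time and decay in frequency of the symbol\<close>

lemma sinh_le_mult_exp: "sinh y \<le> y * exp y" if "0 \<le> y" for y :: real
proof -
  have "1 - 2 * y \<le> exp (- (2 * y))" using exp_ge_add_one_self[of "- (2 * y)"] by simp
  then have "exp y * (1 - 2 * y) \<le> exp y * exp (- (2 * y))" by (intro mult_left_mono) auto
  also have "\<dots> = exp (- y)" by (simp add: exp_add[symmetric])
  finally show ?thesis by (simp add: sinh_field_def algebra_simps)
qed

text \<open>The bound is uniform in a, including a = 0, where the quotient is 0 by the convention
  for division by zero.\<close>

lemma abs_sin_div_le: "\<bar>sin (a * t) / a\<bar> \<le> t" if "0 \<le> t" for a t :: real
proof (cases "a = 0")
  case False
  have "\<bar>sin (a * t)\<bar> \<le> \<bar>a * t\<bar>" by (rule abs_sin_x_le_abs_x)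
  then show ?thesis using False that by (simp add: abs_mult divide_le_eq mult.commute)
qed (use that in simp)

lemma abs_sinhc_le:
  assumes "0 \<le> t" "X \<le> a\<^sup>2" "0 \<le> a"
  shows "\<bar>sinhc X t\<bar> \<le> t * exp (a * t)"
proof -
  have e: "t \<le> t * exp (a * t)" using assms mult_left_mono[of 1 "exp (a * t)" t] by simp
  consider "X < 0" | "X = 0" | "X > 0" by linarith
  then show ?thesis
  proof cases
    case 1
    then show ?thesis using abs_sin_div_le[OF assms(1), of "sqrt (-X)"] e by (simp add: sinhc_def)
  next
    case 2
    then show ?thesis using e assms by (simp add: sinhc_def)
  next
    case 3
    have "sqrt X \<le> a" using assms by (simp add: real_le_lsqrt)
    then have "exp (sqrt X * t) \<le> exp (a * t)" using assms by (simp add: mult_right_mono)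
    have "sinh (sqrt X * t) \<le> sqrt X * t * exp (sqrt X * t)" using 3 assms by (intro sinh_le_mult_exp) simp
    also have "\<dots> \<le> sqrt X * t * exp (a * t)" using 3 assms \<open>exp (sqrt X * t) \<le> exp (a * t)\<close>
      by (intro mult_left_mono) auto
    finally have "sinh (sqrt X * t) / sqrt X \<le> t * exp (a * t)" using 3 by (simp add: divide_le_eq mult_ac)
    moreover have "0 \<le> sinh (sqrt X * t) / sqrt X" using 3 assms by simp
    ultimately show ?thesis using 3 by (simp add: sinhc_def)
  qed
qed

text \<open>At high frequency the growth exp(k^2 t/2) of the hyperbolic sine is cancelled by the
  prefactor, and only the denominator, comparable to k^2, remains.\<close>

lemma S_hat_1_bound:
  assumes t: "0 \<le> t"
  shows "\<exists>C>0. \<forall>k. \<bar>S_hat (Suc 0) t k\<bar> \<le> C / (1 + k\<^sup>2)"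
proof -
  \<comment> \<open>For q = k^2 \<le> 9 one has q^2/4 - q \<le> 4^2, whence exp(4t), and 1 + q \<le>
    10. The summand 4 comes from 3/q \<le> 4/(1+q) for q > 9.\<close>
  define C where "C = 10 * (t * exp (4 * t)) + 4"
  have C0: "0 < C" using t by (simp add: C_def add_nonneg_pos)
  have "\<bar>S_hat (Suc 0) t k\<bar> \<le> C / (1 + k\<^sup>2)" for k
  proof -
    define q where "q = k\<^sup>2"
    have q: "0 \<le> q" by (simp add: q_def)
    have k4: "k ^ 4 = q\<^sup>2" by (simp add: q_def power4_eq_xxxx power2_eq_square)
    have eq: "\<bar>S_hat (Suc 0) t k\<bar> = exp (- (q * t / 2)) * \<bar>sinhc (q\<^sup>2 / 4 - q) t\<bar>"
      using S_hat_1[of t k] by (simp add: abs_mult k4 q_def[symmetric])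
    show ?thesis
    proof (cases "q \<le> 9")
      case True
      have "q\<^sup>2 / 4 - q \<le> 4\<^sup>2"
      proof -
        have "q * (q / 4 - 1) \<le> 9 * (5/4)" if "4 \<le> q" using that True by (intro mult_mono) auto
        moreover have "q * (q / 4 - 1) \<le> 0" if "q \<le> 4" using that q by (intro mult_nonneg_nonpos) auto
        ultimately show ?thesis by (cases "q \<le> 4") (auto simp: power2_eq_square algebra_simps)
      qed
      then have "\<bar>sinhc (q\<^sup>2 / 4 - q) t\<bar> \<le> t * exp (4 * t)" by (intro abs_sinhc_le t) auto
      then have "exp (- (q * t / 2)) * \<bar>sinhc (q\<^sup>2 / 4 - q) t\<bar> \<le> 1 * (t * exp (4 * t))"
        using q t by (intro mult_mono) auto
      also have "\<dots> \<le> C / (1 + q)"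
      proof -
        have "t * exp (4 * t) * (1 + q) \<le> t * exp (4 * t) * 10" using True t by (intro mult_left_mono) auto
        then show ?thesis using q t by (simp add: C_def le_divide_eq)
      qed
      finally show ?thesis unfolding eq q_def .
    next
      case False
      define X where "X = q\<^sup>2 / 4 - q"
      \<comment> \<open>The threshold 9 is large enough for X = q^2/4 - q to stay above
        q^2/9.\<close>
      have "q * 9 \<le> q * q" using False by (intro mult_left_mono) auto
      then have X1: "(q / 3)\<^sup>2 \<le> X" and X2: "X \<le> (q / 2)\<^sup>2"
        using q by (simp_all add: X_def power2_eq_square)
      have s: "q / 3 \<le> sqrt X" "sqrt X \<le> q / 2"
        using real_le_rsqrt[OF X1] real_sqrt_le_mono[OF X2] q by (simp_all add: real_sqrt_abs)
      have X0: "X > 0" using X1 False by (smt (verit) zero_less_power divide_pos_pos)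
      have "\<bar>sinhc X t\<bar> = sinh (sqrt X * t) / sqrt X" using X0 t by (simp add: sinhc_def)
      also have "\<dots> \<le> exp (sqrt X * t) / sqrt X" using X0
        using exp_gt_zero[of "sqrt X * t"] exp_gt_zero[of "- (sqrt X * t)"]
        by (intro divide_right_mono) (auto simp: sinh_field_def simp del: exp_gt_zero)
      also have "\<dots> \<le> exp (q / 2 * t) / (q / 3)" using s X0 False mult_right_mono[OF s(2) t] by (intro frac_le) auto
      finally have "exp (- (q * t / 2)) * \<bar>sinhc X t\<bar> \<le> exp (- (q * t / 2)) * (exp (q / 2 * t) / (q / 3))"
        by (intro mult_left_mono) auto
      also have "\<dots> = 3 / q" by (simp add: exp_minus mult.commute field_simps)
      also have "\<dots> \<le> 4 / (1 + q)" using False by (simp add: field_simps)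
      also have "\<dots> \<le> C / (1 + q)" using t q by (intro divide_right_mono) (auto simp: C_def)
      finally show ?thesis unfolding eq q_def[symmetric] X_def[symmetric] .
    qed
  qed
  with C0 show ?thesis by blast
qed

section \<open>The Gaussian representation of the symbol and its Volterra equation\<close>

lemma integral_even:
  fixes f :: "real \<Rightarrow> real"
  assumes f: "integrable lborel f" and even: "\<And>x. f (- x) = f x"
  shows "(LINT x|lborel. f x) = 2 * (LINT x:{0<..}|lborel. f x)"
proof -
  have [measurable]: "f \<in> borel_measurable borel" using f by auto
  have I: "integrable lborel (\<lambda>x. indicat_real {0<..} x * f x)" "integrable lborel (\<lambda>x. indicat_real {..<0} x * f x)"
    using f by (auto intro!: integrable_real_mult_indicator simp: mult.commute)
  have "(LINT x|lborel. f x) = (LINT x|lborel. indicat_real {0<..} x * f x + indicat_real {..<0} x * f x)"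
    by (rule integral_cong_AE) (simp, simp, use AE_lborel_singleton[of 0] in eventually_elim, auto split: split_indicator)
  also have "\<dots> = (LINT x|lborel. indicat_real {0<..} x * f x) + (LINT x|lborel. indicat_real {..<0} x * f x)"
    by (rule Bochner_Integration.integral_add[OF I])
  also have "(LINT x|lborel. indicat_real {..<0} x * f x) = (LINT x|lborel. indicat_real {0<..} x * f x)"
    by (subst lborel_integral_real_affine[of "-1" _ 0])
       (auto simp: even intro!: Bochner_Integration.integral_cong split: split_indicator)
  finally show ?thesis by (simp add: set_lebesgue_integral_def)
qed

lemma gauss_real:
  fixes a b t :: real
  assumes t: "0 < t"
  shows "integrable lborel (\<lambda>v. exp (- v\<^sup>2 / (4 * t)) * (exp (a * v) * cos (b * v)))"
    "integrable lborel (\<lambda>v. exp (- v\<^sup>2 / (4 * t)) * (exp (a * v) * sin (b * v)))"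
    "(LINT v|lborel. exp (- v\<^sup>2 / (4 * t)) * (exp (a * v) * cos (b * v)))
      = sqrt (4 * pi * t) * (exp (t * (a\<^sup>2 - b\<^sup>2)) * cos (2 * t * a * b))"
    "(LINT v|lborel. exp (- v\<^sup>2 / (4 * t)) * (exp (a * v) * sin (b * v)))
      = sqrt (4 * pi * t) * (exp (t * (a\<^sup>2 - b\<^sup>2)) * sin (2 * t * a * b))"
proof -
  define c where "c = Complex a b"
  note g = gauss_cexp[OF t, of c]
  have R: "Re (of_real (exp (- v\<^sup>2 / (4 * t))) * exp (c * of_real v)) = exp (- v\<^sup>2 / (4 * t)) * (exp (a * v) * cos (b * v))"
    and I: "Im (of_real (exp (- v\<^sup>2 / (4 * t))) * exp (c * of_real v)) = exp (- v\<^sup>2 / (4 * t)) * (exp (a * v) * sin (b * v))" for v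
    by (simp_all add: c_def Re_exp Im_exp)
  have c2: "of_real t * c\<^sup>2 = Complex (t * (a\<^sup>2 - b\<^sup>2)) (2 * t * a * b)"
    by (simp add: c_def complex_eq_iff power2_eq_square algebra_simps)
  show "integrable lborel (\<lambda>v. exp (- v\<^sup>2 / (4 * t)) * (exp (a * v) * cos (b * v)))"
    using integrable_Re[OF g(1)] unfolding R .
  show "integrable lborel (\<lambda>v. exp (- v\<^sup>2 / (4 * t)) * (exp (a * v) * sin (b * v)))"
    using integrable_Im[OF g(1)] unfolding I .
  show "(LINT v|lborel. exp (- v\<^sup>2 / (4 * t)) * (exp (a * v) * cos (b * v)))
      = sqrt (4 * pi * t) * (exp (t * (a\<^sup>2 - b\<^sup>2)) * cos (2 * t * a * b))"
    using integral_Re[OF g(1)] unfolding R g(2) c2 by (simp add: Re_exp)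
  show "(LINT v|lborel. exp (- v\<^sup>2 / (4 * t)) * (exp (a * v) * sin (b * v)))
      = sqrt (4 * pi * t) * (exp (t * (a\<^sup>2 - b\<^sup>2)) * sin (2 * t * a * b))"
    using integral_Im[OF g(1)] unfolding I g(2) c2 by (simp add: Im_exp)
qed

text \<open>The explicit symbol is \<open>e\<^bsup>t(a\<^sup>2 - \<kappa>\<^sup>2) - t\<^esup> sin (2a\<kappa>t) / (2a\<kappa>)\<close>, where \<open>(a + i\<kappa>)\<^sup>2 = a\<^sup>2 - \<kappa>\<^sup>2 + 2ia\<kappa>\<close>;
  the heat semigroup applied to \<open>sin \<kappa>v sinh av\<close> produces exactly this exponent.\<close>

lemma S_hat_1_gauss:
  assumes t: "0 < t" and k: "0 < k" "k \<noteq> 2"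
  shows "S_hat (Suc 0) t k = exp (- t) / (2 * sqrt (pi * t)) *
    (LINT v:{0<..}|lborel. exp (- v\<^sup>2 / (4 * t)) * (sin (k / 2 * v) / (k / 2) * sinhc (1 - (k / 2)\<^sup>2) v))"
proof -
  define \<kappa> where "\<kappa> = k / 2"
  have \<kappa>: "0 < \<kappa>" "\<kappa> \<noteq> 1" and k2: "k = 2 * \<kappa>" using k by (simp_all add: \<kappa>_def)
  have s4: "sqrt (4 * pi * t) = 2 * sqrt (pi * t)"
    by (simp add: real_sqrt_mult)
  have S: "S_hat (Suc 0) t k = exp (- (2 * \<kappa>\<^sup>2 * t)) * sinhc (4 * (\<kappa>\<^sup>2 * (\<kappa>\<^sup>2 - 1))) t"
    using S_hat_1[of t k] unfolding k2 by (simp add: power_mult_distrib power4_eq_xxxx power2_eq_square algebra_simps)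
  let ?f = "\<lambda>v. exp (- v\<^sup>2 / (4 * t)) * (sin (\<kappa> * v) / \<kappa> * sinhc (1 - \<kappa>\<^sup>2) v)"
  have main: "integrable lborel ?f \<and> exp (- t) * (LINT v|lborel. ?f v) = 4 * sqrt (pi * t) * S_hat (Suc 0) t k"
  proof (cases "\<kappa> < 1")
    case True
    \<comment> \<open>For k < 2 the number a is real and \<open>sinhc\<close> splits into two
      exponentials; since sin(2ta\<kappa>) is odd in a, their contributions add up.\<close>
    define a where "a = sqrt (1 - \<kappa>\<^sup>2)"
    have "\<kappa>\<^sup>2 < 1" using True \<kappa> by (simp add: power_less_one_iff)
    then have a: "0 < a" "a\<^sup>2 = 1 - \<kappa>\<^sup>2" by (simp_all add: a_def)
    have f: "?f v = 1 / (2 * \<kappa> * a) * (exp (- v\<^sup>2 / (4 * t)) * (exp (a * v) * sin (\<kappa> * v)))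
        - 1 / (2 * \<kappa> * a) * (exp (- v\<^sup>2 / (4 * t)) * (exp ((-a) * v) * sin (\<kappa> * v)))" for v
      using a \<open>\<kappa>\<^sup>2 < 1\<close> by (simp add: sinhc_def a_def[symmetric] sinh_field_def divide_simps) (simp add: algebra_simps)
    note g = gauss_real(2)[OF t, of a \<kappa>] gauss_real(2)[OF t, of "-a" \<kappa>] gauss_real(4)[OF t, of a \<kappa>] gauss_real(4)[OF t, of "-a" \<kappa>]
    have int: "integrable lborel ?f" unfolding f by (intro Bochner_Integration.integrable_diff integrable_mult_right g)
    have "(LINT v|lborel. ?f v) = 1 / (2 * \<kappa> * a) * (sqrt (4 * pi * t) * (exp (t * (a\<^sup>2 - \<kappa>\<^sup>2)) * sin (2 * t * a * \<kappa>)))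
       - 1 / (2 * \<kappa> * a) * (sqrt (4 * pi * t) * (exp (t * ((-a)\<^sup>2 - \<kappa>\<^sup>2)) * sin (2 * t * (-a) * \<kappa>)))"
      unfolding f by (subst Bochner_Integration.integral_diff)
        (intro integrable_mult_right g, intro integrable_mult_right g, simp only: integral_mult_right_zero g)
    also have "\<dots> = 2 * sqrt (pi * t) / (\<kappa> * a) * (exp (t * (a\<^sup>2 - \<kappa>\<^sup>2)) * sin (2 * t * a * \<kappa>))"
      unfolding s4 using a \<kappa> by (simp add: field_simps)
    finally have "exp (- t) * (LINT v|lborel. ?f v)
      = 2 * sqrt (pi * t) / (\<kappa> * a) * (exp (- t) * exp (t * (a\<^sup>2 - \<kappa>\<^sup>2)) * sin (2 * t * a * \<kappa>))" by simp
    also have "exp (- t) * exp (t * (a\<^sup>2 - \<kappa>\<^sup>2)) = exp (- (2 * \<kappa>\<^sup>2 * t))"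
      unfolding a(2) exp_add[symmetric] by (simp add: algebra_simps)
    also have "2 * sqrt (pi * t) / (\<kappa> * a) * (exp (- (2 * \<kappa>\<^sup>2 * t)) * sin (2 * t * a * \<kappa>)) = 4 * sqrt (pi * t) * S_hat (Suc 0) t k"
    proof -
      have "4 * (\<kappa>\<^sup>2 * (\<kappa>\<^sup>2 - 1)) = - ((2 * \<kappa> * a)\<^sup>2)"
        by (simp add: power_mult_distrib a(2) algebra_simps)
      moreover have "0 < 2 * \<kappa> * a" using a \<kappa> by simp
      ultimately have "sinhc (4 * (\<kappa>\<^sup>2 * (\<kappa>\<^sup>2 - 1))) t = sin (2 * \<kappa> * a * t) / (2 * \<kappa> * a)"
        using a \<kappa> by (simp add: sinhc_def)
      then show ?thesis unfolding S using a \<kappa> by (simp add: field_simps)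
    qed
    finally show ?thesis using int by blast
  next
    case False
    \<comment> \<open>For k > 2 \<open>sinhc\<close> is a sine. The product of the two sines is a
      difference of cosines of frequencies \<kappa> - a and \<kappa> + a; their Gaussian damping
      differs by the factor exp(4a\<kappa>t), which rebuilds the hyperbolic sine of the
      symbol.\<close>
    define a where "a = sqrt (\<kappa>\<^sup>2 - 1)"
    have "1 < \<kappa>\<^sup>2" using False \<kappa> by (simp add: one_less_power)
    then have a: "0 < a" "a\<^sup>2 = \<kappa>\<^sup>2 - 1" by (simp_all add: a_def)
    have ss: "sin (\<kappa> * v) * sin (a * v) = cos ((\<kappa> - a) * v) / 2 - cos ((\<kappa> + a) * v) / 2" for v
      by (simp add: cos_diff cos_add left_diff_distrib distrib_right field_simps)
    have f: "?f v = 1 / (2 * \<kappa> * a) * (exp (- v\<^sup>2 / (4 * t)) * (exp (0 * v) * cos ((\<kappa> - a) * v)))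
        - 1 / (2 * \<kappa> * a) * (exp (- v\<^sup>2 / (4 * t)) * (exp (0 * v) * cos ((\<kappa> + a) * v)))" for v
    proof -
      have "?f v = exp (- v\<^sup>2 / (4 * t)) * (sin (\<kappa> * v) * sin (a * v)) / (\<kappa> * a)"
        using a \<open>1 < \<kappa>\<^sup>2\<close> by (simp add: sinhc_def a_def[symmetric])
      then show ?thesis unfolding ss by (simp add: diff_divide_distrib right_diff_distrib)
    qed
    note g = gauss_real(1)[OF t, of 0 "\<kappa> - a"] gauss_real(1)[OF t, of 0 "\<kappa> + a"] gauss_real(3)[OF t, of 0 "\<kappa> - a"] gauss_real(3)[OF t, of 0 "\<kappa> + a"]
    have int: "integrable lborel ?f" unfolding f by (intro Bochner_Integration.integrable_diff integrable_mult_right g)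
    have "(LINT v|lborel. ?f v) = 1 / (2 * \<kappa> * a) * (sqrt (4 * pi * t) * (exp (t * (0\<^sup>2 - (\<kappa> - a)\<^sup>2)) * cos (2 * t * 0 * (\<kappa> - a))))
       - 1 / (2 * \<kappa> * a) * (sqrt (4 * pi * t) * (exp (t * (0\<^sup>2 - (\<kappa> + a)\<^sup>2)) * cos (2 * t * 0 * (\<kappa> + a))))"
      unfolding f by (subst Bochner_Integration.integral_diff)
        (intro integrable_mult_right g, intro integrable_mult_right g, simp only: integral_mult_right_zero g)
    also have "\<dots> = sqrt (pi * t) / (\<kappa> * a) * (exp (- (t * (\<kappa> - a)\<^sup>2)) - exp (- (t * (\<kappa> + a)\<^sup>2)))"
      unfolding s4 using a \<kappa> by (simp add: field_simps)
    finally have "exp (- t) * (LINT v|lborel. ?f v)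
      = sqrt (pi * t) / (\<kappa> * a) * (exp (- t) * exp (- (t * (\<kappa> - a)\<^sup>2)) - exp (- t) * exp (- (t * (\<kappa> + a)\<^sup>2)))"
      by (simp only: right_diff_distrib mult_ac)
    also have "exp (- t) * exp (- (t * (\<kappa> - a)\<^sup>2)) = exp (- (2 * \<kappa>\<^sup>2 * t)) * exp (2 * \<kappa> * a * t)"
      unfolding exp_add[symmetric] by (simp add: power2_diff a(2) algebra_simps)
    also have "exp (- t) * exp (- (t * (\<kappa> + a)\<^sup>2)) = exp (- (2 * \<kappa>\<^sup>2 * t)) * exp (- (2 * \<kappa> * a * t))"
      unfolding exp_add[symmetric] by (simp add: power2_sum a(2) algebra_simps)
    also have "sqrt (pi * t) / (\<kappa> * a) * (exp (- (2 * \<kappa>\<^sup>2 * t)) * exp (2 * \<kappa> * a * t) - exp (- (2 * \<kappa>\<^sup>2 * t)) * exp (- (2 * \<kappa> * a * t)))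
        = 4 * sqrt (pi * t) * S_hat (Suc 0) t k"
    proof -
      have "4 * (\<kappa>\<^sup>2 * (\<kappa>\<^sup>2 - 1)) = (2 * \<kappa> * a)\<^sup>2"
        by (simp add: power_mult_distrib a(2) algebra_simps)
      moreover have "0 < 2 * \<kappa> * a" using a \<kappa> by simp
      ultimately have sh: "sinhc (4 * (\<kappa>\<^sup>2 * (\<kappa>\<^sup>2 - 1))) t = (exp (2 * \<kappa> * a * t) - exp (- (2 * \<kappa> * a * t))) / (4 * \<kappa> * a)"
        using a \<kappa> by (simp add: sinhc_def sinh_field_def)
      show ?thesis unfolding S sh using a \<kappa> by (simp add: field_simps)
    qed
    finally show ?thesis using int by blast
  qed
  \<comment> \<open>Both factors are odd in v, so only positive times v are left, as the positivity
    argument requires.\<close>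
  have even: "?f (- v) = ?f v" for v by (simp add: sinhc_def)
  have I2: "(LINT v|lborel. ?f v) = 2 * (LINT v:{0<..}|lborel. ?f v)"
  proof (rule integral_even[of ?f])
    show "integrable lborel ?f" using main by blast
    show "?f (- v) = ?f v" for v by (rule even)
  qed
  have final: "exp (- t) * (2 * (LINT v:{0<..}|lborel. ?f v)) = 4 * sqrt (pi * t) * S_hat (Suc 0) t k"
    unfolding I2[symmetric] using main by blast
  have solve: "S = E / (2 * q) * I" if "E * (2 * I) = 4 * q * S" "q \<noteq> 0" for S E q I :: real
    using that by (simp add: field_simps)
  from solve[OF final] show ?thesis using t unfolding \<kappa>_def[symmetric] by simp
qed

text \<open>Read y'' = (1 - \<kappa>^2) y as the wave equation y'' + \<kappa>^2 y = y with y as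
  source; variation of constants gives the claim, and \<open>F\<close> is the corresponding
  antiderivative.\<close>

lemma sinhc_volterra:
  assumes \<kappa>: "\<kappa> \<noteq> 0" and v: "0 \<le> v"
  shows "sinhc (1 - \<kappa>\<^sup>2) v = sin (\<kappa> * v) / \<kappa>
    + (LINT x:{0..v}|lborel. sin (\<kappa> * (v - x)) / \<kappa> * sinhc (1 - \<kappa>\<^sup>2) x)"
proof -
  define X where "X = 1 - \<kappa>\<^sup>2"
  define F where "F = (\<lambda>x. sin (\<kappa> * (v - x)) / \<kappa> * coshc X x + cos (\<kappa> * (v - x)) * sinhc X x)"
  have "(LINT x:{0..v}|lborel. sin (\<kappa> * (v - x)) / \<kappa> * sinhc X x) = F v - F 0"
  proof (rule set_integral_FTC_real[OF v])
    fix x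
    have d: "((\<lambda>x. sin (\<kappa> * (v - x)) / \<kappa>) has_real_derivative - cos (\<kappa> * (v - x))) (at x)"
      "((\<lambda>x. cos (\<kappa> * (v - x))) has_real_derivative \<kappa> * sin (\<kappa> * (v - x))) (at x)"
      using \<kappa> by (auto intro!: derivative_eq_intros)
    have "(F has_real_derivative (- cos (\<kappa> * (v - x)) * coshc X x + X * sinhc X x * (sin (\<kappa> * (v - x)) / \<kappa>))
        + (\<kappa> * sin (\<kappa> * (v - x)) * sinhc X x + coshc X x * cos (\<kappa> * (v - x)))) (at x)"
      unfolding F_def by (intro DERIV_add DERIV_mult d sinhc_deriv coshc_deriv)
    also have "(- cos (\<kappa> * (v - x)) * coshc X x + X * sinhc X x * (sin (\<kappa> * (v - x)) / \<kappa>))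
        + (\<kappa> * sin (\<kappa> * (v - x)) * sinhc X x + coshc X x * cos (\<kappa> * (v - x))) = sin (\<kappa> * (v - x)) / \<kappa> * sinhc X x"
      using \<kappa> by (simp add: X_def field_simps power2_eq_square)
    finally show "(F has_real_derivative sin (\<kappa> * (v - x)) / \<kappa> * sinhc X x) (at x)" .
  next
    have "continuous_on UNIV (sinhc X)"
      using DERIV_isCont[OF sinhc_deriv] by (auto simp: continuous_on_eq_continuous_at)
    then show "continuous_on UNIV (\<lambda>x. sin (\<kappa> * (v - x)) / \<kappa> * sinhc X x)"
      using \<kappa> by (intro continuous_intros) auto
  qed
  then show ?thesis by (simp add: F_def X_def)
qed

section \<open>Positivity of the Volterra iterates\<close>

lemma AE_norm_plane_neq: "AE x in (lborel :: (real^2) measure). norm x \<noteq> c"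
proof -
  have "(\<integral>\<^sup>+x. indicator {x. norm x = c} x \<partial>(lborel :: (real^2) measure))
    = (\<integral>\<^sup>+\<rho>\<in>{0<..}. ennreal \<rho> * (\<integral>\<^sup>+\<theta>\<in>{0..2*pi}. indicator {x::real^2. norm x = c} (polar \<rho> \<theta>) \<partial>lborel) \<partial>lborel)"
    by (rule nn_integral_polar) measurable
  also have "\<dots> = (\<integral>\<^sup>+\<rho>. 0 \<partial>(lborel :: real measure))"
    by (rule nn_integral_cong_AE, use AE_lborel_singleton[of c] in eventually_elim)
       (auto split: split_indicator)
  finally have "emeasure lborel {x::real^2. norm x = c} = 0" by simp
  then show ?thesis by (intro AE_I[of _ _ "{x. norm x = c}"]) auto
qed

text \<open>The product h(x) |g(z)| dominates, so Fubini applies. Here z is the frequency and x the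
  parameter of an average; every exchange in the positivity argument has this shape.\<close>

lemma lborel_integral_swap:
  fixes f :: "real \<Rightarrow> 'a::euclidean_space \<Rightarrow> real" and g :: "'a \<Rightarrow> real"
  assumes g: "integrable lborel g" and h: "integrable lborel h"
    and f [measurable]: "case_prod f \<in> borel_measurable (lborel \<Otimes>\<^sub>M lborel)"
    and bd: "\<And>x z. \<bar>f x z\<bar> \<le> h x"
  shows "(LINT z|lborel. g z * (LINT x|lborel. f x z)) = (LINT x|lborel. LINT z|lborel. g z * f x z)"
proof -
  have [measurable]: "g \<in> borel_measurable borel" "h \<in> borel_measurable borel" using g h by auto
  have "integrable (lborel \<Otimes>\<^sub>M lborel) (\<lambda>(x, z). h x * g z)"
    by (rule lborel_pair.Fubini_integrable)
       (use g h in \<open>auto simp: abs_mult integrable_mult_right integrable_mult_left\<close>)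
  then have int: "integrable (lborel \<Otimes>\<^sub>M lborel) (\<lambda>(x, z). g z * f x z)"
  proof (rule Bochner_Integration.integrable_bound)
    have "\<bar>g z * f x z\<bar> \<le> \<bar>h x * g z\<bar>" for x z
      using bd[of x z] by (simp add: abs_mult mult.commute[of "\<bar>g z\<bar>"] mult_right_mono)
    then show "AE p in lborel \<Otimes>\<^sub>M lborel. norm (case p of (x, z) \<Rightarrow> g z * f x z) \<le> norm (case p of (x, z) \<Rightarrow> h x * g z)"
      by auto
  qed simp
  have "(LINT z|lborel. g z * (LINT x|lborel. f x z)) = (LINT z|lborel. LINT x|lborel. g z * f x z)"
    by simp
  also have "\<dots> = (LINT x|lborel. LINT z|lborel. g z * f x z)"
    using lborel_pair.Fubini_integral[OF int] .
  finally show ?thesis .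
qed

text \<open>Nothing is asked of f beyond the pointwise bound: if f is not integrable, its integral
  is 0 and the claim is the nonnegativity of the right-hand side.\<close>

lemma abs_set_integral_le:
  fixes f :: "real \<Rightarrow> real"
  assumes bd: "\<And>x. x \<in> {a..b} \<Longrightarrow> \<bar>f x\<bar> \<le> h x" and h: "set_integrable lborel {a..b} h"
  shows "\<bar>LINT x:{a..b}|lborel. f x\<bar> \<le> (LINT x:{a..b}|lborel. h x)"
proof (cases "set_integrable lborel {a..b} f")
  case True
  have "norm (LINT x:{a..b}|lborel. f x) \<le> (LINT x:{a..b}|lborel. norm (f x))"
    by (rule set_integral_norm_bound[OF True])
  also have "\<dots> \<le> (LINT x:{a..b}|lborel. h x)"
    by (rule set_integral_mono[OF set_integrable_norm[OF True] h]) (use bd in simp)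
  finally show ?thesis by simp
next
  case False
  have "0 \<le> (LINT x:{a..b}|lborel. h x)"
    unfolding set_lebesgue_integral_def
    by (rule Bochner_Integration.integral_nonneg) (use bd in \<open>force split: split_indicator\<close>)
  with False show ?thesis
    by (simp add: set_lebesgue_integral_def set_integrable_def not_integrable_integral_eq)
qed

text \<open>Picard iterates with a free seed: the seed sin(\<kappa> v)/\<kappa> produces the terms
  of the expansion, and the seed \<open>sinhc\<close> produces its remainders.\<close>

primrec volterra :: "(real \<Rightarrow> real \<Rightarrow> real) \<Rightarrow> nat \<Rightarrow> real \<Rightarrow> real \<Rightarrow> real" where
  "volterra f 0 \<kappa> v = f \<kappa> v"
| "volterra f (Suc m) \<kappa> v = (LINT x:{0..v}|lborel. sin (\<kappa> * (v - x)) / \<kappa> * volterra f m \<kappa> x)"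

lemma borel_measurable_volterra:
  assumes [measurable]: "case_prod f \<in> borel_measurable (borel \<Otimes>\<^sub>M borel)"
  shows "case_prod (volterra f m) \<in> borel_measurable (borel \<Otimes>\<^sub>M borel)"
proof (induction m)
  case 0
  then show ?case using assms by simp
next
  case (Suc m)
  note [measurable] = Suc.IH
  have "case_prod (volterra f (Suc m)) = (\<lambda>p. LINT x|lborel. (if 0 \<le> x \<and> x \<le> snd p then
      sin (fst p * (snd p - x)) / fst p * case_prod (volterra f m) (fst p, x) else 0))"
    by (rule ext, simp only: case_prod_beta volterra.simps set_lebesgue_integral_def fst_conv snd_conv,
        rule Bochner_Integration.integral_cong, simp, simp)
  also have "\<dots> \<in> borel_measurable (borel \<Otimes>\<^sub>M borel)" by measurable
  finally show ?case .
qed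

lemma borel_measurable_volterra' [measurable]:
  assumes "case_prod f \<in> borel_measurable (borel \<Otimes>\<^sub>M borel)"
    and [measurable]: "a \<in> borel_measurable M" "b \<in> borel_measurable M"
  shows "(\<lambda>x. volterra f m (a x) (b x)) \<in> borel_measurable M"
proof -
  note [measurable] = borel_measurable_volterra[OF assms(1), of m]
  have "(\<lambda>x. case_prod (volterra f m) (a x, b x)) \<in> borel_measurable M" by measurable
  then show ?thesis by simp
qed

lemma le_exp: "v \<le> exp v" for v :: real
  using exp_ge_add_one_self[of v] by linarith

lemma integral_power_Icc: "0 \<le> v \<Longrightarrow> (LINT x:{0..v}|lborel. x ^ m / fact m) = v ^ Suc m / fact (Suc m)" for v :: real
proof -
  assume v: "0 \<le> v"
  have "(LINT x:{0..v}|lborel. x ^ m / fact m) = v ^ Suc m / fact (Suc m) - 0 ^ Suc m / fact (Suc m)"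
  proof (rule set_integral_FTC_real[OF v])
    fix x :: real
    have "((\<lambda>x. x ^ Suc m / fact (Suc m)) has_real_derivative (1 + of_nat m) * (1 * x ^ m) / fact (Suc m)) (at x)"
      by (intro DERIV_cdivide DERIV_power_Suc DERIV_ident)
    moreover have "(1 + of_nat m) * (1 * x ^ m) / fact (Suc m) = x ^ m / fact m"
    proof -
      have "real m \<noteq> - 1" by linarith
      then show ?thesis by (simp add: divide_simps add_eq_0_iff)
    qed
    ultimately show "((\<lambda>x. x ^ Suc m / fact (Suc m)) has_real_derivative x ^ m / fact m) (at x)" by simp
  qed (intro continuous_intros, simp)
  then show ?thesis by simp
qed

text \<open>The kernel contributes at most v - x \<le> exp(2(v - x)), which lifts exp(2x) to
  exp(2v); integrating x^m/m! then supplies the next factorial. The bound is uniform in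
  \<kappa>.\<close>

lemma volterra_bound:
  assumes bd: "\<And>v. 0 \<le> v \<Longrightarrow> \<bar>f \<kappa> v\<bar> \<le> exp (2 * v)"
  shows "0 \<le> v \<Longrightarrow> \<bar>volterra f m \<kappa> v\<bar> \<le> exp (2 * v) * (v ^ m / fact m)"
proof (induction m arbitrary: v)
  case 0
  then show ?case using bd by simp
next
  case (Suc m)
  have "\<bar>sin (\<kappa> * (v - x)) / \<kappa> * volterra f m \<kappa> x\<bar> \<le> exp (2 * v) * (x ^ m / fact m)" if "x \<in> {0..v}" for x
  proof -
    have "\<bar>sin (\<kappa> * (v - x)) / \<kappa> * volterra f m \<kappa> x\<bar> \<le> (v - x) * (exp (2 * x) * (x ^ m / fact m))"
      unfolding abs_mult using that by (intro mult_mono abs_sin_div_le Suc.IH) auto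
    also have "\<dots> \<le> exp (2 * (v - x)) * (exp (2 * x) * (x ^ m / fact m))"
      using that le_exp[of "2 * (v - x)"] by (intro mult_right_mono) auto
    also have "\<dots> = exp (2 * v) * (x ^ m / fact m)"
      by (simp add: exp_add[symmetric] algebra_simps)
    finally show ?thesis .
  qed
  then have "\<bar>volterra f (Suc m) \<kappa> v\<bar> \<le> (LINT x:{0..v}|lborel. exp (2 * v) * (x ^ m / fact m))"
    unfolding volterra.simps
    by (intro abs_set_integral_le borel_integrable_atLeastAtMost' continuous_intros) auto
  also have "\<dots> = exp (2 * v) * (v ^ Suc m / fact (Suc m))"
    using Suc.prems by (simp only: set_integral_mult_right integral_power_Icc)
  finally show ?case .
qed

lemma volterra_set_integrable:
  assumes f: "case_prod f \<in> borel_measurable (borel \<Otimes>\<^sub>M borel)"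
    and bd: "\<And>v. 0 \<le> v \<Longrightarrow> \<bar>f \<kappa> v\<bar> \<le> exp (2 * v)"
  shows "set_integrable lborel {0..v} (\<lambda>x. sin (\<kappa> * (v - x)) / \<kappa> * volterra f m \<kappa> x)"
proof -
  note [measurable] = borel_measurable_volterra'[OF f]
  have "integrable lborel (\<lambda>x. indicat_real {0..v} x * (v * (exp (2 * v) * (v ^ m / fact m))))"
    by (intro integrable_mult_left integrable_real_indicator) (auto simp: emeasure_lborel_Icc_eq)
  then show ?thesis unfolding set_integrable_def
  proof (rule Bochner_Integration.integrable_bound)
    have "\<bar>sin (\<kappa> * (v - x)) / \<kappa> * volterra f m \<kappa> x\<bar> \<le> \<bar>v * (exp (2 * v) * (v ^ m / fact m))\<bar>" if "x \<in> {0..v}" for x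
    proof -
      have "\<bar>sin (\<kappa> * (v - x)) / \<kappa> * volterra f m \<kappa> x\<bar> \<le> (v - x) * (exp (2 * x) * (x ^ m / fact m))"
        unfolding abs_mult using that by (intro mult_mono abs_sin_div_le volterra_bound bd) auto
      also have "\<dots> \<le> v * (exp (2 * v) * (v ^ m / fact m))"
        using that by (intro mult_mono divide_right_mono power_mono) auto
      finally show ?thesis by (rule order_trans[OF _ abs_ge_self])
    qed
    then show "AE x in lborel. norm (indicat_real {0..v} x *\<^sub>R (sin (\<kappa> * (v - x)) / \<kappa> * volterra f m \<kappa> x))
        \<le> norm (indicat_real {0..v} x * (v * (exp (2 * v) * (v ^ m / fact m))))"
      by (auto split: split_indicator)
  qed measurable
qed

text \<open>At \<open>\<kappa> = 0\<close> the quotient \<open>sin (\<kappa> v) / \<kappa>\<close> is \<open>0\<close> and not \<open>v\<close>; this concerns only a null set of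
  frequencies, and the bounds below hold there as well.\<close>

abbreviation (input) sinc_fun :: "real \<Rightarrow> real \<Rightarrow> real" where
  "sinc_fun \<equiv> (\<lambda>\<kappa> v. sin (\<kappa> * v) / \<kappa>)"

abbreviation (input) sinhc_fun :: "real \<Rightarrow> real \<Rightarrow> real" where
  "sinhc_fun \<equiv> (\<lambda>\<kappa>. sinhc (1 - \<kappa>\<^sup>2))"

lemma sinc_fun_props:
  fixes \<kappa> v :: real
  shows sinc_fun_measurable: "case_prod sinc_fun \<in> borel_measurable (borel \<Otimes>\<^sub>M borel)"
    and sinc_fun_bound: "0 \<le> v \<Longrightarrow> \<bar>sin (\<kappa> * v) / \<kappa>\<bar> \<le> exp (2 * v)"
proof -
  show "case_prod sinc_fun \<in> borel_measurable (borel \<Otimes>\<^sub>M borel)" by measurable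
  show "\<bar>sin (\<kappa> * v) / \<kappa>\<bar> \<le> exp (2 * v)" if "0 \<le> v"
    using abs_sin_div_le[OF that, of \<kappa>] le_exp[of "2 * v"] that by linarith
qed

lemma sinhc_fun_props:
  fixes \<kappa> v :: real
  shows sinhc_fun_measurable: "case_prod sinhc_fun \<in> borel_measurable (borel \<Otimes>\<^sub>M borel)"
    and sinhc_fun_bound: "0 \<le> v \<Longrightarrow> \<bar>sinhc (1 - \<kappa>\<^sup>2) v\<bar> \<le> exp (2 * v)"
proof -
  show "case_prod sinhc_fun \<in> borel_measurable (borel \<Otimes>\<^sub>M borel)" by measurable
  assume v: "0 \<le> v"
  have "\<bar>sinhc (1 - \<kappa>\<^sup>2) v\<bar> \<le> v * exp (1 * v)" using v by (intro abs_sinhc_le) auto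
  also have "\<dots> \<le> exp v * exp v" using v le_exp[of v] by (intro mult_mono) auto
  finally show "\<bar>sinhc (1 - \<kappa>\<^sup>2) v\<bar> \<le> exp (2 * v)" by (simp add: exp_add[symmetric])
qed

text \<open>The Volterra equation, to which the Volterra operator has been applied m times.\<close>

lemma volterra_remainder:
  assumes \<kappa>: "\<kappa> \<noteq> 0"
  shows "0 \<le> v \<Longrightarrow> volterra sinhc_fun m \<kappa> v = volterra sinc_fun m \<kappa> v + volterra sinhc_fun (Suc m) \<kappa> v"
proof (induction m arbitrary: v)
  case 0
  then show ?case using sinhc_volterra[OF \<kappa>] by simp
next
  case (Suc m)
  have "volterra sinhc_fun (Suc m) \<kappa> v = (LINT x:{0..v}|lborel. sin (\<kappa> * (v - x)) / \<kappa> * volterra sinhc_fun m \<kappa> x)"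
    by (rule volterra.simps)
  also have "\<dots> = (LINT x:{0..v}|lborel. sin (\<kappa> * (v - x)) / \<kappa> * volterra sinc_fun m \<kappa> x
      + sin (\<kappa> * (v - x)) / \<kappa> * volterra sinhc_fun (Suc m) \<kappa> x)"
  proof (intro set_lebesgue_integral_cong allI impI)
    fix x assume "x \<in> {0..v}"
    then have "0 \<le> x" by simp
    show "sin (\<kappa> * (v - x)) / \<kappa> * volterra sinhc_fun m \<kappa> x = sin (\<kappa> * (v - x)) / \<kappa> * volterra sinc_fun m \<kappa> x
      + sin (\<kappa> * (v - x)) / \<kappa> * volterra sinhc_fun (Suc m) \<kappa> x"
      unfolding Suc.IH[OF \<open>0 \<le> x\<close>] by (rule distrib_left)
  qed simp
  also have "\<dots> = volterra sinc_fun (Suc m) \<kappa> v + volterra sinhc_fun (Suc (Suc m)) \<kappa> v"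
    unfolding volterra.simps(2)[of _ m _ v] volterra.simps(2)[of _ "Suc m" _ v]
    by (intro set_integral_add volterra_set_integrable sinc_fun_props sinhc_fun_props)
  finally show ?case .
qed

lemma sinhc_expansion:
  assumes "\<kappa> \<noteq> 0" "0 \<le> v"
  shows "sinhc (1 - \<kappa>\<^sup>2) v = (\<Sum>m<n. volterra sinc_fun m \<kappa> v) + volterra sinhc_fun n \<kappa> v"
proof (induction n)
  case (Suc n)
  then show ?case using volterra_remainder[OF assms, of n] by simp
qed simp

text \<open>The product-to-sum formula written as an integral: the weight 1/2 on an interval of
  length 2v is v times the average.\<close>

lemma sinc_product:
  fixes \<kappa> v W :: real
  assumes "0 \<le> v" "v \<le> W"
  shows "sin (\<kappa> * v) / \<kappa> * (sin (\<kappa> * W) / \<kappa>) = (LINT s:{W - v..W + v}|lborel. 1/2 * (sin (\<kappa> * s) / \<kappa>))"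
proof (cases "\<kappa> = 0")
  case True
  then show ?thesis by (simp add: set_lebesgue_integral_def)
next
  case False
  have "(LINT s:{W - v..W + v}|lborel. 1/2 * (sin (\<kappa> * s) / \<kappa>))
      = - cos (\<kappa> * (W + v)) / (2 * \<kappa>\<^sup>2) - (- cos (\<kappa> * (W - v)) / (2 * \<kappa>\<^sup>2))"
  proof (rule set_integral_FTC_real)
    fix x
    show "((\<lambda>s. - cos (\<kappa> * s) / (2 * \<kappa>\<^sup>2)) has_real_derivative 1/2 * (sin (\<kappa> * x) / \<kappa>)) (at x)"
      using False by (auto intro!: derivative_eq_intros simp: power2_eq_square)
  qed (use assms False in \<open>auto intro!: continuous_intros\<close>)
  also have "\<dots> = (cos (\<kappa> * W - \<kappa> * v) - cos (\<kappa> * W + \<kappa> * v)) / (2 * \<kappa>\<^sup>2)"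
    by (simp add: algebra_simps diff_divide_distrib)
  also have "cos (\<kappa> * W - \<kappa> * v) - cos (\<kappa> * W + \<kappa> * v) = 2 * (sin (\<kappa> * v) * sin (\<kappa> * W))"
    by (simp add: cos_diff cos_add)
  finally show ?thesis by (simp add: power2_eq_square)
qed

context
  fixes \<kappa> :: "real^2 \<Rightarrow> real"
  assumes \<kappa>_measurable [measurable]: "\<kappa> \<in> borel_measurable borel"
begin

text \<open>The weight g may change sign; only its pairings with waves of time at least W - v are
  known to be nonnegative. Integrating these pairings over s gives the claim.\<close>

lemma sinc_product_pos:
  fixes g :: "real^2 \<Rightarrow> real"
  assumes g: "integrable lborel g" and vW: "0 \<le> v" "v \<le> W"
    and pos: "\<And>s. W - v \<le> s \<Longrightarrow> 0 \<le> (LINT z|lborel. g z * (sin (\<kappa> z * s) / \<kappa> z))"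
  shows "0 \<le> (LINT z|lborel. g z * (sin (\<kappa> z * v) / \<kappa> z * (sin (\<kappa> z * W) / \<kappa> z)))"
proof -
  let ?f = "\<lambda>s z. indicat_real {W - v..W + v} s * (1/2 * (sin (\<kappa> z * s) / \<kappa> z))"
  have "(LINT z|lborel. g z * (sin (\<kappa> z * v) / \<kappa> z * (sin (\<kappa> z * W) / \<kappa> z)))
      = (LINT z|lborel. g z * (LINT s|lborel. ?f s z))"
    unfolding sinc_product[OF vW] set_lebesgue_integral_def real_scaleR_def ..
  also have "\<dots> = (LINT s|lborel. LINT z|lborel. g z * ?f s z)"
  proof (rule lborel_integral_swap[OF g])
    show "integrable lborel (\<lambda>s. indicat_real {W - v..W + v} s * (W + v))"
      by (intro integrable_mult_left integrable_real_indicator) (auto simp: emeasure_lborel_Icc_eq)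
    show "\<bar>?f s z\<bar> \<le> indicat_real {W - v..W + v} s * (W + v)" for s z
    proof (cases "s \<in> {W - v..W + v}")
      case True
      then show ?thesis using abs_sin_div_le[of s "\<kappa> z"] vW by auto
    qed simp
  qed measurable
  also have "\<dots> = (LINT s|lborel. indicat_real {W - v..W + v} s * (1/2 * (LINT z|lborel. g z * (sin (\<kappa> z * s) / \<kappa> z))))"
    by (simp add: mult.left_commute[of "g _"] mult.assoc flip: integral_mult_right_zero integral_divide_zero)
  also have "\<dots> \<ge> 0"
    by (rule Bochner_Integration.integral_nonneg) (use pos in \<open>auto split: split_indicator\<close>)
  finally show ?thesis .
qed

context
  fixes g :: "real^2 \<Rightarrow> real"
  assumes g: "integrable lborel g"
    and sinc_pos: "\<And>s. 0 \<le> s \<Longrightarrow> 0 \<le> (LINT z|lborel. g z * (sin (\<kappa> z * s) / \<kappa> z))"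
begin

lemma volterra_mult_integrable:
  assumes f: "case_prod f \<in> borel_measurable (borel \<Otimes>\<^sub>M borel)"
    and bd: "\<And>\<kappa> v. 0 \<le> v \<Longrightarrow> \<bar>f \<kappa> v\<bar> \<le> exp (2 * v)" and v: "0 \<le> v"
  shows "integrable lborel (\<lambda>z. g z * volterra f m (\<kappa> z) v)"
proof -
  note [measurable] = borel_measurable_volterra'[OF f]
  have [measurable]: "g \<in> borel_measurable borel" using g by auto
  have "integrable lborel (\<lambda>z. g z * (exp (2 * v) * (v ^ m / fact m)))" using g by simp
  then show ?thesis
  proof (rule Bochner_Integration.integrable_bound)
    have "\<bar>volterra f m (\<kappa> z) v\<bar> \<le> \<bar>exp (2 * v) * (v ^ m / fact m)\<bar>" for z
      by (rule order_trans[OF volterra_bound[of f, OF bd v] abs_ge_self])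
    then show "AE z in lborel. norm (g z * volterra f m (\<kappa> z) v) \<le> norm (g z * (exp (2 * v) * (v ^ m / fact m)))"
      by (intro AE_I2) (simp only: real_norm_def abs_mult mult_left_mono abs_ge_zero)
  qed simp
qed

text \<open>The companion time W is generalised so that the induction closes. After exchanging
  integrals, the iterate at time x is absorbed into the weight, and \<open>sinc_product_pos\<close>
  merges the sines of times v - x and W.\<close>

lemma volterra_sinc_pos:
  "0 \<le> v \<Longrightarrow> v \<le> W \<Longrightarrow> 0 \<le> (LINT z|lborel. g z * (volterra sinc_fun m (\<kappa> z) v * (sin (\<kappa> z * W) / \<kappa> z)))"
proof (induction m arbitrary: v W)
  case 0
  then show ?case using sinc_product_pos[OF g 0 sinc_pos] by simp
next
  case (Suc m)
  note [measurable] = borel_measurable_volterra'[OF sinc_fun_measurable]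
  let ?f = "\<lambda>x z. indicat_real {0..v} x * (sin (\<kappa> z * (v - x)) / \<kappa> z * volterra sinc_fun m (\<kappa> z) x) * (sin (\<kappa> z * W) / \<kappa> z)"
  have "(LINT z|lborel. g z * (volterra sinc_fun (Suc m) (\<kappa> z) v * (sin (\<kappa> z * W) / \<kappa> z)))
      = (LINT z|lborel. g z * (LINT x|lborel. ?f x z))"
    by (simp add: set_lebesgue_integral_def)
  also have "\<dots> = (LINT x|lborel. LINT z|lborel. g z * ?f x z)"
  proof (rule lborel_integral_swap[OF g])
    show "integrable lborel (\<lambda>x. indicat_real {0..v} x * (v * (exp (2 * v) * (v ^ m / fact m)) * W))"
      by (intro integrable_mult_left integrable_real_indicator) (auto simp: emeasure_lborel_Icc_eq)
    show "\<bar>?f x z\<bar> \<le> indicat_real {0..v} x * (v * (exp (2 * v) * (v ^ m / fact m)) * W)" for x z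
    proof (cases "x \<in> {0..v}")
      case True
      have "\<bar>sin (\<kappa> z * (v - x)) / \<kappa> z * volterra sinc_fun m (\<kappa> z) x * (sin (\<kappa> z * W) / \<kappa> z)\<bar>
          \<le> (v - x) * (exp (2 * x) * (x ^ m / fact m)) * W"
        unfolding abs_mult using True Suc.prems
        by (intro mult_mono abs_sin_div_le volterra_bound sinc_fun_bound) auto
      also have "\<dots> \<le> v * (exp (2 * v) * (v ^ m / fact m)) * W"
        using True Suc.prems by (intro mult_mono divide_right_mono power_mono) auto
      finally show ?thesis using True by simp
    qed simp
  qed measurable
  also have "\<dots> = (LINT x|lborel. indicat_real {0..v} x *
      (LINT z|lborel. (g z * volterra sinc_fun m (\<kappa> z) x) * (sin (\<kappa> z * (v - x)) / \<kappa> z * (sin (\<kappa> z * W) / \<kappa> z))))"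
    by (simp add: mult_ac flip: integral_mult_right_zero)
  also have "\<dots> \<ge> 0"
  proof (rule Bochner_Integration.integral_nonneg)
    fix x
    show "0 \<le> indicat_real {0..v} x *
      (LINT z|lborel. (g z * volterra sinc_fun m (\<kappa> z) x) * (sin (\<kappa> z * (v - x)) / \<kappa> z * (sin (\<kappa> z * W) / \<kappa> z)))"
    proof (cases "x \<in> {0..v}")
      case True
      have "0 \<le> (LINT z|lborel. (g z * volterra sinc_fun m (\<kappa> z) x) * (sin (\<kappa> z * (v - x)) / \<kappa> z * (sin (\<kappa> z * W) / \<kappa> z)))"
      proof (rule sinc_product_pos)
        show "integrable lborel (\<lambda>z. g z * volterra sinc_fun m (\<kappa> z) x)"
          using True by (intro volterra_mult_integrable sinc_fun_props) auto
        show "0 \<le> (LINT z|lborel. g z * volterra sinc_fun m (\<kappa> z) x * (sin (\<kappa> z * s) / \<kappa> z))"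
          if "W - (v - x) \<le> s" for s
          \<comment> \<open>The induction hypothesis needs x \<le> s, which follows from s \<ge> W -
            (v - x) and W \<ge> v.\<close>
          using Suc.IH[of x s] True Suc.prems that by (simp add: mult.assoc)
      qed (use True Suc.prems in auto)
      then show ?thesis by (simp add: True)
    qed simp
  qed
  finally show ?case .
qed

text \<open>Every finite partial sum of the expansion pairs nonnegatively with W = v, and the
  pairing of the remainder is bounded by a multiple of v^n/n!.\<close>

lemma sinhc_sinc_pos:
  assumes v: "0 \<le> v" and ae: "AE z in lborel. \<kappa> z \<noteq> 0"
  shows "0 \<le> (LINT z|lborel. g z * (sinhc (1 - (\<kappa> z)\<^sup>2) v * (sin (\<kappa> z * v) / \<kappa> z)))"
proof -
  note [measurable] = borel_measurable_volterra'[OF sinc_fun_measurable] borel_measurable_volterra'[OF sinhc_fun_measurable]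
  have gm [measurable]: "g \<in> borel_measurable borel" using g by auto
  have int: "integrable lborel (\<lambda>z. g z * (volterra f m (\<kappa> z) v * (sin (\<kappa> z * v) / \<kappa> z)))"
    and bound: "\<bar>LINT z|lborel. g z * (volterra f m (\<kappa> z) v * (sin (\<kappa> z * v) / \<kappa> z))\<bar>
      \<le> (LINT z|lborel. \<bar>g z\<bar>) * (exp (2 * v) * (v ^ m / fact m) * v)"
    if f: "case_prod f \<in> borel_measurable (borel \<Otimes>\<^sub>M borel)" "\<And>\<kappa> v. 0 \<le> v \<Longrightarrow> \<bar>f \<kappa> v\<bar> \<le> exp (2 * v)" for f m
  proof -
    note [measurable] = borel_measurable_volterra'[OF f(1)]
    have i: "integrable lborel (\<lambda>z. \<bar>g z\<bar> * (exp (2 * v) * (v ^ m / fact m) * v))" using g by simp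
    have b: "\<bar>g z * (volterra f m (\<kappa> z) v * (sin (\<kappa> z * v) / \<kappa> z))\<bar> \<le> \<bar>g z\<bar> * (exp (2 * v) * (v ^ m / fact m) * v)" for z
      unfolding abs_mult using v by (intro mult_mono volterra_bound f abs_sin_div_le) auto
    show "integrable lborel (\<lambda>z. g z * (volterra f m (\<kappa> z) v * (sin (\<kappa> z * v) / \<kappa> z)))"
      using i by (rule Bochner_Integration.integrable_bound) (use b v in \<open>auto simp: abs_mult\<close>)
    then have "\<bar>LINT z|lborel. g z * (volterra f m (\<kappa> z) v * (sin (\<kappa> z * v) / \<kappa> z))\<bar>
      \<le> (LINT z|lborel. \<bar>g z\<bar> * (exp (2 * v) * (v ^ m / fact m) * v))"
      by (intro integral_abs_bound[THEN order_trans] integral_mono integrable_abs i b)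
    then show "\<bar>LINT z|lborel. g z * (volterra f m (\<kappa> z) v * (sin (\<kappa> z * v) / \<kappa> z))\<bar>
      \<le> (LINT z|lborel. \<bar>g z\<bar>) * (exp (2 * v) * (v ^ m / fact m) * v)" by simp
  qed
  let ?I = "LINT z|lborel. g z * (sinhc (1 - (\<kappa> z)\<^sup>2) v * (sin (\<kappa> z * v) / \<kappa> z))"
  define e where "e = (\<lambda>n. (LINT z|lborel. \<bar>g z\<bar>) * (exp (2 * v) * (v ^ n / fact n) * v))"
  have low: "- e n \<le> ?I" for n
  proof -
    \<comment> \<open>The expansion fails at \<kappa> = 0, where sin(\<kappa> v)/\<kappa> has its
      default value; hence the equality almost everywhere.\<close>
    have "?I = (LINT z|lborel. (\<Sum>m<n. g z * (volterra sinc_fun m (\<kappa> z) v * (sin (\<kappa> z * v) / \<kappa> z)))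
        + g z * (volterra sinhc_fun n (\<kappa> z) v * (sin (\<kappa> z * v) / \<kappa> z)))"
    proof (rule integral_cong_AE)
      show "AE z in lborel. g z * (sinhc (1 - (\<kappa> z)\<^sup>2) v * (sin (\<kappa> z * v) / \<kappa> z))
        = (\<Sum>m<n. g z * (volterra sinc_fun m (\<kappa> z) v * (sin (\<kappa> z * v) / \<kappa> z)))
        + g z * (volterra sinhc_fun n (\<kappa> z) v * (sin (\<kappa> z * v) / \<kappa> z))"
        using ae
      proof eventually_elim
        case (elim z)
        show ?case
          by (subst sinhc_expansion[OF elim v, of n])
             (simp only: distrib_right distrib_left sum_distrib_left sum_distrib_right)
      qed
    qed simp_all
    also have "\<dots> = (\<Sum>m<n. LINT z|lborel. g z * (volterra sinc_fun m (\<kappa> z) v * (sin (\<kappa> z * v) / \<kappa> z)))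
        + (LINT z|lborel. g z * (volterra sinhc_fun n (\<kappa> z) v * (sin (\<kappa> z * v) / \<kappa> z)))"
    proof (subst Bochner_Integration.integral_add)
      have i1: "integrable lborel (\<lambda>z. g z * (volterra sinc_fun m (\<kappa> z) v * (sin (\<kappa> z * v) / \<kappa> z)))" for m
        by (intro int sinc_fun_props)
      then show "integrable lborel (\<lambda>z. \<Sum>m<n. g z * (volterra sinc_fun m (\<kappa> z) v * (sin (\<kappa> z * v) / \<kappa> z)))"
        by (rule Bochner_Integration.integrable_sum)
      show "integrable lborel (\<lambda>z. g z * (volterra sinhc_fun n (\<kappa> z) v * (sin (\<kappa> z * v) / \<kappa> z)))"
        by (intro int sinhc_fun_props)
      show "(LINT z|lborel. (\<Sum>m<n. g z * (volterra sinc_fun m (\<kappa> z) v * (sin (\<kappa> z * v) / \<kappa> z))))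
        + (LINT z|lborel. g z * (volterra sinhc_fun n (\<kappa> z) v * (sin (\<kappa> z * v) / \<kappa> z)))
        = (\<Sum>m<n. LINT z|lborel. g z * (volterra sinc_fun m (\<kappa> z) v * (sin (\<kappa> z * v) / \<kappa> z)))
        + (LINT z|lborel. g z * (volterra sinhc_fun n (\<kappa> z) v * (sin (\<kappa> z * v) / \<kappa> z)))"
        using Bochner_Integration.integral_sum[of "{..<n}", OF i1] by simp
    qed
    also have "\<dots> \<ge> 0 + - e n"
      using bound[OF sinhc_fun_props, of n] v unfolding e_def
      by (intro add_mono sum_nonneg volterra_sinc_pos) (auto simp: abs_le_iff)
    finally show ?thesis by simp
  qed
  have "(\<lambda>n. v ^ n / fact n) \<longlonglongrightarrow> 0"
    using summable_LIMSEQ_zero[OF summable_exp[of v]] by (simp add: divide_inverse mult.commute)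
  then have "(\<lambda>n. - ((LINT z|lborel. \<bar>g z\<bar>) * (exp (2 * v) * (v ^ n / fact n) * v))) \<longlonglongrightarrow> - ((LINT z|lborel. \<bar>g z\<bar>) * (exp (2 * v) * 0 * v))"
    by (intro tendsto_intros)
  then have "(\<lambda>n. - e n) \<longlonglongrightarrow> 0" by (simp add: e_def)
  then show ?thesis by (rule LIMSEQ_le_const2) (use low in blast)
qed

end

end

section \<open>Positivity of the kernel\<close>

text \<open>Rotating by the polar angle of x reduces the claim to Bessel's integral.\<close>

lemma circle_integral_cos: "(LINT \<theta>:{0..2*pi}|lborel. cos (polar a \<theta> \<bullet> x)) = 2 * pi * bessel_J0 (a * norm x)"
proof -
  obtain \<psi> where \<psi>: "0 \<le> \<psi>" "\<psi> < 2*pi" "x = polar (norm x) \<psi>" using polar_exists[of x] by auto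
  define z where "z = a * norm x"
  have inner: "polar a \<theta> \<bullet> x = z * cos (\<theta> - \<psi>)" for \<theta>
    by (subst \<psi>(3)) (simp add: inner_polar z_def)
  have I: "integrable lborel (\<lambda>\<theta>. indicat_real {0..2*pi} \<theta> * cos (z * cos (\<theta> - c)))" for c
    using borel_integrable_atLeastAtMost'[of 0 "2*pi" "\<lambda>\<theta>. cos (z * cos (\<theta> - c))"]
    by (simp add: set_integrable_def continuous_intros)
  have I1: "integrable lborel (\<lambda>\<theta>. indicat_real {0..2*pi} \<theta>)"
    by (rule integrable_real_indicator) (auto simp: emeasure_lborel_Icc_eq)
  \<comment> \<open>Adding 1 makes the integrand nonnegative, so that the shift lemma for extended
    integrals applies; the constant 2 pi is cancelled afterwards.\<close>
  have nn: "ennreal ((LINT \<theta>:{0..2*pi}|lborel. cos (z * cos (\<theta> - c))) + 2 * pi)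
      = (\<integral>\<^sup>+\<theta>\<in>{0..2*pi}. ennreal (1 + cos (z * cos (\<theta> - c))) \<partial>lborel)" for c
  proof -
    have p: "0 \<le> 1 + cos y" for y :: real using cos_ge_minus_one[of y] by linarith
    have "(\<integral>\<^sup>+\<theta>\<in>{0..2*pi}. ennreal (1 + cos (z * cos (\<theta> - c))) \<partial>lborel)
        = (\<integral>\<^sup>+\<theta>. ennreal (indicat_real {0..2*pi} \<theta> + indicat_real {0..2*pi} \<theta> * cos (z * cos (\<theta> - c))) \<partial>lborel)"
      by (intro nn_integral_cong) (auto split: split_indicator)
    also have "\<dots> = ennreal (LINT \<theta>|lborel. indicat_real {0..2*pi} \<theta> + indicat_real {0..2*pi} \<theta> * cos (z * cos (\<theta> - c)))"
      using p by (intro nn_integral_eq_integral Bochner_Integration.integrable_add I I1) (auto split: split_indicator)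
    also have "(LINT \<theta>|lborel. indicat_real {0..2*pi} \<theta> + indicat_real {0..2*pi} \<theta> * cos (z * cos (\<theta> - c)))
        = (LINT \<theta>:{0..2*pi}|lborel. cos (z * cos (\<theta> - c))) + 2 * pi"
      by (subst Bochner_Integration.integral_add[OF I1 I]) (simp add: set_lebesgue_integral_def)
    finally show ?thesis by simp
  qed
  have pos: "0 \<le> (LINT \<theta>:{0..2*pi}|lborel. cos (z * cos (\<theta> - c))) + 2 * pi" for c
  proof -
    have "- (2 * pi) = (LINT \<theta>|lborel. indicat_real {0..2*pi} \<theta> * (-1))" by simp
    also have "\<dots> \<le> (LINT \<theta>|lborel. indicat_real {0..2*pi} \<theta> * cos (z * cos (\<theta> - c)))"
      by (intro integral_mono I integrable_mult_left I1) (auto split: split_indicator)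
    finally show ?thesis by (simp add: set_lebesgue_integral_def)
  qed
  have "ennreal ((LINT \<theta>:{0..2*pi}|lborel. cos (z * cos (\<theta> - \<psi>))) + 2 * pi)
      = ennreal ((LINT \<theta>:{0..2*pi}|lborel. cos (z * cos (\<theta> - 0))) + 2 * pi)"
    unfolding nn using \<psi> nn_integral_circle_shift[of "\<lambda>\<theta>. ennreal (1 + cos (z * cos \<theta>))" \<psi>] by simp
  then have "(LINT \<theta>:{0..2*pi}|lborel. cos (z * cos (\<theta> - \<psi>))) = (LINT \<theta>:{0..2*pi}|lborel. cos (z * cos \<theta>))"
    using pos[of \<psi>] pos[of 0] by (simp add: ennreal_inj)
  then show ?thesis unfolding inner bessel_J0_integral z_def .
qed

text \<open>Integrating a suitable even symbol against this weight gives, up to the factor (2 pi)^2,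
  the Gaussian regularisation of its kernel at the point x.\<close>

definition gauss_weight :: "real \<Rightarrow> real^2 \<Rightarrow> real^2 \<Rightarrow> real" where
  "gauss_weight \<epsilon> x \<zeta> = cos (x \<bullet> \<zeta>) * exp (- (\<epsilon> * (norm \<zeta>)\<^sup>2 / 2))"

context
  fixes \<epsilon> :: real and x :: "real^2"
  assumes \<epsilon>: "0 < \<epsilon>"
begin

lemma gauss_weight_integrable: "integrable lborel (gauss_weight \<epsilon> x)"
  unfolding gauss_weight_def[abs_def] by (rule gauss_plane_cos[OF \<epsilon>])

lemma gauss_weight_measurable [measurable]: "gauss_weight \<epsilon> x \<in> borel_measurable borel"
  using gauss_weight_integrable by auto

text \<open>The product of cosines splits into the frequencies x - y and x + y, and the transform of
  a Gaussian is positive at both.\<close>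

lemma gauss_weight_cos_pos: "0 \<le> (LINT \<zeta>|lborel. gauss_weight \<epsilon> x \<zeta> * cos (y \<bullet> \<zeta>))"
proof -
  have eq: "gauss_weight \<epsilon> x \<zeta> * cos (y \<bullet> \<zeta>) = 1/2 * (cos ((x - y) \<bullet> \<zeta>) * exp (- (\<epsilon> * (norm \<zeta>)\<^sup>2 / 2)))
      + 1/2 * (cos ((x + y) \<bullet> \<zeta>) * exp (- (\<epsilon> * (norm \<zeta>)\<^sup>2 / 2)))" for \<zeta>
    by (simp add: gauss_weight_def inner_add_left inner_diff_left cos_add cos_diff field_simps)
  show ?thesis
    unfolding eq using \<epsilon>
    by (subst Bochner_Integration.integral_add)
       (intro integrable_mult_right gauss_plane_cos \<epsilon>, intro integrable_mult_right gauss_plane_cos \<epsilon>,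
        simp only: integral_mult_right_zero gauss_plane_cos(2)[OF \<epsilon>], simp)
qed

lemma gauss_weight_J0_pos: "0 \<le> (LINT \<zeta>|lborel. gauss_weight \<epsilon> x \<zeta> * bessel_J0 (a * norm \<zeta>))"
proof -
  let ?f = "\<lambda>\<theta> \<zeta>. indicat_real {0..2*pi} \<theta> * cos (polar a \<theta> \<bullet> \<zeta>)"
  have "2 * pi * (LINT \<zeta>|lborel. gauss_weight \<epsilon> x \<zeta> * bessel_J0 (a * norm \<zeta>))
      = (LINT \<zeta>|lborel. gauss_weight \<epsilon> x \<zeta> * (2 * pi * bessel_J0 (a * norm \<zeta>)))"
    by (simp add: mult.left_commute flip: integral_mult_right_zero)
  also have "\<dots> = (LINT \<zeta>|lborel. gauss_weight \<epsilon> x \<zeta> * (LINT \<theta>|lborel. ?f \<theta> \<zeta>))"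
    unfolding circle_integral_cos[symmetric] set_lebesgue_integral_def real_scaleR_def ..
  also have "\<dots> = (LINT \<theta>|lborel. LINT \<zeta>|lborel. gauss_weight \<epsilon> x \<zeta> * ?f \<theta> \<zeta>)"
  proof (rule lborel_integral_swap[OF gauss_weight_integrable])
    show "integrable lborel (\<lambda>\<theta>. indicat_real {0..2*pi} \<theta>)"
      by (rule integrable_real_indicator) (auto simp: emeasure_lborel_Icc_eq)
  qed (auto split: split_indicator)
  also have "\<dots> = (LINT \<theta>|lborel. indicat_real {0..2*pi} \<theta> * (LINT \<zeta>|lborel. gauss_weight \<epsilon> x \<zeta> * cos (polar a \<theta> \<bullet> \<zeta>)))"
    by (simp add: mult.left_commute flip: integral_mult_right_zero)
  also have "\<dots> \<ge> 0"
    by (rule Bochner_Integration.integral_nonneg) (use gauss_weight_cos_pos in \<open>auto split: split_indicator\<close>)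
  finally show ?thesis using pi_gt_zero by (simp add: zero_le_mult_iff)
qed

text \<open>By the sphere formula for the sine cardinal this is the positivity of the two-dimensional wave kernel.\<close>

lemma gauss_weight_sinc_pos:
  assumes s: "0 \<le> s"
  shows "0 \<le> (LINT \<zeta>|lborel. gauss_weight \<epsilon> x \<zeta> * (sin (norm \<zeta> / 2 * s) / (norm \<zeta> / 2)))"
proof -
  \<comment> \<open>The sphere formula is taken at z = s |\<zeta>| / 2; the half comes from \<kappa>
    = |\<zeta>| / 2, hence the radius s/2.\<close>
  let ?f = "\<lambda>\<mu> \<zeta>. indicat_real {-1..1} \<mu> * (s / 2 * bessel_J0 (s / 2 * sqrt (1 - \<mu>\<^sup>2) * norm \<zeta>))"
  have eq: "sin (norm \<zeta> / 2 * s) / (norm \<zeta> / 2) = (LINT \<mu>|lborel. ?f \<mu> \<zeta>)" if "norm \<zeta> \<noteq> 0" for \<zeta> :: "real^2"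
  proof -
    have "(LINT \<mu>|lborel. ?f \<mu> \<zeta>) = s / 2 * (LINT \<mu>|lborel. indicat_real {-1..1} \<mu> * bessel_J0 (norm \<zeta> / 2 * s * sqrt (1 - \<mu>\<^sup>2)))"
      unfolding integral_mult_right_zero[symmetric] by (simp add: mult_ac)
    also have "\<dots> = (norm \<zeta> / 2 * s) * (LINT \<mu>:{-1..1}|lborel. bessel_J0 (norm \<zeta> / 2 * s * sqrt (1 - \<mu>\<^sup>2))) / norm \<zeta>"
      using that by (simp add: set_lebesgue_integral_def)
    finally show ?thesis unfolding sinc_eq_integral_J0 by simp
  qed
  have "(LINT \<zeta>|lborel. gauss_weight \<epsilon> x \<zeta> * (sin (norm \<zeta> / 2 * s) / (norm \<zeta> / 2)))
      = (LINT \<zeta>|lborel. gauss_weight \<epsilon> x \<zeta> * (LINT \<mu>|lborel. ?f \<mu> \<zeta>))"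
    by (rule integral_cong_AE, simp, simp, use AE_norm_plane_neq[of 0] in eventually_elim) (subst eq, simp, simp)
  also have "\<dots> = (LINT \<mu>|lborel. LINT \<zeta>|lborel. gauss_weight \<epsilon> x \<zeta> * ?f \<mu> \<zeta>)"
  proof (rule lborel_integral_swap[OF gauss_weight_integrable])
    show "integrable lborel (\<lambda>\<mu>::real. indicat_real {-1..1} \<mu> * (s / 2))"
      by (intro integrable_mult_left integrable_real_indicator) (auto simp: emeasure_lborel_Icc_eq)
    have "s / 2 * \<bar>bessel_J0 y\<bar> \<le> s / 2 * 1" for y
      using s by (intro mult_left_mono abs_bessel_J0_le_1) auto
    then show "\<bar>?f \<mu> \<zeta>\<bar> \<le> indicat_real {-1..1} \<mu> * (s / 2)" for \<mu> \<zeta>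
      using s by (auto simp: abs_mult split: split_indicator)
  qed measurable
  also have "\<dots> = (LINT \<mu>|lborel. indicat_real {-1..1} \<mu> * (s / 2 *
      (LINT \<zeta>|lborel. gauss_weight \<epsilon> x \<zeta> * bessel_J0 (s / 2 * sqrt (1 - \<mu>\<^sup>2) * norm \<zeta>))))"
    by (simp add: mult_ac flip: integral_mult_right_zero integral_divide_zero)
  also have "\<dots> \<ge> 0"
    using s by (intro Bochner_Integration.integral_nonneg mult_nonneg_nonneg gauss_weight_J0_pos) auto
  finally show ?thesis .
qed

text \<open>The Gaussian representation displays the pairing as an integral over v > 0, with
  positive weight, of the pairings treated by \<open>sinhc_sinc_pos\<close>.\<close>

lemma gauss_weight_S_hat_pos:
  assumes t: "0 < t"
  shows "0 \<le> (LINT \<zeta>|lborel. gauss_weight \<epsilon> x \<zeta> * S_hat (Suc 0) t (norm \<zeta>))"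
proof -
  define c where "c = exp (- t) / (2 * sqrt (pi * t))"
  have c: "0 < c" using t by (simp add: c_def)
  let ?f = "\<lambda>v \<zeta>. indicat_real {0<..} v * (exp (- v\<^sup>2 / (4 * t)) * (sin (norm \<zeta> / 2 * v) / (norm \<zeta> / 2) * sinhc (1 - (norm \<zeta> / 2)\<^sup>2) v))"
  have "(LINT \<zeta>|lborel. gauss_weight \<epsilon> x \<zeta> * S_hat (Suc 0) t (norm \<zeta>))
      = (LINT \<zeta>|lborel. c * (gauss_weight \<epsilon> x \<zeta> * (LINT v|lborel. ?f v \<zeta>)))"
  proof (rule integral_cong_AE)
    show "AE \<zeta> in lborel. gauss_weight \<epsilon> x \<zeta> * S_hat (Suc 0) t (norm \<zeta>) = c * (gauss_weight \<epsilon> x \<zeta> * (LINT v|lborel. ?f v \<zeta>))"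
      \<comment> \<open>The representation excludes the frequencies 0 and 2, which form null
        circles.\<close>
      using AE_norm_plane_neq[of 0] AE_norm_plane_neq[of 2]
    proof eventually_elim
      case (elim \<zeta>)
      then have "0 < norm \<zeta>" by simp
      from S_hat_1_gauss[OF t this elim(2)] show ?case
        by (simp only: c_def set_lebesgue_integral_def real_scaleR_def mult.left_commute)
    qed
  qed measurable
  also have "\<dots> = c * (LINT \<zeta>|lborel. gauss_weight \<epsilon> x \<zeta> * (LINT v|lborel. ?f v \<zeta>))"
    by (rule integral_mult_right_zero)
  also have "(LINT \<zeta>|lborel. gauss_weight \<epsilon> x \<zeta> * (LINT v|lborel. ?f v \<zeta>)) = (LINT v|lborel. LINT \<zeta>|lborel. gauss_weight \<epsilon> x \<zeta> * ?f v \<zeta>)"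
  proof (rule lborel_integral_swap[OF gauss_weight_integrable])
    \<comment> \<open>The factor exp(3v) is exp(v), from bounding v in the sine quotient, times
      exp(2v), from \<open>sinhc_fun_bound\<close>.\<close>
    show "integrable lborel (\<lambda>v. exp (- v\<^sup>2 / (4 * t)) * exp (3 * v))"
      using gauss_real(1)[OF t, of 3 0] by simp
    show "\<bar>?f v \<zeta>\<bar> \<le> exp (- v\<^sup>2 / (4 * t)) * exp (3 * v)" for v \<zeta>
    proof (cases "0 < v")
      case True
      have "\<bar>sin (norm \<zeta> / 2 * v) / (norm \<zeta> / 2) * sinhc (1 - (norm \<zeta> / 2)\<^sup>2) v\<bar> \<le> v * exp (2 * v)"
        unfolding abs_mult using True by (intro mult_mono abs_sin_div_le sinhc_fun_bound) auto
      also have "\<dots> \<le> exp v * exp (2 * v)" using le_exp[of v] by (intro mult_right_mono) auto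
      also have "\<dots> = exp (3 * v)" by (simp add: exp_add[symmetric])
      finally have "exp (- v\<^sup>2 / (4 * t)) * \<bar>sin (norm \<zeta> / 2 * v) / (norm \<zeta> / 2) * sinhc (1 - (norm \<zeta> / 2)\<^sup>2) v\<bar>
          \<le> exp (- v\<^sup>2 / (4 * t)) * exp (3 * v)" by (intro mult_left_mono) auto
      then show ?thesis using True by (simp add: abs_mult)
    qed simp
  qed measurable
  also have "\<dots> = (LINT v|lborel. indicat_real {0<..} v * (exp (- v\<^sup>2 / (4 * t)) *
      (LINT \<zeta>|lborel. gauss_weight \<epsilon> x \<zeta> * (sinhc (1 - (norm \<zeta> / 2)\<^sup>2) v * (sin (norm \<zeta> / 2 * v) / (norm \<zeta> / 2))))))"
    unfolding integral_mult_right_zero[symmetric] by (simp only: mult_ac)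
  also have "c * \<dots> \<ge> 0"
  proof (rule mult_nonneg_nonneg[OF less_imp_le[OF c] Bochner_Integration.integral_nonneg])
    fix v
    show "0 \<le> indicat_real {0<..} v * (exp (- v\<^sup>2 / (4 * t)) *
      (LINT \<zeta>|lborel. gauss_weight \<epsilon> x \<zeta> * (sinhc (1 - (norm \<zeta> / 2)\<^sup>2) v * (sin (norm \<zeta> / 2 * v) / (norm \<zeta> / 2)))))"
    proof (cases "0 < v")
      case True
      have "0 \<le> (LINT \<zeta>|lborel. gauss_weight \<epsilon> x \<zeta> * (sinhc (1 - (norm \<zeta> / 2)\<^sup>2) v * (sin (norm \<zeta> / 2 * v) / (norm \<zeta> / 2))))"
      proof (rule sinhc_sinc_pos[OF _ gauss_weight_integrable gauss_weight_sinc_pos])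
        show "AE \<zeta> in (lborel :: (real^2) measure). norm \<zeta> / 2 \<noteq> 0"
          using AE_norm_plane_neq[of 0] by eventually_elim simp
      qed (use True in simp_all)
      then show ?thesis using True by simp
    qed simp
  qed
  finally show ?thesis .
qed

end

definition kernel_G_reg :: "real \<Rightarrow> real \<Rightarrow> real \<Rightarrow> real" where
  "kernel_G_reg \<epsilon> t r = 1 / (2 * pi) *
     (LINT k:{0<..}|lborel. S_hat (Suc 0) t k * exp (- (\<epsilon> * k\<^sup>2 / 2)) * bessel_J0 (r * k) * k)"

lemma kernel_G_reg_0: "kernel_G_reg 0 t r = kernel_G t r"
  by (simp add: kernel_G_reg_def kernel_G_def)

lemma gauss_weight_S_hat_integrable:
  assumes \<epsilon>: "0 < \<epsilon>" and t: "0 \<le> t"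
  shows "integrable lborel (\<lambda>\<zeta>. gauss_weight \<epsilon> x \<zeta> * S_hat (Suc 0) t (norm \<zeta>))"
proof -
  obtain C where C: "C > 0" "\<And>k. \<bar>S_hat (Suc 0) t k\<bar> \<le> C / (1 + k\<^sup>2)" using S_hat_1_bound[OF t] by blast
  have C': "\<bar>S_hat (Suc 0) t k\<bar> \<le> C" for k
  proof -
    have "C / (1 + k\<^sup>2) \<le> C / 1" using C(1) by (intro divide_left_mono) (auto simp: add_pos_nonneg)
    with C(2)[of k] show ?thesis by simp
  qed
  note [measurable] = gauss_weight_measurable[OF \<epsilon>]
  have "integrable lborel (\<lambda>\<zeta>. gauss_weight \<epsilon> x \<zeta> * C)"
    using gauss_weight_integrable[OF \<epsilon>] by simp
  then show ?thesis
    by (rule Bochner_Integration.integrable_bound)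
       (use C C' in \<open>auto simp: abs_mult intro!: mult_left_mono intro: order_trans[OF C' abs_ge_self]\<close>)
qed

lemma gauss_weight_S_hat_eq_kernel_G_reg:
  assumes \<epsilon>: "0 < \<epsilon>" and t: "0 \<le> t"
  shows "(LINT \<zeta>|lborel. gauss_weight \<epsilon> x \<zeta> * S_hat (Suc 0) t (norm \<zeta>)) = (2 * pi)\<^sup>2 * kernel_G_reg \<epsilon> t (norm x)"
proof -
  have "(LINT \<zeta>|lborel. gauss_weight \<epsilon> x \<zeta> * S_hat (Suc 0) t (norm \<zeta>))
      = (LINT k:{0<..}|lborel. k * (LINT \<theta>:{0..2*pi}|lborel. gauss_weight \<epsilon> x (polar k \<theta>) * S_hat (Suc 0) t (norm (polar k \<theta>))))"
    by (rule integral_polar[OF gauss_weight_S_hat_integrable[OF \<epsilon> t]])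
  also have "\<dots> = (LINT k:{0<..}|lborel. (2 * pi) * (S_hat (Suc 0) t k * exp (- (\<epsilon> * k\<^sup>2 / 2)) * bessel_J0 (norm x * k) * k))"
  proof (intro set_lebesgue_integral_cong allI impI)
    fix k :: real assume "k \<in> {0<..}"
    then have k: "0 < k" by simp
    have "(LINT \<theta>:{0..2*pi}|lborel. gauss_weight \<epsilon> x (polar k \<theta>) * S_hat (Suc 0) t (norm (polar k \<theta>)))
        = (LINT \<theta>:{0..2*pi}|lborel. S_hat (Suc 0) t k * exp (- (\<epsilon> * k\<^sup>2 / 2)) * cos (polar k \<theta> \<bullet> x))"
      using k by (simp add: gauss_weight_def inner_commute mult_ac)
    also have "\<dots> = S_hat (Suc 0) t k * exp (- (\<epsilon> * k\<^sup>2 / 2)) * (2 * pi * bessel_J0 (k * norm x))"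
      by (simp only: set_integral_mult_right circle_integral_cos)
    finally show "k * (LINT \<theta>:{0..2*pi}|lborel. gauss_weight \<epsilon> x (polar k \<theta>) * S_hat (Suc 0) t (norm (polar k \<theta>)))
        = (2 * pi) * (S_hat (Suc 0) t k * exp (- (\<epsilon> * k\<^sup>2 / 2)) * bessel_J0 (norm x * k) * k)"
      by (simp add: mult_ac)
  qed simp
  also have "\<dots> = (2 * pi)\<^sup>2 * kernel_G_reg \<epsilon> t (norm x)"
    by (simp add: kernel_G_reg_def power2_eq_square)
  finally show ?thesis .
qed

lemma kernel_G_reg_nonneg:
  assumes "0 < \<epsilon>" "0 < t" "0 \<le> r"
  shows "0 \<le> kernel_G_reg \<epsilon> t r"
  using gauss_weight_S_hat_pos[OF assms(1,2), of "polar r 0"] gauss_weight_S_hat_eq_kernel_G_reg[OF assms(1), of t "polar r 0"] assms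
  by (simp add: zero_le_mult_iff)

lemma integrable_sqrt_div: "set_integrable lborel {0<..} (\<lambda>k::real. sqrt k / (1 + k\<^sup>2))"
proof -
  have "(\<integral>\<^sup>+k. ennreal (k powr (-3/2)) * indicator {1..} k \<partial>lborel) = ennreal (0 - (-2 * 1 powr (-1/2)))"
  proof (rule nn_integral_FTC_atLeast[where F = "\<lambda>k. -2 * k powr (-1/2)" and a = 1 and T = 0])
    fix k :: real assume "1 \<le> k"
    then show "((\<lambda>k. -2 * k powr (-1/2)) has_real_derivative k powr (-3/2)) (at k)"
      by (auto intro!: derivative_eq_intros)
  next
    show "((\<lambda>k::real. -2 * k powr (-1/2)) \<longlongrightarrow> 0) at_top" by real_asymp
  qed auto
  then have "integrable lborel (\<lambda>k::real. k powr (-3/2) * indicat_real {1..} k)"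
    by (intro integrableI_bounded) (auto simp: ennreal_mult'' ennreal_indicator intro!: order_le_less_trans[OF eq_refl])
  moreover have "integrable lborel (indicat_real {0..1::real})"
    by (rule integrable_real_indicator) (auto simp: emeasure_lborel_Icc_eq)
  ultimately have "integrable lborel (\<lambda>k. indicat_real {0..1} k + k powr (-3/2) * indicat_real {1..} k)"
    by (intro Bochner_Integration.integrable_add)
  then show ?thesis unfolding set_integrable_def
  proof (rule Bochner_Integration.integrable_bound)
    show "AE k in lborel. norm (indicat_real {0<..} k *\<^sub>R (sqrt k / (1 + k\<^sup>2)))
      \<le> norm (indicat_real {0..1} k + k powr (-3/2) * indicat_real {1..} k)"
    proof (rule AE_I2)
      fix k :: real
      consider "k \<le> 0" | "0 < k" "k \<le> 1" | "1 < k" by linarith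
      then show "norm (indicat_real {0<..} k *\<^sub>R (sqrt k / (1 + k\<^sup>2)))
        \<le> norm (indicat_real {0..1} k + k powr (-3/2) * indicat_real {1..} k)"
      proof cases
        case 2
        then have "sqrt k / (1 + k\<^sup>2) \<le> 1 / 1" by (intro frac_le) auto
        then show ?thesis using 2 by (auto split: split_indicator intro: order_trans)
      next
        case 3
        have "sqrt k / (1 + k\<^sup>2) \<le> sqrt k / k\<^sup>2" using 3 by (intro divide_left_mono) (auto simp: add_pos_pos)
        also have "sqrt k / k\<^sup>2 = k powr (1/2) / k powr 2" using 3 by (simp add: powr_half_sqrt)
        also have "\<dots> = k powr (-3/2)" unfolding powr_diff[symmetric] by simp
        finally show ?thesis using 3 by simp
      qed simp
    qed
  qed measurable
qed

text \<open>The decay of J_0 gives k (1 + k^2)^(-1) (rk)^(-1/2), integrable in k. The constant is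
  independent of \<epsilon>, so the same majorant serves the limit \<epsilon> \<rightarrow>
  0.\<close>

lemma kernel_integrand_bound:
  assumes t: "0 \<le> t"
  obtains C where "C > 0"
    "\<And>\<epsilon> r k. 0 \<le> \<epsilon> \<Longrightarrow> 0 < r \<Longrightarrow> 0 < k \<Longrightarrow>
      \<bar>S_hat (Suc 0) t k * exp (- (\<epsilon> * k\<^sup>2 / 2)) * bessel_J0 (r * k) * k\<bar> \<le> C / sqrt r * (sqrt k / (1 + k\<^sup>2))"
proof -
  obtain C1 where C1: "C1 > 0" "\<And>k. \<bar>S_hat (Suc 0) t k\<bar> \<le> C1 / (1 + k\<^sup>2)" using S_hat_1_bound[OF t] by blast
  obtain C2 where C2: "C2 > 0" "\<And>z. z > 0 \<Longrightarrow> \<bar>bessel_J0 z\<bar> \<le> C2 / sqrt z" using bessel_J0_decay by blast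
  have "\<bar>S_hat (Suc 0) t k * exp (- (\<epsilon> * k\<^sup>2 / 2)) * bessel_J0 (r * k) * k\<bar> \<le> (C1 * C2) / sqrt r * (sqrt k / (1 + k\<^sup>2))"
    if "0 \<le> \<epsilon>" "0 < r" "0 < k" for \<epsilon> r k
  proof -
    have "\<bar>S_hat (Suc 0) t k * exp (- (\<epsilon> * k\<^sup>2 / 2)) * bessel_J0 (r * k) * k\<bar>
        \<le> (C1 / (1 + k\<^sup>2)) * 1 * (C2 / sqrt (r * k)) * k"
      unfolding abs_mult using that C1 C2 by (intro mult_mono) (auto intro!: divide_nonneg_nonneg)
    also have "\<dots> = (C1 * C2) / sqrt r * ((k / sqrt k) / (1 + k\<^sup>2))"
      by (simp add: real_sqrt_mult mult_ac)
    also have "k / sqrt k = sqrt k" using that by (simp add: real_div_sqrt)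
    finally show ?thesis .
  qed
  with that[of "C1 * C2"] C1 C2 show thesis by simp
qed

lemma kernel_G_reg_bound:
  assumes t: "0 \<le> t"
  obtains C where "C > 0" "\<And>\<epsilon> r. 0 \<le> \<epsilon> \<Longrightarrow> 0 < r \<Longrightarrow> \<bar>kernel_G_reg \<epsilon> t r\<bar> \<le> C / sqrt r"
proof -
  obtain C where C: "C > 0" "\<And>\<epsilon> r k. 0 \<le> \<epsilon> \<Longrightarrow> 0 < r \<Longrightarrow> 0 < k \<Longrightarrow>
      \<bar>S_hat (Suc 0) t k * exp (- (\<epsilon> * k\<^sup>2 / 2)) * bessel_J0 (r * k) * k\<bar> \<le> C / sqrt r * (sqrt k / (1 + k\<^sup>2))"
    using kernel_integrand_bound[OF t] by blast
  define I where "I = (LINT k:{0<..}|lborel. sqrt k / (1 + k\<^sup>2) :: real)"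
  have I: "0 \<le> I" unfolding I_def set_lebesgue_integral_def
    by (rule Bochner_Integration.integral_nonneg) (auto split: split_indicator)
  \<comment> \<open>The summand 1 only serves to make the constant strictly positive.\<close>
  have "\<bar>kernel_G_reg \<epsilon> t r\<bar> \<le> (C * I + 1) / sqrt r" if "0 \<le> \<epsilon>" "0 < r" for \<epsilon> r
  proof -
    have D: "integrable lborel (\<lambda>k. indicat_real {0<..} k *\<^sub>R (C / sqrt r * (sqrt k / (1 + k\<^sup>2))))"
      using set_integrable_mult_right[OF integrable_sqrt_div] unfolding set_integrable_def by blast
    have bd: "\<bar>indicat_real {0<..} k *\<^sub>R (S_hat (Suc 0) t k * exp (- (\<epsilon> * k\<^sup>2 / 2)) * bessel_J0 (r * k) * k)\<bar>
        \<le> indicat_real {0<..} k *\<^sub>R (C / sqrt r * (sqrt k / (1 + k\<^sup>2)))" for k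
      using C(2)[OF that, of k] by (auto split: split_indicator)
    have "integrable lborel (\<lambda>k. indicat_real {0<..} k *\<^sub>R (S_hat (Suc 0) t k * exp (- (\<epsilon> * k\<^sup>2 / 2)) * bessel_J0 (r * k) * k))"
      using D
    proof (rule Bochner_Integration.integrable_bound)
      show "AE k in lborel. norm (indicat_real {0<..} k *\<^sub>R (S_hat (Suc 0) t k * exp (- (\<epsilon> * k\<^sup>2 / 2)) * bessel_J0 (r * k) * k))
        \<le> norm (indicat_real {0<..} k *\<^sub>R (C / sqrt r * (sqrt k / (1 + k\<^sup>2))))"
        unfolding real_norm_def by (intro AE_I2 order_trans[OF bd abs_ge_self])
    qed measurable
    then have "\<bar>LINT k:{0<..}|lborel. S_hat (Suc 0) t k * exp (- (\<epsilon> * k\<^sup>2 / 2)) * bessel_J0 (r * k) * k\<bar>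
        \<le> (LINT k:{0<..}|lborel. C / sqrt r * (sqrt k / (1 + k\<^sup>2)))"
      unfolding set_lebesgue_integral_def
      by (intro integral_abs_bound[THEN order_trans] integral_mono integrable_abs bd D)
    also have "\<dots> = C / sqrt r * I" by (simp only: I_def set_integral_mult_right)
    finally have *: "\<bar>LINT k:{0<..}|lborel. S_hat (Suc 0) t k * exp (- (\<epsilon> * k\<^sup>2 / 2)) * bessel_J0 (r * k) * k\<bar> \<le> C / sqrt r * I" .
    have "\<bar>kernel_G_reg \<epsilon> t r\<bar> \<le> 1 * (C / sqrt r * I)"
      unfolding kernel_G_reg_def abs_mult using * pi_ge_two by (intro mult_mono) auto
    also have "\<dots> \<le> (C * I + 1) / sqrt r" using that by (simp add: add_divide_distrib)
    finally show ?thesis .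
  qed
  moreover have "0 < C * I + 1" using C I by (simp add: add_nonneg_pos)
  ultimately show thesis using that by blast
qed

lemma kernel_G_reg_tendsto:
  assumes t: "0 \<le> t" and r: "0 < r"
  shows "(\<lambda>n. kernel_G_reg (1 / real (Suc n)) t r) \<longlonglongrightarrow> kernel_G t r"
proof -
  obtain C where C: "C > 0" "\<And>\<epsilon> r k. 0 \<le> \<epsilon> \<Longrightarrow> 0 < r \<Longrightarrow> 0 < k \<Longrightarrow>
      \<bar>S_hat (Suc 0) t k * exp (- (\<epsilon> * k\<^sup>2 / 2)) * bessel_J0 (r * k) * k\<bar> \<le> C / sqrt r * (sqrt k / (1 + k\<^sup>2))"
    using kernel_integrand_bound[OF t] by blast
  have "(\<lambda>n. LINT k:{0<..}|lborel. S_hat (Suc 0) t k * exp (- (1 / real (Suc n) * k\<^sup>2 / 2)) * bessel_J0 (r * k) * k)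
      \<longlonglongrightarrow> (LINT k:{0<..}|lborel. S_hat (Suc 0) t k * bessel_J0 (r * k) * k)"
    unfolding set_lebesgue_integral_def
  proof (rule integral_dominated_convergence)
    show "integrable lborel (\<lambda>k. indicat_real {0<..} k *\<^sub>R (C / sqrt r * (sqrt k / (1 + k\<^sup>2))))"
      using set_integrable_mult_right[OF integrable_sqrt_div] unfolding set_integrable_def by blast
    show "AE k in lborel. norm (indicat_real {0<..} k *\<^sub>R (S_hat (Suc 0) t k * exp (- (1 / real (Suc n) * k\<^sup>2 / 2)) * bessel_J0 (r * k) * k))
      \<le> indicat_real {0<..} k *\<^sub>R (C / sqrt r * (sqrt k / (1 + k\<^sup>2)))" for n
    proof (rule AE_I2)
      fix k :: real
      show "norm (indicat_real {0<..} k *\<^sub>R (S_hat (Suc 0) t k * exp (- (1 / real (Suc n) * k\<^sup>2 / 2)) * bessel_J0 (r * k) * k))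
        \<le> indicat_real {0<..} k *\<^sub>R (C / sqrt r * (sqrt k / (1 + k\<^sup>2)))"
        using C(2)[of "1 / real (Suc n)" r k] r by (auto split: split_indicator)
    qed
    show "AE k in lborel. (\<lambda>n. indicat_real {0<..} k *\<^sub>R (S_hat (Suc 0) t k * exp (- (1 / real (Suc n) * k\<^sup>2 / 2)) * bessel_J0 (r * k) * k))
      \<longlonglongrightarrow> indicat_real {0<..} k *\<^sub>R (S_hat (Suc 0) t k * bessel_J0 (r * k) * k)"
    proof (rule AE_I2)
      fix k :: real
      have "(\<lambda>n. exp (- (1 / real (Suc n) * k\<^sup>2 / 2))) \<longlonglongrightarrow> exp (- (0 * k\<^sup>2 / 2))"
        by (intro tendsto_intros LIMSEQ_Suc[OF lim_1_over_n]) simp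
      then have "(\<lambda>n. indicat_real {0<..} k *\<^sub>R (S_hat (Suc 0) t k * exp (- (1 / real (Suc n) * k\<^sup>2 / 2)) * bessel_J0 (r * k) * k))
        \<longlonglongrightarrow> indicat_real {0<..} k *\<^sub>R (S_hat (Suc 0) t k * exp (- (0 * k\<^sup>2 / 2)) * bessel_J0 (r * k) * k)"
        by (intro tendsto_scaleR tendsto_mult tendsto_const)
      then show "(\<lambda>n. indicat_real {0<..} k *\<^sub>R (S_hat (Suc 0) t k * exp (- (1 / real (Suc n) * k\<^sup>2 / 2)) * bessel_J0 (r * k) * k))
        \<longlonglongrightarrow> indicat_real {0<..} k *\<^sub>R (S_hat (Suc 0) t k * bessel_J0 (r * k) * k)" by simp
    qed
  qed measurable
  then show ?thesis unfolding kernel_G_reg_def kernel_G_def by (intro tendsto_intros) simp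
qed

lemma kernel_G_nonneg:
  assumes "0 < t" "0 < r"
  shows "0 \<le> kernel_G t r"
  by (rule LIMSEQ_le_const[OF kernel_G_reg_tendsto]) (use assms in \<open>auto intro!: kernel_G_reg_nonneg\<close>)

lemma borel_measurable_kernel_G [measurable (raw)]:
  assumes [measurable]: "f \<in> borel_measurable M" "g \<in> borel_measurable M"
  shows "(\<lambda>x. kernel_G (f x) (g x)) \<in> borel_measurable M"
  unfolding kernel_G_def set_lebesgue_integral_def One_nat_def by measurable

lemma borel_measurable_kernel_G_reg [measurable (raw)]:
  assumes [measurable]: "g \<in> borel_measurable M"
  shows "(\<lambda>x. kernel_G_reg \<epsilon> t (g x)) \<in> borel_measurable M"
  unfolding kernel_G_reg_def set_lebesgue_integral_def by measurable

section \<open>The propagator as a convolution\<close>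

lemma nn_integral_lborel_reflect:
  fixes x :: "'a::euclidean_space"
  assumes [measurable]: "g \<in> borel_measurable borel"
  shows "(\<integral>\<^sup>+y. g (x - y) \<partial>lborel) = (\<integral>\<^sup>+y. g y \<partial>lborel)"
proof -
  have "(\<integral>\<^sup>+y. g y \<partial>lborel) = (\<integral>\<^sup>+y. g (x + (- 1) *\<^sub>R y) \<partial>lborel)"
    by (subst lborel_affine[of "- 1" x]) (simp_all add: nn_integral_density nn_integral_distr)
  then show ?thesis by simp
qed

lemma integrable_pair_mult:
  fixes f :: "'a \<Rightarrow> 'c::{real_normed_field, banach, second_countable_topology}"
  assumes "sigma_finite_measure M1" "sigma_finite_measure M2"
    and f: "integrable M1 f" and g: "integrable M2 g"
  shows "integrable (M1 \<Otimes>\<^sub>M M2) (\<lambda>p. f (fst p) * g (snd p))"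
    and "(LINT p|(M1 \<Otimes>\<^sub>M M2). f (fst p) * g (snd p)) = (LINT x|M1. f x) * (LINT y|M2. g y)"
proof -
  interpret pair_sigma_finite M1 M2
    using assms(1,2) by (rule pair_sigma_finite.intro)
  have [measurable]: "f \<in> borel_measurable M1" "g \<in> borel_measurable M2" using f g by auto
  show int: "integrable (M1 \<Otimes>\<^sub>M M2) (\<lambda>p. f (fst p) * g (snd p))"
    by (rule Fubini_integrable) (use f g in \<open>auto simp: norm_mult\<close>)
  have "(LINT p|(M1 \<Otimes>\<^sub>M M2). f (fst p) * g (snd p)) = (LINT x|M1. LINT y|M2. f x * g y)"
    using integral_fst'[OF int] by simp
  then show "(LINT p|(M1 \<Otimes>\<^sub>M M2). f (fst p) * g (snd p)) = (LINT x|M1. f x) * (LINT y|M2. g y)"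
    by simp
qed

lemma integral_swap_bounded:
  fixes F :: "'a \<Rightarrow> 'c::{real_normed_field, banach, second_countable_topology}"
  assumes "sigma_finite_measure M1" "sigma_finite_measure M2"
    and F: "integrable M1 F" and w: "integrable M2 w"
    and [measurable]: "case_prod c \<in> borel_measurable (M1 \<Otimes>\<^sub>M M2)"
    and c: "\<And>x y. norm (c x y) \<le> 1"
  shows "(LINT y|M2. w y * (LINT x|M1. F x * c x y)) = (LINT x|M1. F x * (LINT y|M2. w y * c x y))"
proof -
  interpret pair_sigma_finite M1 M2
    using assms(1,2) by (rule pair_sigma_finite.intro)
  have [measurable]: "F \<in> borel_measurable M1" "w \<in> borel_measurable M2" using F w by auto
  have int: "integrable (M1 \<Otimes>\<^sub>M M2) (\<lambda>(x, y). F x * w y * c x y)"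
    using integrable_pair_mult(1)[OF assms(1-4)]
  proof (rule Bochner_Integration.integrable_bound)
    have "norm (F x * w y * c x y) \<le> norm (F x * w y)" for x y
      using mult_left_mono[OF c[of x y], of "norm (F x * w y)"] by (simp add: norm_mult)
    then show "AE p in M1 \<Otimes>\<^sub>M M2. norm (case p of (x, y) \<Rightarrow> F x * w y * c x y) \<le> norm (F (fst p) * w (snd p))"
      by (auto simp: case_prod_beta)
  qed measurable
  have "(LINT y|M2. w y * (LINT x|M1. F x * c x y)) = (LINT y|M2. LINT x|M1. F x * w y * c x y)"
    unfolding integral_mult_right_zero[symmetric] by (simp only: mult_ac)
  also have "\<dots> = (LINT x|M1. LINT y|M2. F x * w y * c x y)"
    using Fubini_integral[OF int] .
  also have "\<dots> = (LINT x|M1. F x * (LINT y|M2. w y * c x y))"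
    unfolding integral_mult_right_zero[symmetric] by (simp only: mult_ac)
  finally show ?thesis .
qed

section \<open>Square integrability of the Fourier transform\<close>

lemma fourier_alt: "fourier f \<zeta> = (LINT x|lborel. of_real (f x) * cis (- (x \<bullet> \<zeta>)))"
  by (simp add: fourier_def mult.commute)

lemma borel_measurable_cis [measurable (raw)]:
  assumes [measurable]: "f \<in> borel_measurable M"
  shows "(\<lambda>x. cis (f x)) \<in> borel_measurable M"
  unfolding cis_conv_exp by measurable

lemma borel_measurable_fourier:
  assumes [measurable]: "f \<in> borel_measurable borel"
  shows "fourier f \<in> borel_measurable borel"
  unfolding fourier_def[abs_def] by measurable

lemma norm_fourier_le:
  assumes "integrable lborel f"
  shows "norm (fourier f \<zeta>) \<le> (LINT x|lborel. \<bar>f x\<bar>)"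
proof -
  have "norm (fourier f \<zeta>) \<le> (LINT x|lborel. norm (cis (- (x \<bullet> \<zeta>)) * of_real (f x)))"
    unfolding fourier_def by (rule integral_norm_bound)
  then show ?thesis by (simp add: norm_mult)
qed

text \<open>The squared modulus as a real double integral, into which a frequency weight can be
  inserted and integrated first.\<close>

lemma norm_fourier_square:
  fixes f :: "real^2 \<Rightarrow> real"
  assumes f: "integrable lborel f"
  shows "(norm (fourier f \<zeta>))\<^sup>2
    = (LINT p|(lborel \<Otimes>\<^sub>M lborel). f (fst p) * f (snd p) * cos ((fst p - snd p) \<bullet> \<zeta>))"
proof -
  have [measurable]: "f \<in> borel_measurable borel" using f by auto
  have i1: "integrable lborel (\<lambda>x. of_real (f x) * cis (- (x \<bullet> \<zeta>)))"
    and i2: "integrable lborel (\<lambda>x. of_real (f x) * cis (x \<bullet> \<zeta>))"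
    by (rule Bochner_Integration.integrable_bound[OF f], simp, simp add: norm_mult)+
  have cnj: "cnj (fourier f \<zeta>) = (LINT x|lborel. of_real (f x) * cis (x \<bullet> \<zeta>))"
    unfolding fourier_alt by (subst Bochner_Integration.integral_cnj[symmetric]) (simp add: cis_cnj del: Bochner_Integration.integral_cnj)
  note sf = lborel.sigma_finite_measure_axioms
  have "complex_of_real ((norm (fourier f \<zeta>))\<^sup>2) = cnj (fourier f \<zeta>) * fourier f \<zeta>"
    by (subst complex_norm_square) (rule mult.commute)
  also have "\<dots> = (LINT p|(lborel \<Otimes>\<^sub>M lborel). (of_real (f (fst p)) * cis (fst p \<bullet> \<zeta>)) * (of_real (f (snd p)) * cis (- (snd p \<bullet> \<zeta>))))"
    unfolding cnj unfolding fourier_alt by (rule integrable_pair_mult(2)[OF sf sf i2 i1, symmetric])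
  also have "(\<lambda>p. (of_real (f (fst p)) * cis (fst p \<bullet> \<zeta>)) * (of_real (f (snd p)) * cis (- (snd p \<bullet> \<zeta>))))
      = (\<lambda>p. of_real (f (fst p) * f (snd p)) * cis ((fst p - snd p) \<bullet> \<zeta>))"
  proof
    fix p
    have c: "cis (fst p \<bullet> \<zeta>) * cis (- (snd p \<bullet> \<zeta>)) = cis ((fst p - snd p) \<bullet> \<zeta>)"
      by (simp add: cis_mult inner_diff_left)
    show "(of_real (f (fst p)) * cis (fst p \<bullet> \<zeta>)) * (of_real (f (snd p)) * cis (- (snd p \<bullet> \<zeta>)))
      = of_real (f (fst p) * f (snd p)) * cis ((fst p - snd p) \<bullet> \<zeta>)"
      unfolding c[symmetric] by simp
  qed
  finally have eq: "complex_of_real ((norm (fourier f \<zeta>))\<^sup>2)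
      = (LINT p|(lborel \<Otimes>\<^sub>M lborel). of_real (f (fst p) * f (snd p)) * cis ((fst p - snd p) \<bullet> \<zeta>))" .
  have int: "integrable (lborel \<Otimes>\<^sub>M lborel) (\<lambda>p. complex_of_real (f (fst p) * f (snd p)) * cis ((fst p - snd p) \<bullet> \<zeta>))"
    by (rule Bochner_Integration.integrable_bound[OF integrable_pair_mult(1)[OF sf sf f f]]) (simp_all add: norm_mult)
  have "(norm (fourier f \<zeta>))\<^sup>2 = Re (complex_of_real ((norm (fourier f \<zeta>))\<^sup>2))" by simp
  also have "\<dots> = (LINT p|(lborel \<Otimes>\<^sub>M lborel). Re (of_real (f (fst p) * f (snd p)) * cis ((fst p - snd p) \<bullet> \<zeta>)))"
    unfolding eq by (rule integral_Re[OF int, symmetric])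
  finally show ?thesis by simp
qed

lemma nn_integral_gauss_plane:
  assumes \<epsilon>: "0 < \<epsilon>"
  shows "(\<integral>\<^sup>+z. ennreal (2 * pi / \<epsilon> * exp (- ((norm z)\<^sup>2 / (2 * \<epsilon>)))) \<partial>(lborel :: (real^2) measure)) = ennreal ((2 * pi)\<^sup>2)"
proof -
  have e: "0 < 1 / \<epsilon>" using \<epsilon> by simp
  note g = gauss_plane_cos[OF e, of 0]
  have eq: "2 * pi / \<epsilon> * exp (- ((norm z)\<^sup>2 / (2 * \<epsilon>))) = 2 * pi / \<epsilon> * (cos (0 \<bullet> z) * exp (- (1 / \<epsilon> * (norm z)\<^sup>2 / 2)))" for z :: "real^2"
    by simp
  have "(\<integral>\<^sup>+z. ennreal (2 * pi / \<epsilon> * exp (- ((norm z)\<^sup>2 / (2 * \<epsilon>)))) \<partial>(lborel :: (real^2) measure))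
      = ennreal (LINT z|lborel. 2 * pi / \<epsilon> * (cos (0 \<bullet> z) * exp (- (1 / \<epsilon> * (norm (z::real^2))\<^sup>2 / 2))))"
    unfolding eq using \<epsilon> by (intro nn_integral_eq_integral integrable_mult_right g(1)) simp
  also have "(LINT z|lborel. 2 * pi / \<epsilon> * (cos (0 \<bullet> z) * exp (- (1 / \<epsilon> * (norm (z::real^2))\<^sup>2 / 2)))) = (2 * pi)\<^sup>2"
    unfolding integral_mult_right_zero g(2) using \<epsilon> by (simp add: power2_eq_square)
  finally show ?thesis .
qed

text \<open>Integrating the Gaussian first turns the left-hand side into a double integral of f(x)
  f(y) against a Gaussian in x - y of mass (2 pi)^2. The bound |f(x) f(y)| \<le> (f(x)^2 + f(y)^2)/2
  finishes; the upper bound is the half of Plancherel used below.\<close>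

lemma plancherel_regularised:
  fixes f :: "real^2 \<Rightarrow> real"
  assumes f: "integrable lborel f" and \<epsilon>: "0 < \<epsilon>"
  shows "(\<integral>\<^sup>+\<zeta>. ennreal ((norm (fourier f \<zeta>))\<^sup>2 * exp (- (\<epsilon> * (norm \<zeta>)\<^sup>2 / 2))) \<partial>lborel)
    \<le> ennreal ((2 * pi)\<^sup>2) * (\<integral>\<^sup>+x. ennreal ((f x)\<^sup>2) \<partial>lborel)"
proof -
  have [measurable]: "f \<in> borel_measurable borel" using f by auto
  note [measurable] = borel_measurable_fourier[of f]
  note sf = lborel.sigma_finite_measure_axioms
  define \<gamma> where "\<gamma> = (\<lambda>z::real^2. 2 * pi / \<epsilon> * exp (- ((norm z)\<^sup>2 / (2 * \<epsilon>))))"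
  have \<gamma>0: "0 \<le> \<gamma> z" for z using \<epsilon> by (simp add: \<gamma>_def)
  have [measurable]: "\<gamma> \<in> borel_measurable borel" unfolding \<gamma>_def by measurable
  let ?w = "\<lambda>\<zeta>::real^2. exp (- (\<epsilon> * (norm \<zeta>)\<^sup>2 / 2))"
  have w: "integrable lborel ?w" using gauss_plane_cos(1)[OF \<epsilon>, of 0] by simp
  let ?F = "\<lambda>p. f (fst p) * f (snd p)"
  have F: "integrable (lborel \<Otimes>\<^sub>M lborel) ?F" by (rule integrable_pair_mult(1)[OF sf sf f f])
  have sf2: "sigma_finite_measure ((lborel :: (real^2) measure) \<Otimes>\<^sub>M (lborel :: (real^2) measure))"
    unfolding lborel_prod by (rule sf)
  have int: "integrable lborel (\<lambda>\<zeta>. (norm (fourier f \<zeta>))\<^sup>2 * ?w \<zeta>)"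
  proof (rule Bochner_Integration.integrable_bound[OF integrable_mult_right[OF w, of "(LINT x|lborel. \<bar>f x\<bar>)\<^sup>2"]])
    show "AE \<zeta> in lborel. norm ((norm (fourier f \<zeta>))\<^sup>2 * ?w \<zeta>) \<le> norm ((LINT x|lborel. \<bar>f x\<bar>)\<^sup>2 * ?w \<zeta>)"
      using norm_fourier_le[OF f] by (intro AE_I2) (simp add: abs_mult mult_right_mono power_mono)
  qed simp
  have "(\<integral>\<^sup>+\<zeta>. ennreal ((norm (fourier f \<zeta>))\<^sup>2 * ?w \<zeta>) \<partial>lborel) = ennreal (LINT \<zeta>|lborel. (norm (fourier f \<zeta>))\<^sup>2 * ?w \<zeta>)"
    by (intro nn_integral_eq_integral int) simp
  also have "(LINT \<zeta>|lborel. (norm (fourier f \<zeta>))\<^sup>2 * ?w \<zeta>)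
      = (LINT \<zeta>|lborel. ?w \<zeta> * (LINT p|(lborel \<Otimes>\<^sub>M lborel). ?F p * cos ((fst p - snd p) \<bullet> \<zeta>)))"
    unfolding norm_fourier_square[OF f] by (simp add: mult.commute)
  also have "\<dots> = (LINT p|(lborel \<Otimes>\<^sub>M lborel). ?F p * (LINT \<zeta>|lborel. ?w \<zeta> * cos ((fst p - snd p) \<bullet> \<zeta>)))"
    by (rule integral_swap_bounded[OF sf2 sf F w]) (simp_all add: abs_cos_le_one)
  also have "\<dots> = (LINT p|(lborel \<Otimes>\<^sub>M lborel). ?F p * \<gamma> (fst p - snd p))"
    using gauss_plane_cos(2)[OF \<epsilon>] by (simp add: \<gamma>_def mult.commute[of "exp _" "cos _"])
  also have "ennreal \<dots> \<le> (\<integral>\<^sup>+p. ennreal (norm (?F p * \<gamma> (fst p - snd p))) \<partial>(lborel \<Otimes>\<^sub>M lborel))"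
  proof -
    have "\<gamma> z \<le> 2 * pi / \<epsilon>" for z
      using \<epsilon> mult_left_mono[of "exp (- ((norm z)\<^sup>2 / (2 * \<epsilon>)))" 1 "2 * pi / \<epsilon>"] by (simp add: \<gamma>_def)
    then have "norm (?F p * \<gamma> z) \<le> norm (2 * pi / \<epsilon> * ?F p)" for p z
      using \<epsilon> \<gamma>0[of z] mult_left_mono[of "\<gamma> z" "2 * pi / \<epsilon>" "\<bar>?F p\<bar>"] by (simp add: abs_mult mult_ac)
    then have "integrable (lborel \<Otimes>\<^sub>M lborel) (\<lambda>p. ?F p * \<gamma> (fst p - snd p))"
      by (intro Bochner_Integration.integrable_bound[OF integrable_mult_right[OF F, of "2 * pi / \<epsilon>"]] AE_I2) simp_all
    from integral_norm_bound_ennreal[OF this] show ?thesis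
      by (rule order_trans[rotated]) (simp add: ennreal_leI)
  qed
  also have "\<dots> \<le> (\<integral>\<^sup>+p. ennreal (1/2) * (ennreal ((f (fst p))\<^sup>2) * ennreal (\<gamma> (fst p - snd p)))
        + ennreal (1/2) * (ennreal ((f (snd p))\<^sup>2) * ennreal (\<gamma> (fst p - snd p))) \<partial>(lborel \<Otimes>\<^sub>M lborel))"
  proof (rule nn_integral_mono)
    fix p :: "(real^2) \<times> (real^2)"
    let ?a = "f (fst p)" and ?b = "f (snd p)" and ?c = "\<gamma> (fst p - snd p)"
    have "0 \<le> (\<bar>?a\<bar> - \<bar>?b\<bar>)\<^sup>2" by simp
    then have "\<bar>?a\<bar> * \<bar>?b\<bar> \<le> 1/2 * ?a\<^sup>2 + 1/2 * ?b\<^sup>2" by (simp add: power2_diff)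
    from mult_right_mono[OF this \<gamma>0[of "fst p - snd p"]] have "norm (?a * ?b * ?c) \<le> 1/2 * (?a\<^sup>2 * ?c) + 1/2 * (?b\<^sup>2 * ?c)"
      using \<gamma>0[of "fst p - snd p"] by (simp add: abs_mult algebra_simps)
    then have "ennreal (norm (?a * ?b * ?c)) \<le> ennreal (1/2 * (?a\<^sup>2 * ?c) + 1/2 * (?b\<^sup>2 * ?c))" by (rule ennreal_leI)
    also have "\<dots> = ennreal (1/2) * (ennreal (?a\<^sup>2) * ennreal ?c) + ennreal (1/2) * (ennreal (?b\<^sup>2) * ennreal ?c)"
    proof -
      have h: "0 \<le> ?c" by (rule \<gamma>0)
      have eq: "ennreal (1/2 * (A * ?c)) = ennreal (1/2) * (ennreal A * ennreal ?c)" if "0 \<le> A" for A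
        using h that by (subst ennreal_mult, simp, simp, subst ennreal_mult) simp_all
      have "ennreal (1/2 * (?a\<^sup>2 * ?c) + 1/2 * (?b\<^sup>2 * ?c)) = ennreal (1/2 * (?a\<^sup>2 * ?c)) + ennreal (1/2 * (?b\<^sup>2 * ?c))"
        using h by (intro ennreal_plus) simp_all
      then show ?thesis by (simp only: eq zero_le_power2)
    qed
    finally show "ennreal (norm (?a * ?b * ?c)) \<le> ennreal (1/2) * (ennreal (?a\<^sup>2) * ennreal ?c) + ennreal (1/2) * (ennreal (?b\<^sup>2) * ennreal ?c)" .
  qed
  also have "\<dots> = ennreal (1/2) * (\<integral>\<^sup>+p. ennreal ((f (fst p))\<^sup>2) * ennreal (\<gamma> (fst p - snd p)) \<partial>(lborel \<Otimes>\<^sub>M lborel))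
        + ennreal (1/2) * (\<integral>\<^sup>+p. ennreal ((f (snd p))\<^sup>2) * ennreal (\<gamma> (fst p - snd p)) \<partial>(lborel \<Otimes>\<^sub>M lborel))"
    by (simp add: nn_integral_add nn_integral_cmult)
  also have "(\<integral>\<^sup>+p. ennreal ((f (fst p))\<^sup>2) * ennreal (\<gamma> (fst p - snd p)) \<partial>(lborel \<Otimes>\<^sub>M lborel))
      = ennreal ((2 * pi)\<^sup>2) * (\<integral>\<^sup>+x. ennreal ((f x)\<^sup>2) \<partial>lborel)"
  proof -
    have "(\<integral>\<^sup>+p. ennreal ((f (fst p))\<^sup>2) * ennreal (\<gamma> (fst p - snd p)) \<partial>(lborel \<Otimes>\<^sub>M lborel))
        = (\<integral>\<^sup>+x. \<integral>\<^sup>+y. ennreal ((f x)\<^sup>2) * ennreal (\<gamma> (x - y)) \<partial>lborel \<partial>lborel)"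
      by (subst lborel.nn_integral_fst[symmetric]) simp_all
    also have "\<dots> = (\<integral>\<^sup>+x. ennreal ((f x)\<^sup>2) * ennreal ((2 * pi)\<^sup>2) \<partial>lborel)"
      using nn_integral_lborel_reflect[of "\<lambda>z. ennreal (\<gamma> z)"] nn_integral_gauss_plane[OF \<epsilon>]
      by (simp add: nn_integral_cmult \<gamma>_def)
    finally show ?thesis by (simp add: nn_integral_multc mult.commute)
  qed
  also have "(\<integral>\<^sup>+p. ennreal ((f (snd p))\<^sup>2) * ennreal (\<gamma> (fst p - snd p)) \<partial>(lborel \<Otimes>\<^sub>M lborel))
      = ennreal ((2 * pi)\<^sup>2) * (\<integral>\<^sup>+x. ennreal ((f x)\<^sup>2) \<partial>lborel)"
  proof -
    have \<gamma>s: "\<gamma> (x - y) = \<gamma> (y - x)" for x y by (simp add: \<gamma>_def norm_minus_commute)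
    have "(\<integral>\<^sup>+p. ennreal ((f (snd p))\<^sup>2) * ennreal (\<gamma> (fst p - snd p)) \<partial>(lborel \<Otimes>\<^sub>M lborel))
        = (\<integral>\<^sup>+y. \<integral>\<^sup>+x. ennreal ((f y)\<^sup>2) * ennreal (\<gamma> (y - x)) \<partial>lborel \<partial>lborel)"
      by (subst lborel_pair.nn_integral_snd[symmetric]) (simp_all add: \<gamma>s case_prod_beta)
    also have "\<dots> = (\<integral>\<^sup>+x. ennreal ((f x)\<^sup>2) * ennreal ((2 * pi)\<^sup>2) \<partial>lborel)"
      using nn_integral_lborel_reflect[of "\<lambda>z. ennreal (\<gamma> z)"] nn_integral_gauss_plane[OF \<epsilon>]
      by (simp add: nn_integral_cmult \<gamma>_def)
    finally show ?thesis by (simp add: nn_integral_multc mult.commute)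
  qed
  also have "ennreal (1/2) * (ennreal ((2 * pi)\<^sup>2) * (\<integral>\<^sup>+x. ennreal ((f x)\<^sup>2) \<partial>lborel)) + ennreal (1/2) * (ennreal ((2 * pi)\<^sup>2) * (\<integral>\<^sup>+x. ennreal ((f x)\<^sup>2) \<partial>lborel))
      = ennreal ((2 * pi)\<^sup>2) * (\<integral>\<^sup>+x. ennreal ((f x)\<^sup>2) \<partial>lborel)"
    unfolding distrib_right[symmetric] by (subst ennreal_plus[symmetric]) simp_all
  finally show ?thesis .
qed

text \<open>Fatou's lemma removes the Gaussian, the bound being uniform in \<epsilon>.\<close>

lemma integrable_fourier_square:
  fixes f :: "real^2 \<Rightarrow> real"
  assumes f: "integrable lborel f" "integrable lborel (\<lambda>x. (f x)\<^sup>2)"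
  shows "integrable lborel (\<lambda>\<zeta>. (norm (fourier f \<zeta>))\<^sup>2)"
proof -
  have [measurable]: "f \<in> borel_measurable borel" using f by auto
  note [measurable] = borel_measurable_fourier[of f]
  let ?w = "\<lambda>n \<zeta>::real^2. exp (- (1 / real (Suc n) * (norm \<zeta>)\<^sup>2 / 2))"
  have lim: "(\<lambda>n. ennreal ((norm (fourier f \<zeta>))\<^sup>2 * ?w n \<zeta>)) \<longlonglongrightarrow> ennreal ((norm (fourier f \<zeta>))\<^sup>2)" for \<zeta>
  proof -
    have "(\<lambda>n. ?w n \<zeta>) \<longlonglongrightarrow> exp (- (0 * (norm \<zeta>)\<^sup>2 / 2))"
      by (intro tendsto_intros LIMSEQ_Suc[OF lim_1_over_n]) simp
    then have "(\<lambda>n. (norm (fourier f \<zeta>))\<^sup>2 * ?w n \<zeta>) \<longlonglongrightarrow> (norm (fourier f \<zeta>))\<^sup>2 * exp (- (0 * (norm \<zeta>)\<^sup>2 / 2))"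
      by (intro tendsto_mult tendsto_const)
    then show ?thesis by (intro tendsto_ennrealI) simp
  qed
  have "(\<integral>\<^sup>+\<zeta>. ennreal ((norm (fourier f \<zeta>))\<^sup>2) \<partial>lborel)
      = (\<integral>\<^sup>+\<zeta>. liminf (\<lambda>n. ennreal ((norm (fourier f \<zeta>))\<^sup>2 * ?w n \<zeta>)) \<partial>lborel)"
    using lim_imp_Liminf[OF _ lim] by simp
  also have "\<dots> \<le> liminf (\<lambda>n. \<integral>\<^sup>+\<zeta>. ennreal ((norm (fourier f \<zeta>))\<^sup>2 * ?w n \<zeta>) \<partial>lborel)"
    by (rule nn_integral_liminf) measurable
  also have "\<dots> \<le> liminf (\<lambda>n. ennreal ((2 * pi)\<^sup>2) * (\<integral>\<^sup>+x. ennreal ((f x)\<^sup>2) \<partial>lborel))"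
    by (intro Liminf_mono always_eventually allI plancherel_regularised f) simp
  also have "\<dots> = ennreal ((2 * pi)\<^sup>2) * (\<integral>\<^sup>+x. ennreal ((f x)\<^sup>2) \<partial>lborel)"
    by (simp add: Liminf_const)
  also have "\<dots> < \<infinity>"
    using f(2) by (auto simp: integrable_iff_bounded ennreal_mult_less_top)
  finally show ?thesis by (intro integrableI_bounded) auto
qed

text \<open>A product majorant avoids polar coordinates: (1 + |\<zeta>|^2)^2 is at least (1 +
  \<zeta>_1^2)(1 + \<zeta>_2^2).\<close>

lemma S_hat_1_square_integrable:
  assumes t: "0 \<le> t"
  shows "integrable lborel (\<lambda>\<zeta>::real^2. (S_hat (Suc 0) t (norm \<zeta>))\<^sup>2)"
proof -
  obtain C where C: "C > 0" "\<And>k. \<bar>S_hat (Suc 0) t k\<bar> \<le> C / (1 + k\<^sup>2)" using S_hat_1_bound[OF t] by blast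
  have i: "integrable lborel (\<lambda>x::real. inverse (1 + x\<^sup>2))"
    using integrable_inverse_1_plus_square[unfolded einterval_def]
    by (simp add: set_integrable_def)
  have "integrable lborel (\<lambda>\<zeta>::real^2. C\<^sup>2 * (inverse (1 + (\<zeta>$1)\<^sup>2) * inverse (1 + (\<zeta>$2)\<^sup>2)))"
    by (intro integrable_mult_right integrable_plane_prod i)
  then show ?thesis
  proof (rule Bochner_Integration.integrable_bound)
    have "(S_hat (Suc 0) t (norm \<zeta>))\<^sup>2 \<le> C\<^sup>2 * (inverse (1 + (\<zeta>$1)\<^sup>2) * inverse (1 + (\<zeta>$2)\<^sup>2))" for \<zeta> :: "real^2"
    proof -
      have n: "(norm \<zeta>)\<^sup>2 = (\<zeta>$1)\<^sup>2 + (\<zeta>$2)\<^sup>2"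
        by (simp add: norm_eq_sqrt_inner inner_vec_def sum_2 power2_eq_square)
      have "(S_hat (Suc 0) t (norm \<zeta>))\<^sup>2 \<le> (C / (1 + (norm \<zeta>)\<^sup>2))\<^sup>2"
        using power_mono[OF C(2)[of "norm \<zeta>"], of 2] by simp
      also have "\<dots> = C\<^sup>2 / (1 + (norm \<zeta>)\<^sup>2)\<^sup>2" by (simp add: power_divide)
      also have "\<dots> \<le> C\<^sup>2 / ((1 + (\<zeta>$1)\<^sup>2) * (1 + (\<zeta>$2)\<^sup>2))"
      proof (rule divide_left_mono)
        have "(1 + (\<zeta>$1)\<^sup>2) * (1 + (\<zeta>$2)\<^sup>2) \<le> (1 + (norm \<zeta>)\<^sup>2) * (1 + (norm \<zeta>)\<^sup>2)"
          by (intro mult_mono) (auto simp: n)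
        then show "(1 + (\<zeta>$1)\<^sup>2) * (1 + (\<zeta>$2)\<^sup>2) \<le> (1 + (norm \<zeta>)\<^sup>2)\<^sup>2" by (simp add: power2_eq_square)
      qed (auto intro!: mult_pos_pos add_pos_nonneg zero_less_power)
      finally show ?thesis by (simp add: divide_inverse)
    qed
    then show "AE \<zeta>::real^2 in lborel. norm ((S_hat (Suc 0) t (norm \<zeta>))\<^sup>2) \<le> norm (C\<^sup>2 * (inverse (1 + (\<zeta>$1)\<^sup>2) * inverse (1 + (\<zeta>$2)\<^sup>2)))"
      by (auto intro!: AE_I2 intro: order_trans[OF _ abs_ge_self])
  qed measurable
qed

lemma integrable_S_hat_fourier:
  fixes f :: "real^2 \<Rightarrow> real"
  assumes f: "integrable lborel f" "integrable lborel (\<lambda>x. (f x)\<^sup>2)" and t: "0 \<le> t"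
  shows "integrable lborel (\<lambda>\<zeta>. of_real (S_hat (Suc 0) t (norm \<zeta>)) * fourier f \<zeta>)"
proof -
  have [measurable]: "f \<in> borel_measurable borel" using f by auto
  note [measurable] = borel_measurable_fourier[of f]
  have "integrable lborel (\<lambda>\<zeta>. (S_hat (Suc 0) t (norm \<zeta>))\<^sup>2 + (norm (fourier f \<zeta>))\<^sup>2)"
    by (intro Bochner_Integration.integrable_add S_hat_1_square_integrable integrable_fourier_square f t)
  then show ?thesis
  proof (rule Bochner_Integration.integrable_bound)
    have "\<bar>a\<bar> * b \<le> \<bar>a\<^sup>2 + b\<^sup>2\<bar>" for a b :: real
    proof -
      have "0 \<le> (\<bar>a\<bar> - b)\<^sup>2" by simp
      then have "2 * (\<bar>a\<bar> * b) \<le> a\<^sup>2 + b\<^sup>2" by (simp add: power2_diff)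
      moreover have "0 \<le> a\<^sup>2 + b\<^sup>2" by simp
      ultimately show ?thesis by linarith
    qed
    then show "AE \<zeta> in lborel. norm (of_real (S_hat (Suc 0) t (norm \<zeta>)) * fourier f \<zeta>)
        \<le> norm ((S_hat (Suc 0) t (norm \<zeta>))\<^sup>2 + (norm (fourier f \<zeta>))\<^sup>2)"
      by (intro AE_I2) (simp add: norm_mult)
  qed measurable
qed

text \<open>Within distance 1 of x, f is bounded and the area element \<rho> d\<rho> outweighs
  \<rho>^(-1/2); farther away the singular factor is at most 1 and f is integrable.\<close>

lemma integrable_mult_inverse_sqrt_norm:
  fixes f :: "real^2 \<Rightarrow> real"
  assumes f: "integrable lborel f" and B: "\<And>y. \<bar>f y\<bar> \<le> B"
  shows "integrable lborel (\<lambda>y. f y * (1 / sqrt (norm (x - y))))"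
proof -
  have [measurable]: "f \<in> borel_measurable borel" using f by auto
  define g where "g = (\<lambda>z::real^2. indicat_real {z. norm z \<le> 1} z * (1 / sqrt (norm z)))"
  have [measurable]: "g \<in> borel_measurable borel" unfolding g_def by measurable
  have g0: "0 \<le> g z" for z by (simp add: g_def)
  have "(\<integral>\<^sup>+z. ennreal (g z) \<partial>lborel) = (\<integral>\<^sup>+\<rho>\<in>{0<..}. ennreal \<rho> * (\<integral>\<^sup>+\<theta>\<in>{0..2*pi}. ennreal (g (polar \<rho> \<theta>)) \<partial>lborel) \<partial>lborel)"
    by (rule nn_integral_polar) simp
  also have "\<dots> \<le> (\<integral>\<^sup>+\<rho>\<in>{0..1::real}. (\<integral>\<^sup>+\<theta>\<in>{0..2*pi}. 1 \<partial>lborel) \<partial>lborel)"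
  proof (rule nn_integral_mono)
    fix \<rho> :: real
    consider "\<rho> \<le> 0" | "0 < \<rho>" "\<rho> \<le> 1" | "1 < \<rho>" by linarith
    then show "ennreal \<rho> * (\<integral>\<^sup>+\<theta>\<in>{0..2*pi}. ennreal (g (polar \<rho> \<theta>)) \<partial>lborel) * indicator {0<..} \<rho>
      \<le> (\<integral>\<^sup>+\<theta>\<in>{0..2*pi}. 1 \<partial>lborel) * indicator {0..1} \<rho>"
    proof cases
      case 2
      have "ennreal \<rho> * (\<integral>\<^sup>+\<theta>\<in>{0..2*pi}. ennreal (g (polar \<rho> \<theta>)) \<partial>lborel)
          = (\<integral>\<^sup>+\<theta>\<in>{0..2*pi}. ennreal (\<rho> * (1 / sqrt \<rho>)) \<partial>lborel)"
        using 2 by (subst nn_integral_cmult[symmetric]) (auto simp: g_def ennreal_mult'[symmetric] mult.assoc[symmetric] intro!: nn_integral_cong)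
      also have "\<dots> \<le> (\<integral>\<^sup>+\<theta>\<in>{0..2*pi}. 1 \<partial>lborel)"
        using 2 by (intro nn_integral_mono mult_right_mono) (simp_all add: real_div_sqrt)
      finally show ?thesis using 2 by simp
    qed (simp_all add: g_def)
  qed
  also have "\<dots> = (\<integral>\<^sup>+\<rho>\<in>{0..1::real}. ennreal (2 * pi) \<partial>lborel)" by simp
  also have "\<dots> = ennreal (2 * pi) * emeasure lborel {0..1::real}"
    by (rule nn_integral_cmult_indicator) simp
  also have "\<dots> < \<infinity>"
    by (simp add: ennreal_mult_less_top)
  finally have fin: "(\<integral>\<^sup>+z. ennreal (g z) \<partial>lborel) < \<infinity>" .
  have "integrable lborel (\<lambda>y. g (x - y))"
    using fin g0 nn_integral_lborel_reflect[of "\<lambda>z. ennreal (g z)" x]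
    by (intro integrableI_bounded) auto
  then have "integrable lborel (\<lambda>y. B * g (x - y) + \<bar>f y\<bar>)"
    using f by (intro Bochner_Integration.integrable_add integrable_mult_right integrable_abs)
  then show ?thesis
  proof (rule Bochner_Integration.integrable_bound)
    have B0: "0 \<le> B" using B[of 0] by linarith
    have "\<bar>f y\<bar> * (1 / sqrt (norm (x - y))) \<le> B * g (x - y) + \<bar>f y\<bar>" for y
    proof (cases "norm (x - y) \<le> 1")
      case True
      then have "g (x - y) = 1 / sqrt (norm (x - y))" by (simp add: g_def)
      moreover have "\<bar>f y\<bar> * (1 / sqrt (norm (x - y))) \<le> B * (1 / sqrt (norm (x - y)))"
        using B by (intro mult_right_mono) auto
      ultimately show ?thesis by simp
    next
      case False
      then have "1 \<le> sqrt (norm (x - y))" by (simp add: real_sqrt_ge_1_iff)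
      then have "1 / sqrt (norm (x - y)) \<le> 1" by (simp add: divide_le_eq_1)
      then have "\<bar>f y\<bar> * (1 / sqrt (norm (x - y))) \<le> \<bar>f y\<bar> * 1" by (intro mult_left_mono) auto
      moreover have "0 \<le> B * g (x - y)" using B0 g0 by simp
      ultimately show ?thesis by simp
    qed
    then show "AE y in lborel. norm (f y * (1 / sqrt (norm (x - y)))) \<le> norm (B * g (x - y) + \<bar>f y\<bar>)"
      by (intro AE_I2) (auto simp: abs_mult intro: order_trans[OF _ abs_ge_self])
  qed simp
qed

lemma integrable_mult_kernel_G_reg:
  fixes f :: "real^2 \<Rightarrow> real"
  assumes f: "integrable lborel f" and B: "\<And>y. \<bar>f y\<bar> \<le> B" and t: "0 \<le> t" and \<epsilon>: "0 \<le> \<epsilon>"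
  shows "integrable lborel (\<lambda>y. f y * kernel_G_reg \<epsilon> t (norm (x - y)))"
proof -
  have [measurable]: "f \<in> borel_measurable borel" using f by auto
  obtain C where C: "C > 0" "\<And>\<epsilon> r. 0 \<le> \<epsilon> \<Longrightarrow> 0 < r \<Longrightarrow> \<bar>kernel_G_reg \<epsilon> t r\<bar> \<le> C / sqrt r"
    using kernel_G_reg_bound[OF t] by blast
  from integrable_mult_inverse_sqrt_norm[OF f B, of x]
  have "integrable lborel (\<lambda>y. C * (f y * (1 / sqrt (norm (x - y)))))" by (rule integrable_mult_right)
  then show ?thesis
  proof (rule Bochner_Integration.integrable_bound)
    show "AE y in lborel. norm (f y * kernel_G_reg \<epsilon> t (norm (x - y))) \<le> norm (C * (f y * (1 / sqrt (norm (x - y)))))"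
      using AE_lborel_singleton[of x]
    proof eventually_elim
      case (elim y)
      then have "\<bar>kernel_G_reg \<epsilon> t (norm (x - y))\<bar> \<le> C / sqrt (norm (x - y))" by (intro C \<epsilon>) simp
      then have "\<bar>f y\<bar> * \<bar>kernel_G_reg \<epsilon> t (norm (x - y))\<bar> \<le> \<bar>f y\<bar> * (C / sqrt (norm (x - y)))" by (rule mult_left_mono) simp
      then show ?case using C(1) by (simp add: abs_mult mult_ac)
    qed
  qed measurable
qed

text \<open>With a Gaussian factor in frequency the inversion integral and the Fourier integral may
  be exchanged, which gives the convolution with \<open>kernel_G_reg\<close>. Both sides then
  converge as the factor tends to 1: the frequency side because symbol times transform is
  integrable, the space side by the bound C / sqrt |x - y|.\<close>

theorem S_op_1_eq_convolution:
  fixes f :: "real^2 \<Rightarrow> real"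
  assumes f: "integrable lborel f" and B: "\<And>y. \<bar>f y\<bar> \<le> B" and t: "0 \<le> t"
  shows "S_op (Suc 0) t f x = (LINT y|lborel. f y * kernel_G t (norm (x - y)))"
proof -
  have [measurable]: "f \<in> borel_measurable borel" using f by auto
  note [measurable] = borel_measurable_fourier[of f]
  note sf = lborel.sigma_finite_measure_axioms
  have B0: "0 \<le> B" using B[of 0] by linarith
  have f2: "integrable lborel (\<lambda>x. (f x)\<^sup>2)"
  proof (rule Bochner_Integration.integrable_bound[OF integrable_mult_right[OF f, of B]])
    have "(f y)\<^sup>2 \<le> \<bar>B * f y\<bar>" for y
      using mult_right_mono[OF B[of y], of "\<bar>f y\<bar>"] B0 by (simp add: abs_mult power2_eq_square flip: abs_mult)
    then show "AE y in lborel. norm ((f y)\<^sup>2) \<le> norm (B * f y)" by simp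
  qed simp
  define h where "h = (\<lambda>\<zeta>. of_real (S_hat (Suc 0) t (norm \<zeta>)) * fourier f \<zeta>)"
  have h: "integrable lborel h" unfolding h_def by (rule integrable_S_hat_fourier[OF f f2 t])
  then have [measurable]: "h \<in> borel_measurable borel" by auto
  define w where "w = (\<lambda>n (\<zeta>::real^2). exp (- (1 / real (Suc n) * (norm \<zeta>)\<^sup>2 / 2)))"
  have [measurable]: "w n \<in> borel_measurable borel" for n unfolding w_def by measurable
  have w01: "0 \<le> w n \<zeta>" "w n \<zeta> \<le> 1" for n \<zeta> by (simp_all add: w_def)
  have lim_w: "(\<lambda>n. w n \<zeta>) \<longlonglongrightarrow> 1" for \<zeta>
  proof -
    have "(\<lambda>n. w n \<zeta>) \<longlonglongrightarrow> exp (- (0 * (norm \<zeta>)\<^sup>2 / 2))"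
      unfolding w_def by (intro tendsto_intros LIMSEQ_Suc[OF lim_1_over_n]) simp
    then show ?thesis by simp
  qed
  have "(\<lambda>n. LINT \<zeta>|lborel. cis (x \<bullet> \<zeta>) * h \<zeta> * of_real (w n \<zeta>)) \<longlonglongrightarrow> (LINT \<zeta>|lborel. cis (x \<bullet> \<zeta>) * h \<zeta>)"
  proof (rule integral_dominated_convergence[where w = "\<lambda>\<zeta>. norm (h \<zeta>)"])
    have "(\<lambda>n. cis (x \<bullet> \<zeta>) * h \<zeta> * of_real (w n \<zeta>)) \<longlonglongrightarrow> cis (x \<bullet> \<zeta>) * h \<zeta> * of_real 1" for \<zeta>
      by (intro tendsto_mult tendsto_const tendsto_of_real lim_w)
    then show "AE \<zeta> in lborel. (\<lambda>n. cis (x \<bullet> \<zeta>) * h \<zeta> * of_real (w n \<zeta>)) \<longlonglongrightarrow> cis (x \<bullet> \<zeta>) * h \<zeta>"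
      by simp
    show "AE \<zeta> in lborel. norm (cis (x \<bullet> \<zeta>) * h \<zeta> * of_real (w n \<zeta>)) \<le> norm (h \<zeta>)" for n
      using w01 by (intro AE_I2) (simp add: norm_mult mult_left_le)
  qed (use h in auto)
  then have "(\<lambda>n. Re (1 / (2 * of_real pi)\<^sup>2 * (LINT \<zeta>|lborel. cis (x \<bullet> \<zeta>) * h \<zeta> * of_real (w n \<zeta>))))
      \<longlonglongrightarrow> Re (1 / (2 * of_real pi)\<^sup>2 * (LINT \<zeta>|lborel. cis (x \<bullet> \<zeta>) * h \<zeta>))"
    by (intro tendsto_Re tendsto_mult tendsto_const)
  moreover have "Re (1 / (2 * of_real pi)\<^sup>2 * (LINT \<zeta>|lborel. cis (x \<bullet> \<zeta>) * h \<zeta>)) = S_op (Suc 0) t f x"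
    by (simp add: S_op_def h_def mult.assoc)
  moreover have "Re (1 / (2 * of_real pi)\<^sup>2 * (LINT \<zeta>|lborel. cis (x \<bullet> \<zeta>) * h \<zeta> * of_real (w n \<zeta>)))
      = (LINT y|lborel. f y * kernel_G_reg (1 / real (Suc n)) t (norm (x - y)))" for n
  proof -
    define \<epsilon> where "\<epsilon> = 1 / real (Suc n)"
    have \<epsilon>: "0 < \<epsilon>" by (simp add: \<epsilon>_def)
    define S where "S = (\<lambda>\<zeta>::real^2. complex_of_real (S_hat (Suc 0) t (norm \<zeta>) * w n \<zeta>))"
    have S: "integrable lborel S"
    proof -
      have "integrable lborel (\<lambda>\<zeta>. gauss_weight \<epsilon> 0 \<zeta> * S_hat (Suc 0) t (norm \<zeta>))"
        by (rule gauss_weight_S_hat_integrable[OF \<epsilon> t])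
      then have "integrable lborel (\<lambda>\<zeta>. complex_of_real (gauss_weight \<epsilon> 0 \<zeta> * S_hat (Suc 0) t (norm \<zeta>)))"
        by (rule integrable_of_real)
      then show ?thesis by (simp add: S_def gauss_weight_def w_def \<epsilon>_def mult.commute)
    qed
    have [measurable]: "S \<in> borel_measurable borel" using S by auto
    have Sc: "integrable lborel (\<lambda>\<zeta>. S \<zeta> * cis (z \<bullet> \<zeta>))" for z
      by (rule Bochner_Integration.integrable_bound[OF S]) (simp_all add: norm_mult)
    have fc: "integrable lborel (\<lambda>y. complex_of_real (f y))" using f by (rule integrable_of_real)
    have K: "Re (LINT \<zeta>|lborel. S \<zeta> * cis (z \<bullet> \<zeta>)) = (2 * pi)\<^sup>2 * kernel_G_reg \<epsilon> t (norm z)" for z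
    proof -
      have "Re (LINT \<zeta>|lborel. S \<zeta> * cis (z \<bullet> \<zeta>)) = (LINT \<zeta>|lborel. Re (S \<zeta> * cis (z \<bullet> \<zeta>)))"
        by (rule integral_Re[OF Sc, symmetric])
      also have "\<dots> = (LINT \<zeta>|lborel. gauss_weight \<epsilon> z \<zeta> * S_hat (Suc 0) t (norm \<zeta>))"
        by (simp add: S_def gauss_weight_def w_def \<epsilon>_def mult_ac)
      finally show ?thesis by (simp only: gauss_weight_S_hat_eq_kernel_G_reg[OF \<epsilon> t])
    qed
    have "(LINT \<zeta>|lborel. cis (x \<bullet> \<zeta>) * h \<zeta> * of_real (w n \<zeta>))
        = (LINT \<zeta>|lborel. (S \<zeta> * cis (x \<bullet> \<zeta>)) * (LINT y|lborel. of_real (f y) * cis (- (y \<bullet> \<zeta>))))"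
      unfolding h_def fourier_alt S_def by (simp add: mult_ac)
    also have "\<dots> = (LINT y|lborel. of_real (f y) * (LINT \<zeta>|lborel. (S \<zeta> * cis (x \<bullet> \<zeta>)) * cis (- (y \<bullet> \<zeta>))))"
      by (rule integral_swap_bounded[OF sf sf fc Sc]) simp_all
    also have "\<dots> = (LINT y|lborel. of_real (f y) * (LINT \<zeta>|lborel. S \<zeta> * cis ((x - y) \<bullet> \<zeta>)))"
      by (simp add: mult.assoc cis_mult inner_diff_left)
    finally have eq: "(LINT \<zeta>|lborel. cis (x \<bullet> \<zeta>) * h \<zeta> * of_real (w n \<zeta>))
        = (LINT y|lborel. of_real (f y) * (LINT \<zeta>|lborel. S \<zeta> * cis ((x - y) \<bullet> \<zeta>)))" .
    have int: "integrable lborel (\<lambda>y. of_real (f y) * (LINT \<zeta>|lborel. S \<zeta> * cis ((x - y) \<bullet> \<zeta>)))"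
    proof (rule Bochner_Integration.integrable_bound[OF integrable_mult_right[OF fc, of "of_real (LINT \<zeta>|lborel. norm (S \<zeta>))"]])
      have "norm (LINT \<zeta>|lborel. S \<zeta> * cis (z \<bullet> \<zeta>)) \<le> (LINT \<zeta>|lborel. norm (S \<zeta>))" for z
        by (rule order_trans[OF integral_norm_bound]) (simp add: norm_mult)
      then have "norm (of_real (f y) * (LINT \<zeta>|lborel. S \<zeta> * cis ((x - y) \<bullet> \<zeta>))) \<le> norm (of_real (LINT \<zeta>|lborel. norm (S \<zeta>)) * complex_of_real (f y))" for y
        by (simp add: norm_mult mult.commute[of _ "\<bar>f y\<bar>"] mult_left_mono)
      then show "AE y in lborel. norm (of_real (f y) * (LINT \<zeta>|lborel. S \<zeta> * cis ((x - y) \<bullet> \<zeta>))) \<le> norm (of_real (LINT \<zeta>|lborel. norm (S \<zeta>)) * complex_of_real (f y))"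
        by (rule AE_I2)
    qed measurable
    have "Re (1 / (2 * of_real pi)\<^sup>2 * (LINT \<zeta>|lborel. cis (x \<bullet> \<zeta>) * h \<zeta> * of_real (w n \<zeta>)))
        = 1 / (2 * pi)\<^sup>2 * Re (LINT y|lborel. of_real (f y) * (LINT \<zeta>|lborel. S \<zeta> * cis ((x - y) \<bullet> \<zeta>)))"
    proof -
      have "1 / (2 * complex_of_real pi)\<^sup>2 = of_real (1 / (2 * pi)\<^sup>2)" by simp
      then show ?thesis unfolding eq by (simp only: Re_complex_of_real times_complex.simps Im_complex_of_real mult_zero_left diff_zero)
    qed
    also have "Re (LINT y|lborel. of_real (f y) * (LINT \<zeta>|lborel. S \<zeta> * cis ((x - y) \<bullet> \<zeta>)))
        = (LINT y|lborel. f y * ((2 * pi)\<^sup>2 * kernel_G_reg \<epsilon> t (norm (x - y))))"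
      unfolding integral_Re[OF int, symmetric] by (simp add: K)
    also have "\<dots> = (2 * pi)\<^sup>2 * (LINT y|lborel. f y * kernel_G_reg \<epsilon> t (norm (x - y)))"
      unfolding integral_mult_right_zero[symmetric] by (simp only: mult_ac)
    finally show ?thesis by (simp add: \<epsilon>_def)
  qed
  ultimately have lim1: "(\<lambda>n. LINT y|lborel. f y * kernel_G_reg (1 / real (Suc n)) t (norm (x - y))) \<longlonglongrightarrow> S_op (Suc 0) t f x"
    by simp
  obtain C where C: "C > 0" "\<And>\<epsilon> r. 0 \<le> \<epsilon> \<Longrightarrow> 0 < r \<Longrightarrow> \<bar>kernel_G_reg \<epsilon> t r\<bar> \<le> C / sqrt r"
    using kernel_G_reg_bound[OF t] by blast
  have "(\<lambda>n. LINT y|lborel. f y * kernel_G_reg (1 / real (Suc n)) t (norm (x - y))) \<longlonglongrightarrow> (LINT y|lborel. f y * kernel_G t (norm (x - y)))"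
  proof (rule integral_dominated_convergence)
    show "integrable lborel (\<lambda>y. C * (\<bar>f y\<bar> * (1 / sqrt (norm (x - y)))))"
      using f B by (intro integrable_mult_right integrable_mult_inverse_sqrt_norm[where B = B]) auto
    show "AE y in lborel. (\<lambda>n. f y * kernel_G_reg (1 / real (Suc n)) t (norm (x - y))) \<longlonglongrightarrow> f y * kernel_G t (norm (x - y))"
      using AE_lborel_singleton[of x]
    proof eventually_elim
      case (elim y)
      then show ?case by (intro tendsto_mult tendsto_const kernel_G_reg_tendsto t) simp
    qed
    show "AE y in lborel. norm (f y * kernel_G_reg (1 / real (Suc n)) t (norm (x - y))) \<le> C * (\<bar>f y\<bar> * (1 / sqrt (norm (x - y))))" for n
      using AE_lborel_singleton[of x]
    proof eventually_elim
      case (elim y)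
      then have "\<bar>kernel_G_reg (1 / real (Suc n)) t (norm (x - y))\<bar> \<le> C / sqrt (norm (x - y))" by (intro C) simp_all
      then have "\<bar>f y\<bar> * \<bar>kernel_G_reg (1 / real (Suc n)) t (norm (x - y))\<bar> \<le> \<bar>f y\<bar> * (C / sqrt (norm (x - y)))" by (rule mult_left_mono) simp
      then show ?case by (simp add: abs_mult mult_ac)
    qed
  qed measurable
  with lim1 show ?thesis by (rule LIMSEQ_unique)
qed

text \<open>No integrability is assumed: modulation by a unit factor does not change integrability,
  so for non-integrable h the integral is 0 at every x. Hence \<open>S_op\<close> is continuous for
  all data.\<close>

lemma continuous_on_cis_integral:
  fixes h :: "real^2 \<Rightarrow> complex"
  shows "continuous_on UNIV (\<lambda>x. LINT \<zeta>|lborel. cis (x \<bullet> \<zeta>) * h \<zeta>)"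
proof (cases "integrable lborel h")
  case True
  then have [measurable]: "h \<in> borel_measurable borel" by auto
  have "isCont (\<lambda>x. LINT \<zeta>|lborel. cis (x \<bullet> \<zeta>) * h \<zeta>) x" for x
  proof (rule continuous_at_sequentiallyI)
    fix X assume X: "X \<longlonglongrightarrow> x"
    show "(\<lambda>n. LINT \<zeta>|lborel. cis (X n \<bullet> \<zeta>) * h \<zeta>) \<longlonglongrightarrow> (LINT \<zeta>|lborel. cis (x \<bullet> \<zeta>) * h \<zeta>)"
    proof (rule integral_dominated_convergence[where w = "\<lambda>\<zeta>. norm (h \<zeta>)"])
      show "AE \<zeta> in lborel. (\<lambda>n. cis (X n \<bullet> \<zeta>) * h \<zeta>) \<longlonglongrightarrow> cis (x \<bullet> \<zeta>) * h \<zeta>"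
        unfolding cis_conv_exp by (intro AE_I2 tendsto_intros X)
    qed (use True in \<open>auto simp: norm_mult\<close>)
  qed
  then show ?thesis by (simp add: continuous_on_eq_continuous_at)
next
  case False
  have "\<not> integrable lborel (\<lambda>\<zeta>. cis (x \<bullet> \<zeta>) * h \<zeta>)" for x
  proof
    assume i: "integrable lborel (\<lambda>\<zeta>. cis (x \<bullet> \<zeta>) * h \<zeta>)"
    then have m: "(\<lambda>\<zeta>. cis (x \<bullet> \<zeta>) * h \<zeta>) \<in> borel_measurable lborel" by auto
    have eq: "cis (- (x \<bullet> \<zeta>)) * (cis (x \<bullet> \<zeta>) * h \<zeta>) = h \<zeta>" for \<zeta>
      by (simp add: mult.assoc[symmetric] cis_mult)
    have "integrable lborel (\<lambda>\<zeta>. cis (- (x \<bullet> \<zeta>)) * (cis (x \<bullet> \<zeta>) * h \<zeta>))"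
      using i by (rule Bochner_Integration.integrable_bound) (use m in \<open>simp_all add: norm_mult borel_measurable_times borel_measurable_cis\<close>)
    with False show False unfolding eq by simp
  qed
  then show ?thesis by (simp add: not_integrable_integral_eq)
qed

lemma continuous_on_S_op: "continuous_on UNIV (S_op j t f)"
proof -
  have "continuous_on UNIV (\<lambda>x. Re (1 / (2 * of_real pi)\<^sup>2 *
      (LINT \<zeta>|lborel. cis (x \<bullet> \<zeta>) * (of_real (S_hat j t (norm \<zeta>)) * fourier f \<zeta>))))"
    by (intro continuous_intros continuous_on_cis_integral)
  then show ?thesis by (simp add: S_op_def[abs_def] mult.assoc)
qed

lemma S_op_1_0 [simp]: "S_op (Suc 0) 0 f x = 0"
  by (simp add: S_op_def)

section \<open>Smooth bumps and weak convergence in Sobolev space\<close>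

text \<open>Derivatives are given by an existential chain instead of iterated \<open>deriv\<close>,
  so that sums, products and affine substitutions go through by plain induction on the
  order.\<close>

primrec kdiff :: "nat \<Rightarrow> (real \<Rightarrow> real) \<Rightarrow> bool" where
  "kdiff 0 f \<longleftrightarrow> True"
| "kdiff (Suc n) f \<longleftrightarrow> (\<exists>f'. (\<forall>x. (f has_real_derivative f' x) (at x)) \<and> kdiff n f')"

definition smooth1 :: "(real \<Rightarrow> real) \<Rightarrow> bool" where
  "smooth1 f \<longleftrightarrow> (\<forall>n. kdiff n f)"

lemma kdiff_Suc_imp: "kdiff (Suc n) f \<Longrightarrow> kdiff n f"
proof (induction n arbitrary: f)
  case (Suc n)
  then obtain f' where "\<forall>x. (f has_real_derivative f' x) (at x)" "kdiff (Suc n) f'"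
    unfolding kdiff.simps(2)[of "Suc n"] by blast
  with Suc.IH[of f'] show ?case by auto
qed simp

lemma kdiff_const: "kdiff n (\<lambda>_. c)"
proof (induction n arbitrary: c)
  case (Suc n)
  then show ?case by (auto intro!: exI[of _ "\<lambda>_. 0"])
qed simp

lemma kdiff_add: "kdiff n f \<Longrightarrow> kdiff n g \<Longrightarrow> kdiff n (\<lambda>x. f x + g x)"
proof (induction n arbitrary: f g)
  case (Suc n)
  then obtain f' g' where "\<forall>x. (f has_real_derivative f' x) (at x)" "kdiff n f'"
    "\<forall>x. (g has_real_derivative g' x) (at x)" "kdiff n g'" by auto
  with Suc.IH[of f' g'] show ?case by (auto intro!: exI[of _ "\<lambda>x. f' x + g' x"] DERIV_add)
qed simp

lemma kdiff_mult: "kdiff n f \<Longrightarrow> kdiff n g \<Longrightarrow> kdiff n (\<lambda>x. f x * g x)"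
proof (induction n arbitrary: f g)
  case (Suc n)
  then obtain f' g' where fg: "\<forall>x. (f has_real_derivative f' x) (at x)" "kdiff n f'"
    "\<forall>x. (g has_real_derivative g' x) (at x)" "kdiff n g'" by auto
  have "kdiff n f" "kdiff n g" using Suc.prems by (auto intro: kdiff_Suc_imp simp del: kdiff.simps)
  then have "kdiff n (\<lambda>x. f' x * g x + g' x * f x)"
    using fg by (intro kdiff_add Suc.IH) auto
  moreover have "((\<lambda>x. f x * g x) has_real_derivative f' x * g x + g' x * f x) (at x)" for x
    using fg by (intro DERIV_mult) auto
  ultimately show ?case
    unfolding kdiff.simps by (intro exI[of _ "\<lambda>x. f' x * g x + g' x * f x"]) blast
qed simp

lemma kdiff_affine: "kdiff n f \<Longrightarrow> kdiff n (\<lambda>x. f (c * x + d))"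
proof (induction n arbitrary: f)
  case (Suc n)
  then obtain f' where f': "\<forall>x. (f has_real_derivative f' x) (at x)" "kdiff n f'" by auto
  have "((\<lambda>x. f (c * x + d)) has_real_derivative f' (c * x + d) * c) (at x)" for x
    by (rule DERIV_chain2[where f = f]) (use f' in \<open>auto intro!: derivative_eq_intros\<close>)
  moreover have "kdiff n (\<lambda>x. f' (c * x + d) * c)"
    using f' by (intro kdiff_mult kdiff_const Suc.IH)
  ultimately show ?case
    unfolding kdiff.simps by (intro exI[of _ "\<lambda>x. f' (c * x + d) * c"]) blast
qed simp

lemma smooth1_const: "smooth1 (\<lambda>_. c)"
  and smooth1_add: "smooth1 f \<Longrightarrow> smooth1 g \<Longrightarrow> smooth1 (\<lambda>x. f x + g x)"
  and smooth1_mult: "smooth1 f \<Longrightarrow> smooth1 g \<Longrightarrow> smooth1 (\<lambda>x. f x * g x)"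
  and smooth1_affine: "smooth1 f \<Longrightarrow> smooth1 (\<lambda>x. f (c * x + d))"
  by (auto simp: smooth1_def intro: kdiff_const kdiff_add kdiff_mult kdiff_affine)

lemma smooth1_diff: "smooth1 f \<Longrightarrow> smooth1 g \<Longrightarrow> smooth1 (\<lambda>x. f x - g x)"
  using smooth1_add[OF _ smooth1_mult[OF smooth1_const], of f g "-1"] by simp

lemma smooth1_DERIV: "smooth1 f \<Longrightarrow> (f has_real_derivative deriv f x) (at x)"
proof -
  assume "smooth1 f"
  then have "kdiff (Suc 0) f" by (simp only: smooth1_def)
  then obtain f' where "\<forall>x. (f has_real_derivative f' x) (at x)" by auto
  then show ?thesis using DERIV_imp_deriv by metis
qed

lemma smooth1_deriv: "smooth1 f \<Longrightarrow> smooth1 (deriv f)"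
  unfolding smooth1_def[of "deriv f"]
proof
  fix n assume "smooth1 f"
  then have "kdiff (Suc n) f" by (simp only: smooth1_def)
  then obtain f' where f': "\<forall>x. (f has_real_derivative f' x) (at x)" "kdiff n f'" by auto
  then have "f' = deriv f" using DERIV_imp_deriv by (metis ext)
  with f' show "kdiff n (deriv f)" by simp
qed

lemma smooth1_if_DERIV:
  assumes "\<And>x. (f has_real_derivative f' x) (at x)" "smooth1 f'"
  shows "smooth1 f"
  unfolding smooth1_def
proof
  fix n
  show "kdiff n f" using assms by (cases n) (auto simp: smooth1_def)
qed

lemma smooth1_continuous: "smooth1 f \<Longrightarrow> continuous_on S f"
  using smooth1_DERIV DERIV_isCont by (metis continuous_at_imp_continuous_on)

text \<open>The polynomial makes the family P(1/x) exp(-1/x) closed under differentiation, which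
  sends P to X^2 (P - P'). Smoothness of the flat function is then one induction.\<close>

definition flat_exp :: "real poly \<Rightarrow> real \<Rightarrow> real" where
  "flat_exp P x = (if 0 < x then poly P (1 / x) * exp (- (1 / x)) else 0)"

lemma poly_exp_tendsto_0: "((\<lambda>x::real. x ^ k * poly P x / exp x) \<longlongrightarrow> 0) at_top"
proof (induction P arbitrary: k)
  case 0
  then show ?case by simp
next
  case (pCons a P)
  have "((\<lambda>x. a * (x ^ k / exp x) + x ^ Suc k * poly P x / exp x) \<longlongrightarrow> a * 0 + 0) at_top"
    by (intro tendsto_add tendsto_mult tendsto_const tendsto_power_div_exp_0 pCons.IH)
  moreover have "a * (x ^ k / exp x) + x ^ Suc k * poly P x / exp x = x ^ k * poly (pCons a P) x / exp x" for x
    by (simp add: field_simps)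
  ultimately show ?case by simp
qed

lemma flat_exp_tendsto_0: "(flat_exp P \<longlongrightarrow> 0) (at 0)"
proof (rule filterlim_split_at)
  have "\<forall>\<^sub>F x in at_left 0. flat_exp P x = 0"
    by (simp add: eventually_at_filter flat_exp_def)
  then show "(flat_exp P \<longlongrightarrow> 0) (at_left 0)" by (rule tendsto_eventually)
  have "((\<lambda>x. inverse x ^ 0 * poly P (inverse x) / exp (inverse x)) \<longlongrightarrow> 0) (at_right 0)"
    by (rule filterlim_compose[OF poly_exp_tendsto_0 filterlim_inverse_at_top_right])
  moreover have "\<forall>\<^sub>F x in at_right 0. inverse x ^ 0 * poly P (inverse x) / exp (inverse x) = flat_exp P x"
    by (auto simp: eventually_at_filter flat_exp_def exp_minus divide_inverse)
  ultimately show "(flat_exp P \<longlongrightarrow> 0) (at_right 0)" by (rule Lim_transform_eventually)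
qed

lemma flat_exp_DERIV:
  "(flat_exp P has_real_derivative flat_exp ([:0, 0, 1:] * (P - pderiv P)) x) (at x)"
proof -
  consider "x > 0" | "x = 0" | "x < 0" by linarith
  then show ?thesis
  proof cases
    case 1
    have "((\<lambda>x. poly P (1 / x) * exp (- (1 / x))) has_real_derivative
        poly (pderiv P) (1 / x) * (- 1 / x\<^sup>2) * exp (- (1 / x)) + exp (- (1 / x)) * (1 / x\<^sup>2) * poly P (1 / x)) (at x)"
    proof (intro DERIV_mult)
      have inv: "((\<lambda>x. 1 / x) has_real_derivative - 1 / x\<^sup>2) (at x)"
        using 1 by (auto intro!: derivative_eq_intros simp: power2_eq_square)
      show "((\<lambda>x. poly P (1 / x)) has_real_derivative poly (pderiv P) (1 / x) * (- 1 / x\<^sup>2)) (at x)"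
        by (rule DERIV_chain2[OF poly_DERIV inv])
      show "((\<lambda>x. exp (- (1 / x))) has_real_derivative exp (- (1 / x)) * (1 / x\<^sup>2)) (at x)"
        using DERIV_chain2[OF DERIV_exp DERIV_minus[OF inv]] by simp
    qed
    then have "(flat_exp P has_real_derivative
        poly (pderiv P) (1 / x) * (- 1 / x\<^sup>2) * exp (- (1 / x)) + exp (- (1 / x)) * (1 / x\<^sup>2) * poly P (1 / x)) (at x)"
      by (rule has_field_derivative_transform_within_open[of _ _ _ "{0<..}"]) (use 1 in \<open>auto simp: flat_exp_def\<close>)
    moreover have "poly (pderiv P) (1 / x) * (- 1 / x\<^sup>2) * exp (- (1 / x)) + exp (- (1 / x)) * (1 / x\<^sup>2) * poly P (1 / x)
        = flat_exp ([:0, 0, 1:] * (P - pderiv P)) x"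
      using 1 by (simp add: flat_exp_def field_simps power2_eq_square)
    ultimately show ?thesis by simp
  next
    case 2
    \<comment> \<open>The difference quotient at 0 is itself a member of the family, with polynomial
      X P.\<close>
    have "((\<lambda>h. (flat_exp P (0 + h) - flat_exp P 0) / h) \<longlongrightarrow> 0) (at 0)"
    proof (rule Lim_transform_eventually[OF flat_exp_tendsto_0[of "[:0, 1:] * P"]])
      show "\<forall>\<^sub>F h in at 0. flat_exp ([:0, 1:] * P) h = (flat_exp P (0 + h) - flat_exp P 0) / h"
        by (auto simp: eventually_at_filter flat_exp_def)
    qed
    then show ?thesis using 2 by (simp add: DERIV_def flat_exp_def)
  next
    case 3
    have "(flat_exp P has_real_derivative 0) (at x)"
      by (rule has_field_derivative_transform_within_open[of "\<lambda>_. 0" _ _ "{..<0}"]) (use 3 in \<open>auto simp: flat_exp_def\<close>)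
    then show ?thesis using 3 by (simp add: flat_exp_def)
  qed
qed

lemma smooth1_flat_exp: "smooth1 (flat_exp P)"
proof -
  have "kdiff n (flat_exp P)" for n
    by (induction n arbitrary: P) (use flat_exp_DERIV in \<open>auto intro!: exI\<close>)
  then show ?thesis by (simp add: smooth1_def)
qed

lemma smooth_step_exists:
  "\<exists>H. smooth1 H \<and> (\<forall>x. 0 \<le> H x \<and> H x \<le> 1) \<and> (\<forall>x. x \<le> -1 \<longrightarrow> H x = 0) \<and> (\<forall>x. 1 \<le> x \<longrightarrow> H x = 1)
    \<and> (\<forall>x. 0 \<le> deriv H x)"
proof -
  \<comment> \<open>A smooth function positive exactly on (-1, 1); the step is its normalised
    antiderivative.\<close>
  define \<beta> where "\<beta> = (\<lambda>x. flat_exp 1 (1 * x + 1) * flat_exp 1 ((-1) * x + 1))"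
  have \<beta>s: "smooth1 \<beta>" unfolding \<beta>_def by (intro smooth1_mult smooth1_affine smooth1_flat_exp)
  have \<beta>0: "0 \<le> \<beta> x" for x by (simp add: \<beta>_def flat_exp_def)
  have \<beta>pos: "0 < \<beta> x" if "-1 < x" "x < 1" for x using that by (simp add: \<beta>_def flat_exp_def)
  have \<beta>out: "\<beta> x = 0" if "1 \<le> \<bar>x\<bar>" for x using that by (auto simp: \<beta>_def flat_exp_def)
  have "\<exists>F. \<forall>x::real. -\<infinity> < ereal x \<longrightarrow> ereal x < \<infinity> \<longrightarrow> (F has_vector_derivative \<beta> x) (at x)"
    by (rule einterval_antiderivative) (use DERIV_isCont[OF smooth1_DERIV[OF \<beta>s]] in auto)
  then obtain F where F: "\<And>x. (F has_real_derivative \<beta> x) (at x)"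
    by (auto simp: has_real_derivative_iff_has_vector_derivative)
  have mono: "F x \<le> F y" if "x \<le> y" for x y
    by (rule DERIV_nonneg_imp_nondecreasing[OF that]) (use F \<beta>0 in blast)
  have c1: "F x = F 1" if "1 \<le> x" for x
  proof (cases "x = 1")
    case False
    then show ?thesis using DERIV_isconst_end[of 1 x F] that F \<beta>out
      by (metis DERIV_isCont abs_of_nonneg continuous_at_imp_continuous_on less_eq_real_def order_less_trans zero_less_one)
  qed simp
  have c2: "F x = F (-1)" if "x \<le> -1" for x
  proof (rule antisym)
    show "F x \<le> F (-1)" by (rule mono[OF that])
    show "F (-1) \<le> F x"
    proof (rule DERIV_nonpos_imp_nonincreasing[OF that])
      fix z assume "x \<le> z" "z \<le> -1"
      then show "\<exists>y. (F has_real_derivative y) (at z) \<and> y \<le> 0" using F[of z] \<beta>out[of z] by auto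
    qed
  qed
  define c where "c = F 1 - F (-1)"
  have "F (-1) < F (1/2)" 
    by (rule DERIV_pos_imp_increasing_open[of "-1" "1/2" F])
       (use F \<beta>pos in \<open>auto intro!: exI continuous_at_imp_continuous_on DERIV_isCont\<close>)
  then have c: "0 < c" using mono[of "1/2" 1] by (simp add: c_def)
  define H where "H = (\<lambda>x. (F x - F (-1)) / c)"
  have H: "(H has_real_derivative (\<beta> x / c)) (at x)" for x
    unfolding H_def using DERIV_cdivide[OF DERIV_diff[OF F[of x] DERIV_const], of "F (-1)" c] by simp
  have "smooth1 (\<lambda>x. 1 / c * \<beta> x)" by (intro smooth1_mult smooth1_const \<beta>s)
  then have s: "smooth1 H" using H by (intro smooth1_if_DERIV[of H "\<lambda>x. \<beta> x / c"]) auto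
  have dH: "deriv H x = \<beta> x / c" for x by (rule DERIV_imp_deriv[OF H])
  have "F (-1) \<le> F x" for x 
  proof (cases "x \<le> -1")
    case True
    from c2[OF this] show ?thesis by (rule eq_refl[OF sym])
  next
    case False
    then show ?thesis by (intro mono) simp
  qed
  then have "0 \<le> H x" for x using c by (simp add: H_def)
  moreover have "F x \<le> F 1" for x 
  proof (cases "1 \<le> x")
    case True
    from c1[OF this] show ?thesis by (rule eq_refl)
  next
    case False
    then show ?thesis by (intro mono) simp
  qed
  then have "H x \<le> 1" for x using c by (simp add: H_def c_def)
  moreover have "H x = 0" if "x \<le> -1" for x using c2[OF that] by (simp add: H_def)
  moreover have "H x = 1" if "1 \<le> x" for x using c1[OF that] c by (simp add: H_def c_def)
  moreover have "0 \<le> deriv H x" for x using \<beta>0[of x] c by (simp add: dH)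
  ultimately show ?thesis using s by blast
qed

definition smooth_step :: "real \<Rightarrow> real" where
  "smooth_step = (SOME H. smooth1 H \<and> (\<forall>x. 0 \<le> H x \<and> H x \<le> 1) \<and> (\<forall>x. x \<le> -1 \<longrightarrow> H x = 0) \<and> (\<forall>x. 1 \<le> x \<longrightarrow> H x = 1)
    \<and> (\<forall>x. 0 \<le> deriv H x))"

lemma smooth_step:
  shows smooth1_step: "smooth1 smooth_step" and step_ge_0: "0 \<le> smooth_step x" and step_le_1: "smooth_step x \<le> 1"
    and step_left: "x \<le> -1 \<Longrightarrow> smooth_step x = 0" and step_right: "1 \<le> x \<Longrightarrow> smooth_step x = 1"
    and deriv_step_ge_0: "0 \<le> deriv smooth_step x"
  using someI_ex[OF smooth_step_exists] unfolding smooth_step_def[symmetric] by blast+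

definition step_at :: "real \<Rightarrow> real \<Rightarrow> real \<Rightarrow> real" where
  "step_at c a x = smooth_step (c * (x - a))"

text \<open>The derivative of the step \<open>step_at\<close>, of width 1/c around a. Its mass is 1
  because the step climbs from 0 to 1.\<close>

definition bump_at :: "real \<Rightarrow> real \<Rightarrow> real \<Rightarrow> real" where
  "bump_at c a x = c * deriv smooth_step (c * (x - a))"

lemma step_at_DERIV: "(step_at c a has_real_derivative bump_at c a x) (at x)"
proof -
  have "((\<lambda>x. c * (x - a)) has_real_derivative c) (at x)" by (auto intro!: derivative_eq_intros)
  from DERIV_chain2[OF smooth1_DERIV[OF smooth1_step] this]
  show ?thesis by (simp add: step_at_def[abs_def] bump_at_def mult.commute)
qed

lemma smooth1_step_at: "smooth1 (step_at c a)"
  using smooth1_affine[OF smooth1_step, of c "- c * a"] by (simp add: step_at_def[abs_def] algebra_simps)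

lemma deriv_step_at: "deriv (step_at c a) = bump_at c a"
  using DERIV_imp_deriv[OF step_at_DERIV] by blast

lemma smooth1_bump_at: "smooth1 (bump_at c a)"
  using smooth1_deriv[OF smooth1_step_at] unfolding deriv_step_at .

lemma deriv_step_outside: "1 < \<bar>x\<bar> \<Longrightarrow> deriv smooth_step x = 0"
proof -
  assume "1 < \<bar>x\<bar>"
  then consider "x < -1" | "1 < x" by linarith
  then show ?thesis
  proof cases
    case 1
    have "(smooth_step has_real_derivative 0) (at x)"
      by (rule has_field_derivative_transform_within_open[of "\<lambda>_. 0" _ _ "{..<-1}"]) (use 1 step_left in auto)
    then show ?thesis by (rule DERIV_imp_deriv)
  next
    case 2
    have "(smooth_step has_real_derivative 0) (at x)"
      by (rule has_field_derivative_transform_within_open[of "\<lambda>_. 1" _ _ "{1<..}"]) (use 2 step_right in auto)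
    then show ?thesis by (rule DERIV_imp_deriv)
  qed
qed

lemma bump_at_nonneg: "0 \<le> c \<Longrightarrow> 0 \<le> bump_at c a x"
  by (simp add: bump_at_def deriv_step_ge_0)

lemma bump_at_outside: "0 < c \<Longrightarrow> 1 / c < \<bar>x - a\<bar> \<Longrightarrow> bump_at c a x = 0"
proof -
  assume "0 < c" "1 / c < \<bar>x - a\<bar>"
  then have "1 < \<bar>c * (x - a)\<bar>" by (simp add: abs_mult divide_less_eq mult.commute)
  then show ?thesis by (simp add: bump_at_def deriv_step_outside)
qed

lemma bump_at_integral:
  assumes c: "1 \<le> c"
  shows "integrable lborel (bump_at c a)" "(LINT x|lborel. bump_at c a x) = 1"
proof -
  have c0: "0 < c" using c by simp
  have eq: "bump_at c a x = indicat_real {a - 1..a + 1} x * bump_at c a x" for x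
  proof (cases "x \<in> {a - 1..a + 1}")
    case False
    have "1 / c \<le> 1" using c by simp
    also have "1 < \<bar>x - a\<bar>" using False by auto
    finally show ?thesis using bump_at_outside[OF c0] by simp
  qed simp
  have cont: "continuous_on S (bump_at c a)" for S by (rule smooth1_continuous[OF smooth1_bump_at])
  have "set_integrable lborel {a - 1..a + 1} (bump_at c a)"
    by (rule borel_integrable_atLeastAtMost'[OF cont])
  then show "integrable lborel (bump_at c a)" unfolding set_integrable_def real_scaleR_def eq[symmetric] .
  have "(LINT x|lborel. bump_at c a x) = (LINT x:{a - 1..a + 1}|lborel. bump_at c a x)"
    unfolding set_lebesgue_integral_def real_scaleR_def eq[symmetric] ..
  also have "\<dots> = step_at c a (a + 1) - step_at c a (a - 1)"
    by (rule set_integral_FTC_real[OF _ step_at_DERIV cont]) simp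
  also have "\<dots> = 1" using c by (simp add: step_at_def step_right step_left)
  finally show "(LINT x|lborel. bump_at c a x) = 1" .
qed

section \<open>Tensor products as test functions on the plane\<close>

abbreviation tensor :: "(real \<Rightarrow> real) \<Rightarrow> (real \<Rightarrow> real) \<Rightarrow> real^2 \<Rightarrow> real" where
  "tensor f g \<equiv> (\<lambda>x. f (x$1) * g (x$2))"

lemma tensor_has_derivative:
  assumes "smooth1 f" "smooth1 g"
  shows "(tensor f g has_derivative (\<lambda>h. deriv f (x$1) * h$1 * g (x$2) + f (x$1) * (deriv g (x$2) * h$2))) (at x)"
proof -
  have c: "((\<lambda>x::real^2. h (x$i)) has_derivative (\<lambda>v. deriv h (x$i) * v$i)) (at x)" if "smooth1 h" for h i
  proof -
    have "((\<lambda>x::real^2. x$i) has_derivative (\<lambda>v. v$i)) (at x)"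
      by (rule bounded_linear_imp_has_derivative[OF bounded_linear_vec_nth])
    from has_derivative_compose[OF this smooth1_DERIV[OF that, unfolded has_field_derivative_def]]
    show ?thesis by simp
  qed
  show ?thesis
    using has_derivative_mult[OF c[OF assms(1), of 1] c[OF assms(2), of 2]] by (simp add: add.commute mult_ac)
qed

lemma partial_deriv_tensor:
  assumes "smooth1 f" "smooth1 g"
  shows "partial_deriv 1 (tensor f g) = tensor (deriv f) g" "partial_deriv 2 (tensor f g) = tensor f (deriv g)"
proof -
  have D: "frechet_derivative (tensor f g) (at x) v = deriv f (x$1) * v$1 * g (x$2) + f (x$1) * (deriv g (x$2) * v$2)" for x v
    using fun_cong[OF frechet_derivative_at[OF tensor_has_derivative[OF assms, of x]], of v] by (rule sym)
  show "partial_deriv 1 (tensor f g) = tensor (deriv f) g" "partial_deriv 2 (tensor f g) = tensor f (deriv g)"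
    unfolding partial_deriv_def D by (simp_all add: axis_def)
qed

lemma foldr_partial_deriv_tensor:
  assumes "smooth1 f" "smooth1 g"
  shows "\<exists>f' g'. smooth1 f' \<and> smooth1 g' \<and> foldr partial_deriv \<alpha> (tensor f g) = tensor f' g'"
proof (induction \<alpha>)
  case Nil
  then show ?case using assms by auto
next
  case (Cons i \<alpha>)
  then obtain f' g' where fg: "smooth1 f'" "smooth1 g'" "foldr partial_deriv \<alpha> (tensor f g) = tensor f' g'" by blast
  have eq: "foldr partial_deriv (i # \<alpha>) (tensor f g) = partial_deriv i (tensor f' g')"
    by (simp add: fg(3))
  consider "i = 1" | "i = 2" using exhaust_2[of i] by blast
  then show ?case
  proof cases
    case 1
    show ?thesis unfolding eq unfolding 1 partial_deriv_tensor(1)[OF fg(1,2)]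
      using fg(1,2) smooth1_deriv by blast
  next
    case 2
    show ?thesis unfolding eq unfolding 2 partial_deriv_tensor(2)[OF fg(1,2)]
      using fg(1,2) smooth1_deriv by blast
  qed
qed

lemma test_fun_tensor:
  assumes "smooth1 f" "smooth1 g"
    and supp: "\<And>x. x \<notin> {l..u} \<Longrightarrow> f x = 0" "\<And>x. x \<notin> {l'..u'} \<Longrightarrow> g x = 0"
  shows "test_fun (tensor f g)"
  unfolding test_fun_def smooth_fun_def
proof (intro conjI allI)
  fix \<alpha> x
  show "foldr partial_deriv \<alpha> (tensor f g) differentiable at x"
  proof -
    obtain f' g' where "smooth1 f'" "smooth1 g'" "foldr partial_deriv \<alpha> (tensor f g) = tensor f' g'"
      using foldr_partial_deriv_tensor[OF assms(1,2), of \<alpha>] by blast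
    then show ?thesis using differentiableI[OF tensor_has_derivative] by metis
  qed
  have "{x. tensor f g x \<noteq> 0} \<subseteq> cbox (vec2 l l') (vec2 u u')"
  proof
    fix x assume "x \<in> {x. tensor f g x \<noteq> 0}"
    then have "f (x$1) \<noteq> 0" "g (x$2) \<noteq> 0" by auto
    then have "x$1 \<in> {l..u}" "x$2 \<in> {l'..u'}" using supp by blast+
    then show "x \<in> cbox (vec2 l l') (vec2 u u')" by (simp add: mem_box_cart forall_2)
  qed
  then show "compact (closure {x. tensor f g x \<noteq> 0})"
    using bounded_subset[OF bounded_cbox] by (simp add: compact_closure)
qed

lemma tensor_square_integrable:
  assumes f: "continuous_on UNIV f" "\<And>x. x \<notin> {l..l + d} \<Longrightarrow> f x = 0" "\<And>x. \<bar>f x\<bar> \<le> M"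
    and g: "continuous_on UNIV g" "\<And>x. x \<notin> {l'..l' + d} \<Longrightarrow> g x = 0" "\<And>x. \<bar>g x\<bar> \<le> M"
    and d: "0 \<le> d"
  shows "integrable lborel (\<lambda>x. (tensor f g x)\<^sup>2)" "(LINT x|lborel. (tensor f g x)\<^sup>2) \<le> (d * M\<^sup>2)\<^sup>2"
proof -
  have sq: "integrable lborel (\<lambda>x. (h x)\<^sup>2) \<and> 0 \<le> (LINT x|lborel. (h x)\<^sup>2) \<and> (LINT x|lborel. (h x)\<^sup>2) \<le> d * M\<^sup>2"
    if h: "continuous_on UNIV h" "\<And>x. x \<notin> {a..a + d} \<Longrightarrow> h x = 0" "\<And>x. \<bar>h x\<bar> \<le> M" for h a
  proof -
    have i: "integrable lborel (\<lambda>x. indicat_real {a..a + d} x * M\<^sup>2)"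
      by (intro integrable_mult_left integrable_real_indicator) (auto simp: emeasure_lborel_Icc_eq)
    have "(h x)\<^sup>2 \<le> M\<^sup>2" for x using h(3)[of x] by (metis abs_ge_zero power2_abs power_mono)
    then have b: "(h x)\<^sup>2 \<le> indicat_real {a..a + d} x * M\<^sup>2" for x
      using h(2)[of x] by (auto split: split_indicator)
    have [measurable]: "h \<in> borel_measurable borel" using h(1) by (rule borel_measurable_continuous_onI)
    have ih: "integrable lborel (\<lambda>x. (h x)\<^sup>2)"
      using i by (rule Bochner_Integration.integrable_bound) (use b in \<open>auto intro: order_trans[OF _ abs_ge_self]\<close>)
    moreover have "(LINT x|lborel. (h x)\<^sup>2) \<le> d * M\<^sup>2"
      using integral_mono[OF ih i b] d by simp
    ultimately show ?thesis by simp
  qed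
  note sf = sq[of f l, OF f] and sg = sq[of g l', OF g]
  show "integrable lborel (\<lambda>x. (tensor f g x)\<^sup>2)"
    using integrable_plane_prod[of "\<lambda>x. (f x)\<^sup>2" "\<lambda>x. (g x)\<^sup>2"] sf sg by (simp add: power_mult_distrib)
  have "(LINT x|lborel. (tensor f g x)\<^sup>2) = (LINT x|lborel. (f x)\<^sup>2) * (LINT x|lborel. (g x)\<^sup>2)"
    using integral_plane_prod[of "\<lambda>x. (f x)\<^sup>2" "\<lambda>x. (g x)\<^sup>2"] sf sg by (simp add: power_mult_distrib)
  also have "\<dots> \<le> (d * M\<^sup>2) * (d * M\<^sup>2)" using sf sg d by (intro mult_mono) auto
  finally show "(LINT x|lborel. (tensor f g x)\<^sup>2) \<le> (d * M\<^sup>2)\<^sup>2" by (simp add: power2_eq_square)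
qed

text \<open>Young's inequality with a free weight e replaces Cauchy-Schwarz; choosing e later gives
  either smallness or a plain bound.\<close>

lemma L2_mult_integrable:
  fixes f g :: "real^2 \<Rightarrow> real"
  assumes "L2_fun f" "L2_fun g"
  shows "integrable lborel (\<lambda>x. f x * g x)"
    and "0 < e \<Longrightarrow> \<bar>LINT x|lborel. f x * g x\<bar> \<le> (e * (LINT x|lborel. (f x)\<^sup>2) + (LINT x|lborel. (g x)\<^sup>2) / e) / 2"
proof -
  have [measurable]: "f \<in> borel_measurable borel" "g \<in> borel_measurable borel"
    and i: "integrable lborel (\<lambda>x. (f x)\<^sup>2)" "integrable lborel (\<lambda>x. (g x)\<^sup>2)"
    using assms by (auto simp: L2_fun_def)
  have bd: "\<bar>a * b\<bar> \<le> (e * a\<^sup>2 + b\<^sup>2 / e) / 2" if "0 < e" for a b e :: real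
  proof -
    have "0 \<le> (e * \<bar>a\<bar> - \<bar>b\<bar>)\<^sup>2 / e" using that by simp
    also have "\<dots> = e * a\<^sup>2 + b\<^sup>2 / e - 2 * \<bar>a * b\<bar>"
      using that by (simp add: power2_diff power_mult_distrib abs_mult field_simps power2_eq_square)
    finally show ?thesis by simp
  qed
  have ie: "integrable lborel (\<lambda>x. (e * (f x)\<^sup>2 + (g x)\<^sup>2 / e) / 2)" for e using i by simp
  show int: "integrable lborel (\<lambda>x. f x * g x)"
    by (rule Bochner_Integration.integrable_bound[OF ie[of 1]])
       (use bd[of 1] in \<open>auto intro: order_trans[OF _ abs_ge_self]\<close>)
  assume e: "0 < e"
  have "\<bar>LINT x|lborel. f x * g x\<bar> \<le> (LINT x|lborel. (e * (f x)\<^sup>2 + (g x)\<^sup>2 / e) / 2)"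
    by (rule order_trans[OF integral_abs_bound integral_mono[OF integrable_abs[OF int] ie bd[OF e]]])
  then show "\<bar>LINT x|lborel. f x * g x\<bar> \<le> (e * (LINT x|lborel. (f x)\<^sup>2) + (LINT x|lborel. (g x)\<^sup>2) / e) / 2"
    using i by simp
qed

lemma L2_fun_add: "L2_fun f \<Longrightarrow> L2_fun g \<Longrightarrow> L2_fun (\<lambda>x. f x + g x)"
proof -
  assume fg: "L2_fun f" "L2_fun g"
  then have [measurable]: "f \<in> borel_measurable borel" "g \<in> borel_measurable borel" by (auto simp: L2_fun_def)
  have "integrable lborel (\<lambda>x. (f x)\<^sup>2 + (g x)\<^sup>2 + 2 * (f x * g x))"
    using fg L2_mult_integrable[OF fg] by (auto simp: L2_fun_def)
  then show ?thesis by (simp add: L2_fun_def power2_sum mult.assoc)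
qed

lemma L2_fun_cmult: "L2_fun f \<Longrightarrow> L2_fun (\<lambda>x. c * f x)"
  by (auto simp: L2_fun_def power_mult_distrib)

lemma L2_fun_diff: "L2_fun f \<Longrightarrow> L2_fun g \<Longrightarrow> L2_fun (\<lambda>x. f x - g x)"
  using L2_fun_add[of f "\<lambda>x. (-1) * g x"] L2_fun_cmult[of g "-1"] by simp

lemma L2_fun_sum: "finite A \<Longrightarrow> (\<And>i. i \<in> A \<Longrightarrow> L2_fun (f i)) \<Longrightarrow> L2_fun (\<lambda>x. \<Sum>i\<in>A. f i x)"
  by (induction A rule: finite_induct) (auto simp: L2_fun_add, simp add: L2_fun_def)

lemma has_weak_deriv_Nil: "has_weak_deriv [] h h"
  by (simp add: has_weak_deriv_def)

text \<open>The order-zero summand of the norm belongs to the chosen representative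
  \<open>weak_deriv [] h\<close>, which has the same pairings with test functions as h. Young's
  inequality with weight 1/e then yields a bound proportional to e.\<close>

lemma H2_norm_weak_bound:
  assumes h: "L2_fun h" and \<phi>: "test_fun \<phi>" "L2_fun \<phi>" and e: "0 < e" "H2_norm h < e"
  shows "\<bar>LINT x|lborel. h x * \<phi> x\<bar> \<le> e * (1 + (LINT x|lborel. (\<phi> x)\<^sup>2))"
proof -
  define g where "g = weak_deriv [] h"
  have "L2_fun g \<and> has_weak_deriv [] h g"
    unfolding g_def weak_deriv_def by (rule someI[of _ h]) (use h has_weak_deriv_Nil in blast)
  then have g: "L2_fun g" "(LINT x|lborel. h x * \<phi> x) = (LINT x|lborel. g x * \<phi> x)"
    using \<phi> by (auto simp: has_weak_deriv_def)
  have "finite {\<alpha>::2 list. length \<alpha> \<le> 2}" using finite_lists_length_le[of "UNIV :: 2 set" 2] by simp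
  then have "(L2_norm (weak_deriv [] h))\<^sup>2 \<le> (\<Sum>\<alpha> | length \<alpha> \<le> 2. (L2_norm (weak_deriv \<alpha> h))\<^sup>2)"
    by (intro member_le_sum) auto
  then have "sqrt ((L2_norm (weak_deriv [] h))\<^sup>2) \<le> H2_norm h"
    unfolding H2_norm_def by (rule real_sqrt_le_mono)
  moreover have "0 \<le> L2_norm g" by (simp add: L2_norm_def)
  ultimately have "L2_norm g < e" using e by (simp add: g_def)
  moreover have "(L2_norm g)\<^sup>2 = (LINT x|lborel. (g x)\<^sup>2)" by (simp add: L2_norm_def)
  ultimately have g2: "(LINT x|lborel. (g x)\<^sup>2) \<le> e\<^sup>2"
    using \<open>0 \<le> L2_norm g\<close> power_mono[of "L2_norm g" e 2] by simp
  have p0: "0 \<le> (LINT x|lborel. (\<phi> x)\<^sup>2)" by simp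
  have "\<bar>LINT x|lborel. g x * \<phi> x\<bar> \<le> (1/e * (LINT x|lborel. (g x)\<^sup>2) + (LINT x|lborel. (\<phi> x)\<^sup>2) / (1/e)) / 2"
    using e by (intro L2_mult_integrable g \<phi>) simp
  also have "\<dots> \<le> (1/e * e\<^sup>2 + (LINT x|lborel. (\<phi> x)\<^sup>2) / (1/e)) / 2"
    using g2 e by (intro divide_right_mono add_mono mult_left_mono) auto
  also have "\<dots> = e / 2 * (1 + (LINT x|lborel. (\<phi> x)\<^sup>2))"
    using e by (simp add: power2_eq_square field_simps)
  also have "\<dots> \<le> e * (1 + (LINT x|lborel. (\<phi> x)\<^sup>2))"
    using e p0 by (intro mult_right_mono) auto
  finally show ?thesis using g by simp
qed

text \<open>Pairing with a fixed test function turns the Sobolev-valued Riemann sums into scalar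
  ones; the gauge for the tolerance e' serves unchanged.\<close>

lemma has_H2_integral_weak:
  assumes F: "has_H2_integral F y a b" and \<phi>: "test_fun \<phi>" "L2_fun \<phi>"
  shows "((\<lambda>s. LINT x|lborel. F s x * \<phi> x) has_integral (LINT x|lborel. y x * \<phi> x)) {a..b}"
  unfolding has_integral_real
proof (intro allI impI)
  fix e :: real assume e: "0 < e"
  define p where "p = 1 + (LINT x|lborel. (\<phi> x)\<^sup>2)"
  have p: "0 < p" unfolding p_def by (intro add_pos_nonneg) auto
  \<comment> \<open>The factor 2 makes the final estimate strict.\<close>
  define e' where "e' = e / (2 * p)"
  have e': "0 < e'" using e p by (simp add: e'_def)
  have L2: "\<And>s. s \<in> {a..b} \<Longrightarrow> L2_fun (F s)" "L2_fun y"
    using F by (auto simp: has_H2_integral_def H2_fun_def)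
  obtain \<gamma> where \<gamma>: "gauge \<gamma>" "\<And>P. P tagged_division_of cbox a b \<Longrightarrow> \<gamma> fine P \<Longrightarrow>
           H2_norm (\<lambda>x. (\<Sum>(s,K)\<in>P. measure lborel K * F s x) - y x) < e'"
    using F e' unfolding has_H2_integral_def by meson
  show "\<exists>\<gamma>. gauge \<gamma> \<and> (\<forall>\<D>. \<D> tagged_division_of {a..b} \<and> \<gamma> fine \<D> \<longrightarrow>
      norm ((\<Sum>(x, k)\<in>\<D>. measure lborel k *\<^sub>R (LINT xa|lborel. F x xa * \<phi> xa)) - (LINT x|lborel. y x * \<phi> x)) < e)"
  proof (intro exI[of _ \<gamma>] conjI allI impI \<gamma>(1))
    fix P assume P: "P tagged_division_of {a..b} \<and> \<gamma> fine P"
    then have P': "P tagged_division_of cbox a b" by simp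
    have tags: "s \<in> {a..b}" if "(s, K) \<in> P" for s K
      using P that by (metis tag_in_interval cbox_interval)
    have fin: "finite P" using P by auto
    have L2p: "L2_fun (case p of (s, K) \<Rightarrow> (\<lambda>x. measure lborel K * F s x))" if "p \<in> P" for p
      using that tags L2 by (cases p) (auto intro: L2_fun_cmult)
    have s: "L2_fun (\<lambda>x. \<Sum>(s,K)\<in>P. measure lborel K * F s x)"
      using L2_fun_sum[OF fin L2p] by (simp add: case_prod_beta)
    have "\<bar>LINT x|lborel. ((\<Sum>(s,K)\<in>P. measure lborel K * F s x) - y x) * \<phi> x\<bar> \<le> e' * p"
      unfolding p_def by (rule H2_norm_weak_bound[OF L2_fun_diff[OF s L2(2)] \<phi> e' \<gamma>(2)[OF P']]) (use P in simp)
    also have "\<dots> < e" using e p by (simp add: e'_def)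
    also have "(LINT x|lborel. ((\<Sum>(s,K)\<in>P. measure lborel K * F s x) - y x) * \<phi> x)
        = (LINT x|lborel. (\<Sum>(s,K)\<in>P. measure lborel K * F s x) * \<phi> x) - (LINT x|lborel. y x * \<phi> x)"
      unfolding left_diff_distrib by (intro Bochner_Integration.integral_diff L2_mult_integrable s L2 \<phi>)
    also have "(LINT x|lborel. (\<Sum>(s,K)\<in>P. measure lborel K * F s x) * \<phi> x) = (\<Sum>(s,K)\<in>P. measure lborel K *\<^sub>R (LINT x|lborel. F s x * \<phi> x))"
    proof -
      have "(LINT x|lborel. (\<Sum>(s,K)\<in>P. measure lborel K * F s x) * \<phi> x) = (LINT x|lborel. (\<Sum>p\<in>P. measure lborel (snd p) * (F (fst p) x * \<phi> x)))"
        by (simp add: sum_distrib_right case_prod_beta mult.assoc)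
      also have "\<dots> = (\<Sum>p\<in>P. (LINT x|lborel. measure lborel (snd p) * (F (fst p) x * \<phi> x)))"
        by (intro Bochner_Integration.integral_sum integrable_mult_right L2_mult_integrable L2 \<phi>) (use tags in auto)
      finally show ?thesis by (simp add: case_prod_beta)
    qed
    finally show "norm ((\<Sum>(x, k)\<in>P. measure lborel k *\<^sub>R (LINT xa|lborel. F x xa * \<phi> xa)) - (LINT x|lborel. y x * \<phi> x)) < e"
      by simp
  qed
qed

lemma C0_H2_on_weak_continuous:
  assumes u: "C0_H2_on I u" and \<phi>: "test_fun \<phi>" "L2_fun \<phi>"
  shows "continuous_on I (\<lambda>s. LINT x|lborel. u s x * \<phi> x)"
  unfolding continuous_on_def
proof
  fix t assume t: "t \<in> I"
  define p where "p = 1 + (LINT x|lborel. (\<phi> x)\<^sup>2)"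
  have p: "0 < p" unfolding p_def by (intro add_pos_nonneg) auto
  have L2: "\<And>s. s \<in> I \<Longrightarrow> L2_fun (u s)" using u by (auto simp: C0_H2_on_def H2_fun_def)
  have lim: "((\<lambda>s. H2_norm (\<lambda>x. u s x - u t x)) \<longlongrightarrow> 0) (at t within I)"
    using u t by (auto simp: C0_H2_on_def)
  show "((\<lambda>s. LINT x|lborel. u s x * \<phi> x) \<longlongrightarrow> (LINT x|lborel. u t x * \<phi> x)) (at t within I)"
  proof (rule tendstoI)
    fix e :: real assume e: "0 < e"
    define e' where "e' = e / (2 * p)"
    have e': "0 < e'" using e p by (simp add: e'_def)
    have "\<forall>\<^sub>F s in at t within I. H2_norm (\<lambda>x. u s x - u t x) < e'"
      using order_tendstoD(2)[OF lim e'] .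
    moreover have "\<forall>\<^sub>F s in at t within I. s \<in> I" by (simp add: eventually_at_filter)
    ultimately show "\<forall>\<^sub>F s in at t within I. dist (LINT x|lborel. u s x * \<phi> x) (LINT x|lborel. u t x * \<phi> x) < e"
    proof eventually_elim
      case (elim s)
      have "\<bar>LINT x|lborel. (u s x - u t x) * \<phi> x\<bar> \<le> e' * p"
        unfolding p_def by (rule H2_norm_weak_bound[OF L2_fun_diff[OF L2 L2] \<phi> e' elim(1)]) (use elim t in auto)
      also have "\<dots> < e" using e p by (simp add: e'_def)
      also have "(LINT x|lborel. (u s x - u t x) * \<phi> x) = (LINT x|lborel. u s x * \<phi> x) - (LINT x|lborel. u t x * \<phi> x)"
        unfolding left_diff_distrib using elim t by (intro Bochner_Integration.integral_diff L2_mult_integrable L2 \<phi>) auto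
      finally show ?case by (simp add: dist_real_def)
    qed
  qed
qed

section \<open>Mollification, boundedness and circular averages\<close>

lemma deriv_step_bounded: obtains M where "1 \<le> M" "\<And>x. \<bar>deriv smooth_step x\<bar> \<le> M"
proof -
  have "compact (deriv smooth_step ` {-1..1})"
    by (intro compact_continuous_image smooth1_continuous smooth1_deriv smooth1_step) simp
  then obtain M where M: "\<And>x. x \<in> {-1..1} \<Longrightarrow> \<bar>deriv smooth_step x\<bar> \<le> M"
    using compact_imp_bounded bounded_iff by (metis image_eqI real_norm_def)
  have "\<bar>deriv smooth_step x\<bar> \<le> max 1 M" for x
  proof (cases "x \<in> {-1..1}")
    case True
    then show ?thesis using M[OF True] by simp
  next
    case False
    then have "1 < \<bar>x\<bar>" by auto
    then show ?thesis by (simp add: deriv_step_outside)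
  qed
  then show thesis by (intro that[of "max 1 M"]) auto
qed

lemma L2_fun_tensor:
  assumes f: "smooth1 f" "\<And>x. x \<notin> {l..l + d} \<Longrightarrow> f x = 0"
    and g: "smooth1 g" "\<And>x. x \<notin> {l'..l' + d} \<Longrightarrow> g x = 0" and d: "0 \<le> d"
  shows "L2_fun (tensor f g)"
proof -
  have bdd: "\<exists>M. \<forall>x. \<bar>h x\<bar> \<le> M" if h: "smooth1 h" "\<And>x. x \<notin> {a..a + d} \<Longrightarrow> h x = 0" for h a
  proof -
    have "compact (h ` {a..a + d})" by (intro compact_continuous_image smooth1_continuous h) simp
    then obtain M where M: "\<And>x. x \<in> {a..a + d} \<Longrightarrow> \<bar>h x\<bar> \<le> M"
      using compact_imp_bounded bounded_iff by (metis image_eqI real_norm_def)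
    have "\<bar>h x\<bar> \<le> max 0 M" for x using M[of x] h(2)[of x] by (cases "x \<in> {a..a + d}") auto
    then show ?thesis by blast
  qed
  obtain Mf Mg where M: "\<And>x. \<bar>f x\<bar> \<le> Mf" "\<And>x. \<bar>g x\<bar> \<le> Mg"
    using bdd[of f l] bdd[of g l'] f g by metis
  have [measurable]: "f \<in> borel_measurable borel" "g \<in> borel_measurable borel"
    using f g by (auto intro: borel_measurable_continuous_onI smooth1_continuous)
  have "integrable lborel (\<lambda>x. (tensor f g x)\<^sup>2)"
  proof (rule tensor_square_integrable(1)[where M = "max Mf Mg"])
    show "\<bar>f x\<bar> \<le> max Mf Mg" "\<bar>g x\<bar> \<le> max Mf Mg" for x using M(1)[of x] M(2)[of x] by auto
  qed (use f g d in \<open>auto intro: smooth1_continuous\<close>)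
  then show ?thesis by (simp add: L2_fun_def)
qed

definition mollifier :: "real \<Rightarrow> real^2 \<Rightarrow> real^2 \<Rightarrow> real" where
  "mollifier c x = tensor (bump_at c (x$1)) (bump_at c (x$2))"

lemma bump_at_support: "1 \<le> c \<Longrightarrow> x \<notin> {a - 1..a - 1 + 2} \<Longrightarrow> bump_at c a x = 0"
proof -
  assume c: "1 \<le> c" and x: "x \<notin> {a - 1..a - 1 + 2}"
  have "1 / c \<le> 1" using c by simp
  also have "1 < \<bar>x - a\<bar>" using x by auto
  finally show ?thesis using c by (intro bump_at_outside) auto
qed

lemma step_diff_support: "1 \<le> c \<Longrightarrow> x \<notin> {a - 1..a - 1 + 2} \<Longrightarrow> step_at c a x - step_at 1 a x = 0"
proof -
  assume c: "1 \<le> c" and x: "x \<notin> {a - 1..a - 1 + 2}"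
  then consider "x - a \<le> -1" | "1 \<le> x - a" by force
  then show ?thesis
  proof cases
    case 1
    then have "c * (x - a) \<le> c * (-1)" using c by (intro mult_left_mono) auto
    then show ?thesis using 1 c by (simp add: step_at_def step_left)
  next
    case 2
    then have "c * 1 \<le> c * (x - a)" using c by (intro mult_left_mono) auto
    then have "1 \<le> c * (x - a)" using c by linarith
    then show ?thesis using 2 by (simp add: step_at_def step_right)
  qed
qed

lemma mollifier:
  assumes c: "1 \<le> c"
  shows test_fun_mollifier: "test_fun (mollifier c x)" and L2_fun_mollifier: "L2_fun (mollifier c x)"
    and mollifier_nonneg: "0 \<le> mollifier c x y"
    and mollifier_integrable: "integrable lborel (mollifier c x)" and mollifier_integral: "(LINT y|lborel. mollifier c x y) = 1"
proof -
  show "test_fun (mollifier c x)" unfolding mollifier_def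
    by (rule test_fun_tensor[OF smooth1_bump_at smooth1_bump_at bump_at_support[OF c] bump_at_support[OF c]])
  show "L2_fun (mollifier c x)" unfolding mollifier_def
    by (rule L2_fun_tensor[where d = 2, OF smooth1_bump_at bump_at_support[OF c] smooth1_bump_at bump_at_support[OF c]]) auto
  show "0 \<le> mollifier c x y" using c by (simp add: mollifier_def bump_at_nonneg)
  show "integrable lborel (mollifier c x)" unfolding mollifier_def
    by (intro integrable_plane_prod bump_at_integral c)
  show "(LINT y|lborel. mollifier c x y) = 1" unfolding mollifier_def
    by (simp add: integral_plane_prod bump_at_integral[OF c])
qed

text \<open>The bumps are nonnegative, have mass 1 and shrink to x, so only the oscillation of f
  near x matters.\<close>

lemma mollifier_tendsto:
  fixes f :: "real^2 \<Rightarrow> real"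
  assumes f: "continuous_on UNIV f"
  shows "(\<lambda>n. LINT y|lborel. f y * mollifier (real (Suc n)) x y) \<longlonglongrightarrow> f x"
proof (rule LIMSEQ_I)
  fix e :: real assume e: "0 < e"
  from f have "isCont f x" by (simp add: continuous_on_eq_continuous_at)
  then obtain d where d: "0 < d" "\<And>y. dist y x < d \<Longrightarrow> dist (f y) (f x) < e / 2"
    unfolding continuous_at_eps_delta using e by (metis half_gt_zero)
  \<comment> \<open>Each coordinate deviates by at most 1/c on the support, so its points are within
    2/c of x.\<close>
  obtain N :: nat where N: "2 / d < real N" using reals_Archimedean2 by blast
  have "norm ((LINT y|lborel. f y * mollifier (real (Suc n)) x y) - f x) < e" if n: "N \<le> n" for n
  proof -
    define c where "c = real (Suc n)"
    have c: "1 \<le> c" by (simp add: c_def)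
    note m = mollifier_nonneg[OF c] mollifier_integrable[OF c] mollifier_integral[OF c]
    have "real N < c" using n by (simp add: c_def)
    then have "2 / d < c" using N by linarith
    then have "2 < c * d" using d(1) by (simp add: pos_divide_less_eq)
    then have dc: "2 / c < d" using c by (simp add: pos_divide_less_eq mult.commute)
    have far: "mollifier c x y = 0" if "d \<le> dist y x" for y
    proof (rule ccontr)
      assume "mollifier c x y \<noteq> 0"
      then have "\<bar>y$1 - x$1\<bar> \<le> 1 / c" "\<bar>y$2 - x$2\<bar> \<le> 1 / c"
        using bump_at_outside[of c "y$1" "x$1"] bump_at_outside[of c "y$2" "x$2"] c
        by (auto simp: mollifier_def not_le[symmetric])
      then have "dist y x \<le> 2 / c"
        using norm_le_l1_cart[of "y - x"] by (simp add: sum_2 dist_norm)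
      with dc that show False by linarith
    qed
    have close: "\<bar>(f y - f x) * mollifier c x y\<bar> \<le> e / 2 * mollifier c x y" for y
    proof (cases "dist y x < d")
      case True
      then have "\<bar>f y - f x\<bar> \<le> e / 2" using d(2)[OF True] by (simp add: dist_real_def)
      from mult_right_mono[OF this m(1)[of x y]] show ?thesis using m(1)[of x y] by (simp add: abs_mult)
    next
      case False
      then show ?thesis using far[of y] by simp
    qed
    have fm [measurable]: "f \<in> borel_measurable borel" using f by (rule borel_measurable_continuous_onI)
    have [measurable]: "mollifier c x \<in> borel_measurable borel" using m(2) by auto
    have i0: "integrable lborel (\<lambda>y. e / 2 * mollifier c x y)" using m(2) by simp
    have i1: "integrable lborel (\<lambda>y. (f y - f x) * mollifier c x y)"
      using i0 by (rule Bochner_Integration.integrable_bound)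
        (simp, unfold real_norm_def, intro AE_I2 order_trans[OF close abs_ge_self])
    have "(LINT y|lborel. f y * mollifier c x y) = (LINT y|lborel. (f y - f x) * mollifier c x y + f x * mollifier c x y)"
      by (simp add: algebra_simps)
    also have "\<dots> = (LINT y|lborel. (f y - f x) * mollifier c x y) + f x"
      using i1 m(2,3) by (subst Bochner_Integration.integral_add) simp_all
    finally have "norm ((LINT y|lborel. f y * mollifier c x y) - f x) = \<bar>LINT y|lborel. (f y - f x) * mollifier c x y\<bar>"
      by simp
    also have "\<dots> \<le> (LINT y|lborel. e / 2 * mollifier c x y)"
      by (rule order_trans[OF integral_abs_bound integral_mono[OF integrable_abs[OF i1] i0 close]])
    also have "\<dots> = e / 2" using m(3) by simp
    also have "\<dots> < e" using e by simp
    finally show ?thesis by (simp add: c_def)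
  qed
  then show "\<exists>no. \<forall>n\<ge>no. norm ((LINT y|lborel. f y * mollifier (real (Suc n)) x y) - f x) < e" by blast
qed

text \<open>Sobolev's embedding in the plane needs only the mixed second derivative:
  with \<open>G' = P - Q\<close>, where \<open>P\<close> is a narrow and \<open>Q\<close> a fixed bump, \<open>P \<otimes> P\<close> differs from \<open>Q \<otimes> Q\<close> by
  first and mixed second derivatives of uniformly bounded test functions.\<close>

lemma H2_continuous_bounded:
  assumes H2: "H2_fun f" and cont: "continuous_on UNIV f"
  shows "\<exists>B. \<forall>x. \<bar>f x\<bar> \<le> B"
proof -
  have f: "L2_fun f" using H2 by (simp add: H2_fun_def)
  have wd: "\<exists>g. L2_fun g \<and> has_weak_deriv \<alpha> f g" if "length \<alpha> \<le> 2" for \<alpha>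
    using H2 that by (simp add: H2_fun_def)
  obtain g1 where g1: "L2_fun g1" "has_weak_deriv [1] f g1" using wd[of "[1]"] by auto
  obtain g2 where g2: "L2_fun g2" "has_weak_deriv [2] f g2" using wd[of "[2]"] by auto
  obtain g12 where g12: "L2_fun g12" "has_weak_deriv [1, 2] f g12" using wd[of "[1, 2]"] by auto
  obtain M where M: "1 \<le> M" "\<And>x. \<bar>deriv smooth_step x\<bar> \<le> M" using deriv_step_bounded by blast
  \<comment> \<open>A bound for the squared norm of the test functions below: they live on a square
    of side 2 and each factor is at most \<open>M\<close>. Each summand of \<open>B\<close> is then
    Young's inequality with weight 1.\<close>
  define K where "K = (2 * M\<^sup>2)\<^sup>2"
  define B where "B = ((LINT x|lborel. (f x)\<^sup>2) + K) / 2 + ((LINT x|lborel. (g1 x)\<^sup>2) + K) / 2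
    + ((LINT x|lborel. (g2 x)\<^sup>2) + K) / 2 + ((LINT x|lborel. (g12 x)\<^sup>2) + K) / 2"
  have main: "\<bar>LINT y|lborel. f y * mollifier c x y\<bar> \<le> B" if c: "1 \<le> c" for c x
  proof -
    \<comment> \<open>The narrow bump P is unbounded as c grows, but the difference of steps G stays
      between -1 and 1, whence bounds independent of c.\<close>
    define P Q G where "P = bump_at c" and "Q = bump_at 1" and "G = (\<lambda>a x. step_at c a x - step_at 1 a x)"
    have sm: "smooth1 (P a)" "smooth1 (Q a)" "smooth1 (G a)" "smooth1 (\<lambda>x. P a x - Q a x)" for a
      unfolding P_def Q_def G_def by (intro smooth1_bump_at smooth1_step_at smooth1_diff)+
    have dG: "deriv (G a) = (\<lambda>x. P a x - Q a x)" for a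
      unfolding G_def P_def Q_def by (rule ext, rule DERIV_imp_deriv) (intro DERIV_diff step_at_DERIV)
    have supp: "P a z = 0" "Q a z = 0" "G a z = 0" if "z \<notin> {a - 1..a - 1 + 2}" for a z
      using bump_at_support[OF c that] bump_at_support[OF _ that, of 1] step_diff_support[OF c that]
      unfolding P_def Q_def G_def by auto
    have bd: "\<bar>Q a z\<bar> \<le> M" "\<bar>G a z\<bar> \<le> M" for a z
    proof -
      show "\<bar>Q a z\<bar> \<le> M" using M by (simp add: Q_def bump_at_def)
      have "\<bar>G a z\<bar> \<le> 1" unfolding G_def step_at_def
        using step_ge_0[of "c * (z - a)"] step_le_1[of "c * (z - a)"] step_ge_0[of "1 * (z - a)"] step_le_1[of "1 * (z - a)"] by linarith
      then show "\<bar>G a z\<bar> \<le> M" using M by simp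
    qed
    let ?a = "x$1" and ?b = "x$2"
    let ?t = "\<lambda>A B. tensor (A ?a) (B ?b)"
    have L2: "L2_fun (?t A B)" if "A \<in> {P, Q, G, \<lambda>a x. P a x - Q a x}" "B \<in> {P, Q, G, \<lambda>a x. P a x - Q a x}" for A B
      by (rule L2_fun_tensor[where l = "?a - 1" and l' = "?b - 1" and d = 2]) (use that sm supp in auto)
    have test: "test_fun (?t A B)" if "A \<in> {Q, G}" "B \<in> {Q, G}" for A B
      by (rule test_fun_tensor[where l = "?a - 1" and l' = "?b - 1" and u = "?a - 1 + 2" and u' = "?b - 1 + 2"]) (use that sm supp in auto)
    have bound: "\<bar>LINT y|lborel. h y * ?t A B y\<bar> \<le> ((LINT x|lborel. (h x)\<^sup>2) + K) / 2"
      if h: "L2_fun h" and AB: "A \<in> {Q, G}" "B \<in> {Q, G}" for h A B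
    proof -
      have "(LINT y|lborel. (?t A B y)\<^sup>2) \<le> K" unfolding K_def
        by (rule tensor_square_integrable(2)[where l = "?a - 1" and l' = "?b - 1"])
           (use AB sm supp bd in \<open>auto intro: smooth1_continuous\<close>)
      moreover have "\<bar>LINT y|lborel. h y * ?t A B y\<bar> \<le> (1 * (LINT x|lborel. (h x)\<^sup>2) + (LINT x|lborel. (?t A B x)\<^sup>2) / 1) / 2"
        by (rule L2_mult_integrable(2)[OF h L2]) (use AB in auto)
      ultimately show ?thesis by simp
    qed
    let ?R = "\<lambda>a x. P a x - Q a x"
    have e1: "(LINT y|lborel. f y * ?t ?R Q y) = - (LINT y|lborel. g1 y * ?t G Q y)"
      using g1(2) test[of G Q] unfolding has_weak_deriv_def by (force simp: partial_deriv_tensor sm dG)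
    have e2: "(LINT y|lborel. f y * ?t Q ?R y) = - (LINT y|lborel. g2 y * ?t Q G y)"
      using g2(2) test[of Q G] unfolding has_weak_deriv_def by (force simp: partial_deriv_tensor sm dG)
    have e12: "(LINT y|lborel. f y * ?t ?R ?R y) = (LINT y|lborel. g12 y * ?t G G y)"
    proof -
      have "foldr partial_deriv [1, 2] (?t G G) = partial_deriv 1 (partial_deriv 2 (?t G G))" by simp
      also have "\<dots> = ?t ?R ?R"
        unfolding partial_deriv_tensor(2)[OF sm(3) sm(3)] dG partial_deriv_tensor(1)[OF sm(3) sm(4)] ..
      finally have "foldr partial_deriv [1, 2] (?t G G) = ?t ?R ?R" .
      then show ?thesis using g12(2) test[of G G] unfolding has_weak_deriv_def by force
    qed
    \<comment> \<open>P \<otimes> P is expanded with P = G' + Q; in three of the four terms the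
      derivatives are moved to f, with sign -1 for each order.\<close>
    have "(LINT y|lborel. f y * mollifier c x y) = (LINT y|lborel. f y * ?t ?R ?R y + f y * ?t ?R Q y + f y * ?t Q ?R y + f y * ?t Q Q y)"
      by (intro Bochner_Integration.integral_cong) (simp_all add: mollifier_def P_def algebra_simps)
    also have "\<dots> = (LINT y|lborel. f y * ?t ?R ?R y) + (LINT y|lborel. f y * ?t ?R Q y) + (LINT y|lborel. f y * ?t Q ?R y) + (LINT y|lborel. f y * ?t Q Q y)"
    proof -
      have i: "integrable lborel (\<lambda>y. f y * ?t A B y)" if "A \<in> {P, Q, G, ?R}" "B \<in> {P, Q, G, ?R}" for A B
        by (rule L2_mult_integrable(1)[OF f L2[OF that]])
      have "integrable lborel (\<lambda>y. f y * ?t ?R ?R y)" "integrable lborel (\<lambda>y. f y * ?t ?R Q y)"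
        "integrable lborel (\<lambda>y. f y * ?t Q ?R y)" "integrable lborel (\<lambda>y. f y * ?t Q Q y)"
        by (rule i; simp)+
      then show ?thesis by (simp only: Bochner_Integration.integral_add Bochner_Integration.integrable_add)
    qed
    also have "\<bar>\<dots>\<bar> \<le> B"
      unfolding e1 e2 e12 B_def
    proof -
      have tri: "\<bar>a + - b + - c + d\<bar> \<le> D + B + C + A"
        if "\<bar>a\<bar> \<le> A" "\<bar>b\<bar> \<le> B" "\<bar>c\<bar> \<le> C" "\<bar>d\<bar> \<le> D" for a b c d A B C D :: real
        using that by linarith
      show "\<bar>(LINT y|lborel. g12 y * ?t G G y) + - (LINT y|lborel. g1 y * ?t G Q y) + - (LINT y|lborel. g2 y * ?t Q G y)
          + (LINT y|lborel. f y * ?t Q Q y)\<bar>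
        \<le> ((LINT x|lborel. (f x)\<^sup>2) + K) / 2 + ((LINT x|lborel. (g1 x)\<^sup>2) + K) / 2
          + ((LINT x|lborel. (g2 x)\<^sup>2) + K) / 2 + ((LINT x|lborel. (g12 x)\<^sup>2) + K) / 2"
        by (rule tri; rule bound; (rule g12 g1 g2 f | simp))
    qed
    finally show ?thesis .
  qed
  have "\<bar>f x\<bar> \<le> B" for x
  proof (rule LIMSEQ_le_const2)
    show "(\<lambda>n. \<bar>LINT y|lborel. f y * mollifier (real (Suc n)) x y\<bar>) \<longlonglongrightarrow> \<bar>f x\<bar>"
      by (intro tendsto_rabs mollifier_tendsto cont)
  qed (use main in auto)
  then show ?thesis by blast
qed

text \<open>Boundedness turns the power into a square: |f|^p \<le> B^(p-2) f^2.\<close>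

lemma powr_integrable_bounded:
  assumes f: "L2_fun f" and B: "\<And>x. \<bar>f x\<bar> \<le> B" and p: "2 < p"
  shows "integrable lborel (\<lambda>x. \<bar>f x\<bar> powr p)" "\<And>x. \<bar>\<bar>f x\<bar> powr p\<bar> \<le> B powr p"
proof -
  have [measurable]: "f \<in> borel_measurable borel" and i: "integrable lborel (\<lambda>x. (f x)\<^sup>2)"
    using f by (auto simp: L2_fun_def)
  show "\<bar>\<bar>f x\<bar> powr p\<bar> \<le> B powr p" for x using B[of x] p by (simp add: powr_mono2)
  have "\<bar>f x\<bar> powr p \<le> B powr (p - 2) * (f x)\<^sup>2" for x
  proof (cases "f x = 0")
    case False
    have "\<bar>f x\<bar> powr p = \<bar>f x\<bar> powr (p - 2) * \<bar>f x\<bar> powr 2" by (subst powr_add[symmetric]) simp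
    also have "\<bar>f x\<bar> powr 2 = (f x)\<^sup>2" using False by simp
    also have "\<bar>f x\<bar> powr (p - 2) * (f x)\<^sup>2 \<le> B powr (p - 2) * (f x)\<^sup>2"
      using B[of x] p by (intro mult_right_mono powr_mono2) auto
    finally show ?thesis .
  qed simp
  then have b: "norm (\<bar>f x\<bar> powr p) \<le> norm (B powr (p - 2) * (f x)\<^sup>2)" for x
    by (simp add: abs_mult)
  show "integrable lborel (\<lambda>x. \<bar>f x\<bar> powr p)"
    by (rule Bochner_Integration.integrable_bound[OF integrable_mult_right[OF i, of "B powr (p - 2)"]]) (use b in auto)
qed

text \<open>The point x is rounded down to a grid of mesh 1/(n+1). For fixed n only countably many
  grid points occur, and continuity in x gives the limit.\<close>

lemma caratheodory_measurable:
  fixes v :: "real \<Rightarrow> real^2 \<Rightarrow> real"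
  assumes m: "\<And>x. (\<lambda>s. v s x) \<in> borel_measurable borel" and c: "\<And>s. continuous_on UNIV (v s)"
  shows "case_prod v \<in> borel_measurable (borel \<Otimes>\<^sub>M borel)"
proof -
  define d where "d = (\<lambda>(n::nat) (x::real^2). vec2 (real_of_int \<lfloor>real (Suc n) * x$1\<rfloor> / real (Suc n)) (real_of_int \<lfloor>real (Suc n) * x$2\<rfloor> / real (Suc n)))"
  have lim: "(\<lambda>n. v s (d n x)) \<longlonglongrightarrow> v s x" for s x
  proof -
    have l: "(\<lambda>n. real_of_int \<lfloor>real (Suc n) * a\<rfloor> / real (Suc n)) \<longlonglongrightarrow> a" for a :: real
    proof (rule real_tendsto_sandwich)
      show "\<forall>\<^sub>F n in sequentially. a - 1 / real (Suc n) \<le> real_of_int \<lfloor>real (Suc n) * a\<rfloor> / real (Suc n)"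
      proof (intro always_eventually allI)
        fix n
        have "a * real (Suc n) - 1 \<le> real_of_int \<lfloor>real (Suc n) * a\<rfloor>" by (simp add: mult.commute)
        then have "(a * real (Suc n) - 1) / real (Suc n) \<le> real_of_int \<lfloor>real (Suc n) * a\<rfloor> / real (Suc n)"
          by (intro divide_right_mono) auto
        moreover have "(a * real (Suc n) - 1) / real (Suc n) = a - 1 / real (Suc n)"
          by (simp add: diff_divide_distrib del: of_nat_Suc)
        ultimately show "a - 1 / real (Suc n) \<le> real_of_int \<lfloor>real (Suc n) * a\<rfloor> / real (Suc n)" by simp
      qed
      show "\<forall>\<^sub>F n in sequentially. real_of_int \<lfloor>real (Suc n) * a\<rfloor> / real (Suc n) \<le> a"
      proof (intro always_eventually allI)
        fix n
        have "real_of_int \<lfloor>real (Suc n) * a\<rfloor> \<le> a * real (Suc n)" by (simp add: mult.commute)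
        then show "real_of_int \<lfloor>real (Suc n) * a\<rfloor> / real (Suc n) \<le> a" by (simp add: divide_le_eq)
      qed
      have "(\<lambda>n. a - 1 / real (Suc n)) \<longlonglongrightarrow> a - 0" by (intro tendsto_diff tendsto_const LIMSEQ_Suc[OF lim_1_over_n])
      then show "(\<lambda>n. a - 1 / real (Suc n)) \<longlonglongrightarrow> a" by simp
    qed simp
    have "(\<lambda>n. d n x) \<longlonglongrightarrow> x"
    proof (rule vec_tendstoI)
      fix i :: 2
      show "(\<lambda>n. d n x $ i) \<longlonglongrightarrow> x $ i" using exhaust_2[of i] l by (auto simp: d_def)
    qed
    moreover have "isCont (v s) x" using c[of s] by (simp add: continuous_on_eq_continuous_at)
    ultimately show ?thesis by (rule isCont_tendsto_compose[rotated])
  qed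
  have meas: "(\<lambda>p. v (fst p) (d n (snd p))) \<in> borel_measurable (borel \<Otimes>\<^sub>M borel)" for n
  proof -
    have inner: "(\<lambda>p. v (fst p) (vec2 (real_of_int i / real (Suc n)) (real_of_int \<lfloor>real (Suc n) * (snd p)$2\<rfloor> / real (Suc n))))
        \<in> borel_measurable (borel \<Otimes>\<^sub>M (borel :: (real^2) measure))" for i
    proof (rule measurable_compose_countable[where f = "\<lambda>j p. v (fst p) (vec2 (real_of_int i / real (Suc n)) (real_of_int j / real (Suc n)))" and g = "\<lambda>p. \<lfloor>real (Suc n) * (snd p)$2\<rfloor>"])
      show "(\<lambda>p. v (fst p) (vec2 (real_of_int i / real (Suc n)) (real_of_int j / real (Suc n)))) \<in> borel_measurable (borel \<Otimes>\<^sub>M (borel :: (real^2) measure))" for j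
        by (rule measurable_compose[OF measurable_fst m])
    qed measurable
    show ?thesis unfolding d_def
      by (rule measurable_compose_countable[where f = "\<lambda>i p. v (fst p) (vec2 (real_of_int i / real (Suc n)) (real_of_int \<lfloor>real (Suc n) * (snd p)$2\<rfloor> / real (Suc n)))" and g = "\<lambda>p. \<lfloor>real (Suc n) * (snd p)$1\<rfloor>"])
         (rule inner, measurable)
  qed
  have "(\<lambda>p. v (fst p) (snd p)) \<in> borel_measurable (borel \<Otimes>\<^sub>M borel)"
    by (rule borel_measurable_LIMSEQ_real[where u = "\<lambda>n p. v (fst p) (d n (snd p))"]) (use lim meas in auto)
  then show ?thesis by (simp add: case_prod_beta')
qed

text \<open>For fixed x the value u(s, x) is a limit of mollified pairings, which are continuous in
  s; the continuous representative in x then gives joint measurability.\<close>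

lemma solution_measurable:
  assumes u: "C0_H2_on I u" and cont: "\<And>s. s \<in> {0..t} \<Longrightarrow> continuous_on UNIV (u s)" and I: "{0..t} \<subseteq> I"
  shows "(\<lambda>(s, x). indicat_real {0..t} s * u s x) \<in> borel_measurable (borel \<Otimes>\<^sub>M borel)"
proof (rule caratheodory_measurable)
  show "continuous_on UNIV (\<lambda>x. indicat_real {0..t} s * u s x)" for s
    by (cases "s \<in> {0..t}") (use cont in \<open>auto intro!: continuous_intros\<close>)
  fix x
  have m: "(\<lambda>s. indicat_real {0..t} s * (LINT y|lborel. u s y * mollifier (real (Suc n)) x y)) \<in> borel_measurable borel" for n
  proof -
    have "continuous_on {0..t} (\<lambda>s. LINT y|lborel. u s y * mollifier (real (Suc n)) x y)"
      by (rule continuous_on_subset[OF C0_H2_on_weak_continuous[OF u test_fun_mollifier L2_fun_mollifier] I]) simp_all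
    from borel_measurable_continuous_on_indicator[OF _ this] show ?thesis by simp
  qed
  show "(\<lambda>s. indicat_real {0..t} s * u s x) \<in> borel_measurable borel"
  proof (rule borel_measurable_LIMSEQ_real[OF _ m])
    fix s
    show "(\<lambda>n. indicat_real {0..t} s * (LINT y|lborel. u s y * mollifier (real (Suc n)) x y)) \<longlonglongrightarrow> indicat_real {0..t} s * u s x"
      by (cases "s \<in> {0..t}") (use mollifier_tendsto[OF cont] in auto)
  qed
qed

text \<open>Convexity on the open half-line; the endpoints x = 0 and M = 0 are treated apart, using
  0 powr a = 0.\<close>

lemma powr_above_tangent:
  fixes x M p :: real
  assumes "0 \<le> x" "0 \<le> M" "1 \<le> p"
  shows "M powr p + p * M powr (p - 1) * (x - M) \<le> x powr p"
proof (cases "M = 0")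
  case True
  then show ?thesis by simp
next
  case False
  then have M: "0 < M" using assms by simp
  have pM: "M powr (p - 1) * M = M powr p" using M powr_add[of M "p - 1" 1] by simp
  show ?thesis
  proof (cases "x = 0")
    case True
    have "1 * M powr p \<le> p * M powr p" using assms(3) by (intro mult_right_mono) auto
    then show ?thesis using True pM by (simp add: mult.assoc)
  next
    case False
    then have x: "0 < x" using assms by simp
    have "x powr p - M powr p \<ge> (p * M powr (p - 1)) * (x - M)"
    proof (rule convex_on_imp_above_tangent[of "{0<..}"])
      show "((\<lambda>x. x powr p) has_real_derivative p * M powr (p - 1)) (at M within {0<..})"
        by (rule has_field_derivative_at_within[OF has_real_derivative_powr[OF M]])
      show "M \<in> interior {0<..}" using M by (simp add: interior_open)
    qed (use powr_convex[OF assms(3)] x in simp_all)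
    then show ?thesis by simp
  qed
qed

text \<open>The tangent inequality at M = |mean of h| is applied to |h| and integrated. The linear
  term is nonnegative because the mean of |h| is at least M.\<close>

lemma circle_jensen:
  fixes h :: "real \<Rightarrow> real"
  assumes h: "continuous_on UNIV h" and p: "1 \<le> p"
  shows "ennreal (2 * pi * \<bar>1 / (2 * pi) * (LINT \<theta>:{0..2*pi}|lborel. h \<theta>)\<bar> powr p)
    \<le> (\<integral>\<^sup>+\<theta>\<in>{0..2*pi}. ennreal (\<bar>h \<theta>\<bar> powr p) \<partial>lborel)"
proof -
  define M where "M = \<bar>1 / (2 * pi) * (LINT \<theta>:{0..2*pi}|lborel. h \<theta>)\<bar>"
  have M: "0 \<le> M" by (simp add: M_def)
  have ia: "set_integrable lborel {0..2*pi} (\<lambda>\<theta>. \<bar>h \<theta>\<bar>)" and ih: "set_integrable lborel {0..2*pi} h"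
    and ip: "set_integrable lborel {0..2*pi} (\<lambda>\<theta>. \<bar>h \<theta>\<bar> powr p)"
    using h p by (auto intro!: borel_integrable_atLeastAtMost' continuous_intros continuous_on_powr' intro: continuous_on_subset)
  have ic: "set_integrable lborel {0..2*pi} (\<lambda>\<theta>. k)" for k :: real
    by (intro borel_integrable_atLeastAtMost' continuous_intros)
  have ci: "(LINT \<theta>:{0..2*pi}|lborel. k) = 2 * pi * k" for k :: real by (simp add: set_lebesgue_integral_def)
  have "2 * pi * M = \<bar>LINT \<theta>:{0..2*pi}|lborel. h \<theta>\<bar>" by (simp add: M_def abs_mult)
  also have "\<dots> \<le> (LINT \<theta>:{0..2*pi}|lborel. \<bar>h \<theta>\<bar>)"
    using set_integral_norm_bound[OF ih] by simp
  finally have A: "2 * pi * M \<le> (LINT \<theta>:{0..2*pi}|lborel. \<bar>h \<theta>\<bar>)" .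
  have it: "set_integrable lborel {0..2*pi} (\<lambda>\<theta>. p * M powr (p - 1) * (\<bar>h \<theta>\<bar> - M))"
    by (intro set_integrable_mult_right set_integral_diff ia ic)
  have "2 * pi * M powr p \<le> 2 * pi * M powr p + p * M powr (p - 1) * ((LINT \<theta>:{0..2*pi}|lborel. \<bar>h \<theta>\<bar>) - 2 * pi * M)"
    using A p by simp
  also have "\<dots> = (LINT \<theta>:{0..2*pi}|lborel. M powr p + p * M powr (p - 1) * (\<bar>h \<theta>\<bar> - M))"
    by (simp only: set_integral_add[OF ic it] set_integral_mult_right set_integral_diff[OF ia ic] ci)
  also have "\<dots> \<le> (LINT \<theta>:{0..2*pi}|lborel. \<bar>h \<theta>\<bar> powr p)"
    by (rule set_integral_mono[OF set_integral_add(1)[OF ic it] ip]) (use M p in \<open>auto intro!: powr_above_tangent\<close>)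
  finally have "ennreal (2 * pi * M powr p) \<le> ennreal (LINT \<theta>:{0..2*pi}|lborel. \<bar>h \<theta>\<bar> powr p)" by (rule ennreal_leI)
  also have "\<dots> = (\<integral>\<^sup>+\<theta>. ennreal (indicat_real {0..2*pi} \<theta> *\<^sub>R \<bar>h \<theta>\<bar> powr p) \<partial>lborel)"
    using ip unfolding set_integrable_def set_lebesgue_integral_def by (intro nn_integral_eq_integral[symmetric]) auto
  also have "\<dots> = (\<integral>\<^sup>+\<theta>\<in>{0..2*pi}. ennreal (\<bar>h \<theta>\<bar> powr p) \<partial>lborel)"
    by (intro nn_integral_cong) (auto split: split_indicator)
  finally show ?thesis by (simp add: M_def)
qed

lemma borel_measurable_kernel_D [measurable (raw)]:
  assumes [measurable]: "f \<in> borel_measurable M" "g \<in> borel_measurable M"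
  shows "(\<lambda>x. kernel_D (f x) r (g x)) \<in> borel_measurable M"
  unfolding kernel_D_def set_lebesgue_integral_def by measurable

lemma norm_polar_diff: "norm (polar r \<theta> - polar \<rho> \<phi>) = sqrt (r\<^sup>2 + \<rho>\<^sup>2 - 2 * r * \<rho> * cos (\<theta> - \<phi>))"
proof -
  have "(norm (a - b))\<^sup>2 = (norm a)\<^sup>2 + (norm b)\<^sup>2 - 2 * (a \<bullet> b)" for a b :: "real^2"
    by (simp add: power2_norm_eq_inner inner_diff_left inner_diff_right inner_commute)
  from this[of "polar r \<theta>" "polar \<rho> \<phi>"]
  have "(norm (polar r \<theta> - polar \<rho> \<phi>))\<^sup>2 = (norm (polar r \<theta>))\<^sup>2 + (norm (polar \<rho> \<phi>))\<^sup>2 - 2 * (polar r \<theta> \<bullet> polar \<rho> \<phi>)" .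
  then have "(norm (polar r \<theta> - polar \<rho> \<phi>))\<^sup>2 = r\<^sup>2 + \<rho>\<^sup>2 - 2 * r * \<rho> * cos (\<theta> - \<phi>)"
    by (simp add: inner_polar mult.assoc)
  then show ?thesis by (metis norm_ge_zero real_sqrt_unique)
qed

text \<open>Tonelli and polar coordinates in y; by rotation invariance the integral over \<theta>
  does not depend on the angle of y, so the angular integrals factor.\<close>

lemma circle_convolution:
  fixes f :: "real^2 \<Rightarrow> real" and G :: "real \<Rightarrow> ennreal"
  assumes [measurable]: "f \<in> borel_measurable borel" "G \<in> borel_measurable borel"
  shows "(\<integral>\<^sup>+\<theta>\<in>{0..2*pi}. (\<integral>\<^sup>+y. ennreal (f y) * G (norm (polar r \<theta> - y)) \<partial>lborel) \<partial>lborel)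
    = (\<integral>\<^sup>+\<rho>\<in>{0<..}. ennreal \<rho> * ((\<integral>\<^sup>+\<theta>\<in>{0..2*pi}. G (sqrt (r\<^sup>2 + \<rho>\<^sup>2 - 2 * r * \<rho> * cos \<theta>)) \<partial>lborel)
        * (\<integral>\<^sup>+\<phi>\<in>{0..2*pi}. ennreal (f (polar \<rho> \<phi>)) \<partial>lborel)) \<partial>lborel)"
proof -
  define K where "K = (\<lambda>\<rho>. \<integral>\<^sup>+\<theta>\<in>{0..2*pi}. G (sqrt (r\<^sup>2 + \<rho>\<^sup>2 - 2 * r * \<rho> * cos \<theta>)) \<partial>lborel)"
  have [measurable]: "K \<in> borel_measurable borel" unfolding K_def by measurable
  have inner: "(\<integral>\<^sup>+\<theta>\<in>{0..2*pi}. G (norm (polar r \<theta> - polar \<rho> \<phi>)) \<partial>lborel) = K \<rho>" if "\<phi> \<in> {0..2*pi}" for \<rho> \<phi>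
    unfolding norm_polar_diff K_def
    by (rule nn_integral_circle_shift[of "\<lambda>\<theta>. G (sqrt (r\<^sup>2 + \<rho>\<^sup>2 - 2 * r * \<rho> * cos \<theta>))"]) (use that in auto)
  have "(\<integral>\<^sup>+\<theta>\<in>{0..2*pi}. (\<integral>\<^sup>+y. ennreal (f y) * G (norm (polar r \<theta> - y)) \<partial>lborel) \<partial>lborel)
      = (\<integral>\<^sup>+\<theta>. \<integral>\<^sup>+y. ennreal (f y) * (G (norm (polar r \<theta> - y)) * indicator {0..2*pi} \<theta>) \<partial>lborel \<partial>lborel)"
    by (simp add: nn_integral_multc[symmetric] mult.assoc)
  also have "\<dots> = (\<integral>\<^sup>+y. \<integral>\<^sup>+\<theta>. ennreal (f y) * (G (norm (polar r \<theta> - y)) * indicator {0..2*pi} \<theta>) \<partial>lborel \<partial>lborel)"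
    by (rule lborel_pair.Fubini') simp
  also have "\<dots> = (\<integral>\<^sup>+y. ennreal (f y) * (\<integral>\<^sup>+\<theta>\<in>{0..2*pi}. G (norm (polar r \<theta> - y)) \<partial>lborel) \<partial>lborel)"
    by (simp add: nn_integral_cmult)
  also have "\<dots> = (\<integral>\<^sup>+\<rho>\<in>{0<..}. ennreal \<rho> * (\<integral>\<^sup>+\<phi>\<in>{0..2*pi}. ennreal (f (polar \<rho> \<phi>)) *
      (\<integral>\<^sup>+\<theta>\<in>{0..2*pi}. G (norm (polar r \<theta> - polar \<rho> \<phi>)) \<partial>lborel) \<partial>lborel) \<partial>lborel)"
    by (rule nn_integral_polar) simp
  also have "\<dots> = (\<integral>\<^sup>+\<rho>\<in>{0<..}. ennreal \<rho> * (\<integral>\<^sup>+\<phi>\<in>{0..2*pi}. K \<rho> * ennreal (f (polar \<rho> \<phi>)) \<partial>lborel) \<partial>lborel)"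
  proof -
    have "ennreal (f (polar \<rho> \<phi>)) * (\<integral>\<^sup>+\<theta>\<in>{0..2*pi}. G (norm (polar r \<theta> - polar \<rho> \<phi>)) \<partial>lborel) * indicator {0..2*pi} \<phi>
      = K \<rho> * ennreal (f (polar \<rho> \<phi>)) * indicator {0..2*pi} \<phi>" for \<rho> \<phi>
      using inner[of \<phi> \<rho>] by (cases "\<phi> \<in> {0..2*pi}") (simp_all add: mult.commute)
    then show ?thesis by (simp only:)
  qed
  also have "\<dots> = (\<integral>\<^sup>+\<rho>\<in>{0<..}. ennreal \<rho> * (K \<rho> * (\<integral>\<^sup>+\<phi>\<in>{0..2*pi}. ennreal (f (polar \<rho> \<phi>)) \<partial>lborel)) \<partial>lborel)"
    by (simp add: nn_integral_cmult mult.assoc)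
  finally show ?thesis by (simp add: K_def)
qed

section \<open>The integral inequality\<close>

lemma circ_mean_polar: "circ_mean f r = 1 / (2 * pi) * (LINT \<theta>:{0..2*pi}|lborel. f (polar r \<theta>))"
  by (simp add: circ_mean_def polar_def)

lemma set_integrable_polar:
  assumes "continuous_on UNIV f"
  shows "set_integrable lborel {0..2*pi} (\<lambda>\<theta>. f (polar r \<theta>) :: real)"
proof (rule borel_integrable_atLeastAtMost')
  show "continuous_on {0..2*pi} (\<lambda>\<theta>. f (polar r \<theta>))"
    by (rule continuous_on_compose2[OF assms]) (auto intro!: continuous_intros)
qed

lemma circ_mean_diff:
  assumes "continuous_on UNIV f" "continuous_on UNIV g"
  shows "circ_mean (\<lambda>x. f x - g x) r = circ_mean f r - circ_mean g r"
  unfolding circ_mean_polar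
  by (simp only: set_integral_diff set_integrable_polar assms right_diff_distrib)

lemma nn_circle_integral:
  assumes f: "continuous_on UNIV f" "\<And>x. 0 \<le> f x"
  shows "(\<integral>\<^sup>+\<theta>\<in>{0..2*pi}. ennreal (f (polar r \<theta>)) \<partial>lborel) = ennreal (2 * pi * circ_mean f r)"
    and "0 \<le> circ_mean f r"
proof -
  have i: "integrable lborel (\<lambda>\<theta>. indicat_real {0..2*pi} \<theta> *\<^sub>R f (polar r \<theta>))"
    using set_integrable_polar[OF f(1), of r] by (simp add: set_integrable_def)
  have "(\<integral>\<^sup>+\<theta>\<in>{0..2*pi}. ennreal (f (polar r \<theta>)) \<partial>lborel)
      = (\<integral>\<^sup>+\<theta>. ennreal (indicat_real {0..2*pi} \<theta> *\<^sub>R f (polar r \<theta>)) \<partial>lborel)"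
    by (intro nn_integral_cong) (auto split: split_indicator)
  also have "\<dots> = ennreal (LINT \<theta>|lborel. indicat_real {0..2*pi} \<theta> *\<^sub>R f (polar r \<theta>))"
    using f(2) by (intro nn_integral_eq_integral i) simp
  finally show "(\<integral>\<^sup>+\<theta>\<in>{0..2*pi}. ennreal (f (polar r \<theta>)) \<partial>lborel) = ennreal (2 * pi * circ_mean f r)"
    by (simp add: circ_mean_polar set_lebesgue_integral_def)
  show "0 \<le> circ_mean f r"
    unfolding circ_mean_polar set_lebesgue_integral_def using f(2)
    by (intro mult_nonneg_nonneg Bochner_Integration.integral_nonneg) auto
qed

text \<open>The integrability clauses belong to the claim: without them the inequality could hold
  through the default value 0 of a divergent integral.\<close>

theorem proposition3p11:
  fixes p T t r :: real and Tmax :: ereal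
    and u0 u1 :: "real^2 \<Rightarrow> real"
    and u :: "real \<Rightarrow> real^2 \<Rightarrow> real"
    and w W_lin :: "real \<Rightarrow> real \<Rightarrow> real"
  assumes p: "p > 2"
    and u0: "test_fun u0" and u1: "test_fun u1"
    and u: "maximal_mild_sobolev_solution p u0 u1 Tmax u"
    and T: "0 < T" "ereal T < Tmax"
    and w: "\<And>t r. w t r = sqrt r * circ_mean (u t) r"
    and W_lin: "\<And>t r. W_lin t r = sqrt r * circ_mean (\<lambda>x. S_op 0 t u0 x + S_op 1 t u1 x) r"
    and t: "0 \<le> t" "t \<le> T"
    and r: "0 < r"
  shows "(\<forall>s\<in>{0..<t}. set_integrable lborel {0<..}
            (\<lambda>\<rho>. kernel_D (t - s) r \<rho> * \<rho> powr ((1 - p) / 2) * \<bar>w s \<rho>\<bar> powr p)) \<and>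
         set_integrable lborel {0..t}
            (\<lambda>s. LINT \<rho>:{0<..}|lborel.
               kernel_D (t - s) r \<rho> * \<rho> powr ((1 - p) / 2) * \<bar>w s \<rho>\<bar> powr p) \<and>
         w t r \<ge> W_lin t r +
            (LINT s:{0..t}|lborel. LINT \<rho>:{0<..}|lborel.
               kernel_D (t - s) r \<rho> * \<rho> powr ((1 - p) / 2) * \<bar>w s \<rho>\<bar> powr p)"
proof -
  define I where "I = {t. 0 \<le> t \<and> ereal t < Tmax}"
  have sub: "{0..t} \<subseteq> I"
  proof
    fix s assume "s \<in> {0..t}"
    then have "ereal s \<le> ereal T" "0 \<le> s" using t by auto
    then show "s \<in> I" using le_less_trans[OF _ T(2)] by (auto simp: I_def)
  qed
  have tI: "t \<in> I" using sub t by auto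
  have mild: "mild_sobolev_solution p u0 u1 Tmax u"
    using u by (simp add: maximal_mild_sobolev_solution_def)
  then have cont: "\<And>s. s \<in> I \<Longrightarrow> continuous_on UNIV (u s)" and C0: "C0_H2_on I u"
    and int: "has_H2_integral (\<lambda>s. S_op 1 (t - s) (\<lambda>x. \<bar>u s x\<bar> powr p))
          (\<lambda>x. u t x - (S_op 0 t u0 x + S_op 1 t u1 x)) 0 t"
    using tI unfolding mild_sobolev_solution_def I_def by auto
  have H2: "H2_fun (u s)" if "s \<in> I" for s using C0 that by (simp add: C0_H2_on_def)
  define Y where "Y = (\<lambda>x. u t x - (S_op 0 t u0 x + S_op 1 t u1 x))"
  have Y: "continuous_on UNIV Y"
    unfolding Y_def by (intro continuous_intros cont tI continuous_on_S_op)
  \<comment> \<open>Cutting off in time makes the function jointly measurable on the whole line,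
    with zero contribution outside [0, t].\<close>
  define U where "U = (\<lambda>s x. indicat_real {0..t} s * u s x)"
  have U_in: "U s = u s" if "s \<in> {0..t}" for s using that by (simp add: U_def)
  have U_out: "U s x = 0" if "s \<notin> {0..t}" for s x using that by (simp add: U_def)
  have "case_prod U \<in> borel_measurable (borel \<Otimes>\<^sub>M borel)"
    using solution_measurable[OF C0 _ sub] cont sub unfolding U_def by blast
  then have U_meas [measurable (raw)]: "(\<lambda>z. U (a z) (b z)) \<in> borel_measurable M"
    if "a \<in> borel_measurable M" "b \<in> borel_measurable M" for a b and M :: "'z measure"
    using measurable_compose[OF measurable_Pair[OF that], of "case_prod U" borel] by simp
  have f: "integrable lborel (\<lambda>x. \<bar>U s x\<bar> powr p) \<and> (\<exists>B. \<forall>x. \<bar>\<bar>U s x\<bar> powr p\<bar> \<le> B)" for s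
  proof (cases "s \<in> {0..t}")
    case True
    then have s: "s \<in> I" using sub by blast
    obtain B where B: "\<And>x. \<bar>u s x\<bar> \<le> B" using H2_continuous_bounded[OF H2[OF s] cont[OF s]] by blast
    have "L2_fun (u s)" using H2[OF s] by (simp add: H2_fun_def)
    from powr_integrable_bounded[OF this B p] show ?thesis unfolding U_in[OF True] by blast
  next
    case False
    then show ?thesis by (auto simp: U_out)
  qed
  \<comment> \<open>The Duhamel integrand in convolution form, where sign and joint measurability
    are visible; \<open>F_S\<close> identifies it with the multiplier.\<close>
  define F where "F = (\<lambda>s x. LINT y|lborel. \<bar>U s y\<bar> powr p * kernel_G (t - s) (norm (x - y)))"
  have F_meas [measurable (raw)]: "(\<lambda>z. F (a z) (b z)) \<in> borel_measurable M"
    if [measurable]: "a \<in> borel_measurable M" "b \<in> borel_measurable M" for a b and M :: "'z measure"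
    unfolding F_def by measurable
  have F_S: "F s = S_op 1 (t - s) (\<lambda>x. \<bar>u s x\<bar> powr p)" if "s \<in> {0..t}" for s
  proof
    fix x
    obtain B where B: "\<And>x. \<bar>\<bar>U s x\<bar> powr p\<bar> \<le> B" using f by blast
    have "0 \<le> t - s" using that by simp
    from S_op_1_eq_convolution[OF conjunct1[OF f] B this, of x]
    show "F s x = S_op 1 (t - s) (\<lambda>x. \<bar>u s x\<bar> powr p) x" unfolding F_def U_in[OF that] by simp
  qed
  \<comment> \<open>At s = t the propagator has time 0 and vanishes. Kernel positivity needs t - s >
    0, so half-open intervals are used from here on.\<close>
  have F_out: "F s x = 0" if "s \<notin> {0..<t}" for s x
  proof (cases "s = t")
    case True
    then show ?thesis using F_S[of t] t by simp
  next
    case False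
    then have "s \<notin> {0..t}" using that by auto
    then show ?thesis by (simp add: F_def U_out)
  qed
  have F_cont: "continuous_on UNIV (F s)" for s
  proof (cases "s \<in> {0..t}")
    case True
    then show ?thesis by (simp add: F_S continuous_on_S_op)
  next
    case False
    then have "F s = (\<lambda>x. 0)" using F_out[of s] by (intro ext) auto
    then show ?thesis by simp
  qed
  \<comment> \<open>Nonnegativity is available only for positive radii; y = x is a null set.\<close>
  have pos: "AE y in lborel. 0 \<le> \<bar>U s y\<bar> powr p * kernel_G (t - s) (norm (x - y))" if "s \<in> {0..<t}" for s x
    using AE_lborel_singleton[of x]
  proof eventually_elim
    case (elim y)
    then have "0 \<le> kernel_G (t - s) (norm (x - y))" using that by (intro kernel_G_nonneg) auto
    then show ?case by simp
  qed
  have F_nn: "ennreal (F s x) = (\<integral>\<^sup>+y. ennreal (\<bar>U s y\<bar> powr p) * ennreal (kernel_G (t - s) (norm (x - y))) \<partial>lborel)"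
    and F_nonneg: "0 \<le> F s x" if s: "s \<in> {0..<t}" for s x
  proof -
    obtain B where B: "\<And>x. \<bar>\<bar>U s x\<bar> powr p\<bar> \<le> B" using f by blast
    have "integrable lborel (\<lambda>y. \<bar>U s y\<bar> powr p * kernel_G (t - s) (norm (x - y)))"
      using integrable_mult_kernel_G_reg[OF conjunct1[OF f] B, of "t - s" 0 x] s
      by (simp add: kernel_G_reg_0)
    from nn_integral_eq_integral[OF this pos[OF s]]
    show "ennreal (F s x) = (\<integral>\<^sup>+y. ennreal (\<bar>U s y\<bar> powr p) * ennreal (kernel_G (t - s) (norm (x - y))) \<partial>lborel)"
      by (simp add: F_def ennreal_mult')
    show "0 \<le> F s x" unfolding F_def by (rule integral_nonneg_AE[OF pos[OF s]])
  qed
  have F0: "0 \<le> F s x" for s x using F_nonneg[of s x] F_out[of s x] by (cases "s \<in> {0..<t}") auto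

  \<comment> \<open>The Duhamel term as a pointwise lower bound\<close>
  have Y_lower: "(\<integral>\<^sup>+s. ennreal (F s x) \<partial>lborel) \<le> ennreal (Y x)" and Y0: "0 \<le> Y x" for x
  proof -
    define m where "m = (\<lambda>n. mollifier (real (Suc n)) x)"
    have m: "test_fun (m n)" "L2_fun (m n)" "0 \<le> m n y" for n y
      unfolding m_def by (rule test_fun_mollifier L2_fun_mollifier mollifier_nonneg, simp)+
    have [measurable]: "m n \<in> borel_measurable borel" for n using m(2)[of n] by (simp add: L2_fun_def)
    define g where "g = (\<lambda>n s. LINT y|lborel. F s y * m n y)"
    have [measurable]: "g n \<in> borel_measurable borel" for n unfolding g_def by measurable
    have g0: "0 \<le> g n s" for n s unfolding g_def using F0 m(3) by (intro Bochner_Integration.integral_nonneg) simp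
    \<comment> \<open>Pairing the Sobolev integral with a bump gives a scalar gauge integral; as
      \<open>g n\<close> is nonnegative, it becomes a Lebesgue integral.\<close>
    have hi: "(g n has_integral (LINT y|lborel. Y y * m n y)) UNIV" for n
    proof -
      have "((\<lambda>s. LINT y|lborel. S_op 1 (t - s) (\<lambda>x. \<bar>u s x\<bar> powr p) y * m n y) has_integral (LINT y|lborel. Y y * m n y)) {0..t}"
        using has_H2_integral_weak[OF int m(1,2)] unfolding Y_def .
      then have "(g n has_integral (LINT y|lborel. Y y * m n y)) {0..t}"
        by (rule has_integral_eq[rotated]) (simp add: g_def F_S)
      moreover have "g n s = 0" if "s \<notin> {0..t}" for s
      proof -
        have "s \<notin> {0..<t}" using that by auto
        from F_out[OF this] show ?thesis by (simp add: g_def)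
      qed
      ultimately show ?thesis using has_integral_on_superset[of "g n" _ "{0..t}" UNIV] by auto
    qed
    have nn: "(\<integral>\<^sup>+s. ennreal (g n s) \<partial>lborel) = ennreal (LINT y|lborel. Y y * m n y)" for n
      by (rule nn_integral_has_integral_lborel[OF _ g0 hi]) simp
    have lim: "(\<lambda>n. LINT y|lborel. Y y * m n y) \<longlonglongrightarrow> Y x" unfolding m_def by (rule mollifier_tendsto[OF Y])
    have "0 \<le> (LINT y|lborel. Y y * m n y)" for n using has_integral_nonneg[OF hi g0] by blast
    then show "0 \<le> Y x" by (intro LIMSEQ_le_const[OF lim]) auto
    have gl: "(\<lambda>n. ennreal (g n s)) \<longlonglongrightarrow> ennreal (F s x)" for s
      unfolding g_def m_def by (intro tendsto_ennrealI mollifier_tendsto F_cont)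
    \<comment> \<open>Fatou's lemma as the bumps shrink; continuity of \<open>F s\<close> and of
      \<open>Y\<close> identifies the limits at x.\<close>
    have "(\<integral>\<^sup>+s. ennreal (F s x) \<partial>lborel) = (\<integral>\<^sup>+s. liminf (\<lambda>n. ennreal (g n s)) \<partial>lborel)"
      using lim_imp_Liminf[OF _ gl] by simp
    also have "\<dots> \<le> liminf (\<lambda>n. \<integral>\<^sup>+s. ennreal (g n s) \<partial>lborel)"
      by (rule nn_integral_liminf) simp
    also have "\<dots> = ennreal (Y x)"
      unfolding nn by (rule lim_imp_Liminf[OF _ tendsto_ennrealI[OF lim]]) simp
    finally show "(\<integral>\<^sup>+s. ennreal (F s x) \<partial>lborel) \<le> ennreal (Y x)" .
  qed

  \<comment> \<open>Reduction of the kernel integral to a circle integral of the Duhamel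
    integrand\<close>
  define V where "V = (\<lambda>s \<rho>. sqrt \<rho> * circ_mean (U s) \<rho>)"
  have [measurable (raw)]: "(\<lambda>z. V (a z) (b z)) \<in> borel_measurable M"
    if [measurable]: "a \<in> borel_measurable M" "b \<in> borel_measurable M" for a b and M :: "'z measure"
    unfolding V_def circ_mean_polar set_lebesgue_integral_def by measurable
  define D where "D = (\<lambda>s \<rho>. kernel_D (t - s) r \<rho> * \<rho> powr ((1 - p) / 2) * \<bar>V s \<rho>\<bar> powr p)"
  have D_meas [measurable (raw)]: "(\<lambda>z. D (a z) (b z)) \<in> borel_measurable M"
    if [measurable]: "a \<in> borel_measurable M" "b \<in> borel_measurable M" for a b and M :: "'z measure"
    unfolding D_def by measurable
  have D_w: "kernel_D (t - s) r \<rho> * \<rho> powr ((1 - p) / 2) * \<bar>w s \<rho>\<bar> powr p = D s \<rho>" if "s \<in> {0..t}" for s \<rho>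
    by (simp add: D_def V_def w U_in[OF that])
  let ?c = "ennreal (sqrt r / (2 * pi))"
  have key: "(\<integral>\<^sup>+\<rho>\<in>{0<..}. ennreal \<bar>D s \<rho>\<bar> \<partial>lborel) \<le> ?c * (\<integral>\<^sup>+\<theta>\<in>{0..2*pi}. ennreal (F s (polar r \<theta>)) \<partial>lborel)" if s: "s \<in> {0..<t}" for s
  proof -
    define G where "G = (\<lambda>z. ennreal (kernel_G (t - s) z))"
    have [measurable]: "G \<in> borel_measurable borel" unfolding G_def by measurable
    define a where "a = (\<lambda>\<rho> \<theta>. sqrt (r\<^sup>2 + \<rho>\<^sup>2 - 2 * r * \<rho> * cos \<theta>))"
    \<comment> \<open>The two circles do not meet when \<rho> differs from r, so the singularity of
      the kernel at 0 is avoided.\<close>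
    have a: "0 < a \<rho> \<theta>" if "0 < \<rho>" "\<rho> \<noteq> r" for \<rho> \<theta>
    proof -
      have "r * \<rho> * cos \<theta> \<le> r * \<rho> * 1" using r that by (intro mult_left_mono) auto
      moreover have "0 < (r - \<rho>)\<^sup>2" using that by simp
      ultimately show ?thesis by (simp add: a_def power2_diff)
    qed
    define L where "L = (\<lambda>\<rho>. LINT \<theta>:{0..2*pi}|lborel. kernel_G (t - s) (a \<rho> \<theta>))"
    define K where "K = (\<lambda>\<rho>. \<integral>\<^sup>+\<theta>\<in>{0..2*pi}. G (a \<rho> \<theta>) \<partial>lborel)"
    define J where "J = (\<lambda>\<rho>. \<integral>\<^sup>+\<phi>\<in>{0..2*pi}. ennreal (\<bar>U s (polar \<rho> \<phi>)\<bar> powr p) \<partial>lborel)"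
    have [measurable]: "K \<in> borel_measurable borel" "J \<in> borel_measurable borel"
      unfolding K_def J_def a_def by measurable
    \<comment> \<open>Only an inequality: if the kernel were not integrable on the circle,
      \<open>L\<close> would be 0 by convention while \<open>K\<close> keeps the true value.\<close>
    have L0: "0 \<le> L \<rho>" and LK: "ennreal (L \<rho>) \<le> K \<rho>" if \<rho>: "0 < \<rho>" "\<rho> \<noteq> r" for \<rho>
    proof -
      have g: "0 \<le> kernel_G (t - s) (a \<rho> \<theta>)" for \<theta> using s a[OF \<rho>] by (intro kernel_G_nonneg) auto
      show "0 \<le> L \<rho>" unfolding L_def set_lebesgue_integral_def using g
        by (intro Bochner_Integration.integral_nonneg) simp
      have "ennreal (L \<rho>) \<le> (\<integral>\<^sup>+\<theta>. ennreal (indicat_real {0..2*pi} \<theta> *\<^sub>R kernel_G (t - s) (a \<rho> \<theta>)) \<partial>lborel)"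
      proof (cases "integrable lborel (\<lambda>\<theta>. indicat_real {0..2*pi} \<theta> *\<^sub>R kernel_G (t - s) (a \<rho> \<theta>))")
        case True
        then show ?thesis unfolding L_def set_lebesgue_integral_def
          by (subst nn_integral_eq_integral) (simp_all add: g)
      next
        case False
        then show ?thesis unfolding L_def set_lebesgue_integral_def by (simp add: not_integrable_integral_eq)
      qed
      also have "\<dots> = K \<rho>" unfolding K_def G_def
        by (intro nn_integral_cong) (auto split: split_indicator)
      finally show "ennreal (L \<rho>) \<le> K \<rho>" .
    qed
    have D_eq: "D s \<rho> = sqrt r * (\<rho> * (L \<rho> * \<bar>circ_mean (U s) \<rho>\<bar> powr p))" if \<rho>: "0 < \<rho>" for \<rho>
    proof -
      have kd: "kernel_D (t - s) r \<rho> = sqrt r * \<rho> powr (1/2) * L \<rho>"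
        using \<rho> by (simp add: kernel_D_def L_def a_def real_sqrt_mult powr_half_sqrt)
      have V: "\<bar>V s \<rho>\<bar> powr p = \<rho> powr (p / 2) * \<bar>circ_mean (U s) \<rho>\<bar> powr p"
        using \<rho> by (simp add: V_def abs_mult powr_mult powr_powr powr_half_sqrt[symmetric])
      \<comment> \<open>The powers from the kernel, the weight and |w|^p combine to exactly \<rho>,
        the polar area element.\<close>
      have pw: "\<rho> powr (1/2) * (\<rho> powr ((1 - p) / 2) * \<rho> powr (p / 2)) = \<rho>"
        using \<rho> by (simp add: powr_add[symmetric] add_divide_distrib[symmetric])
      have "D s \<rho> = sqrt r * (\<rho> powr (1/2) * (\<rho> powr ((1 - p) / 2) * \<rho> powr (p / 2)) * (L \<rho> * \<bar>circ_mean (U s) \<rho>\<bar> powr p))"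
        unfolding D_def kd V by (simp only: mult_ac)
      then show ?thesis unfolding pw .
    qed
    have "s \<in> {0..t}" using s by simp
    then have Us: "continuous_on UNIV (U s)" using sub cont[of s] U_in[of s] by auto
    have jensen: "ennreal (2 * pi * \<bar>circ_mean (U s) \<rho>\<bar> powr p) \<le> J \<rho>" for \<rho>
    proof -
      have "continuous_on UNIV (\<lambda>\<theta>. U s (polar \<rho> \<theta>))"
        by (rule continuous_on_compose2[OF Us]) (auto intro!: continuous_intros)
      from circle_jensen[OF this, of p] show ?thesis using p by (simp add: circ_mean_polar J_def)
    qed
    have bound: "ennreal \<bar>D s \<rho>\<bar> \<le> ?c * (ennreal \<rho> * (K \<rho> * J \<rho>))" if \<rho>: "0 < \<rho>" "\<rho> \<noteq> r" for \<rho>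
    proof -
      have abs_D: "\<bar>D s \<rho>\<bar> = sqrt r / (2 * pi) * (\<rho> * (L \<rho> * (2 * pi * \<bar>circ_mean (U s) \<rho>\<bar> powr p)))"
        using L0[OF \<rho>] \<rho> r by (simp add: D_eq)
      have "ennreal \<bar>D s \<rho>\<bar> = ?c * (ennreal \<rho> * (ennreal (L \<rho>) * ennreal (2 * pi * \<bar>circ_mean (U s) \<rho>\<bar> powr p)))"
      proof -
        have prod: "ennreal (c * (x * (l * y))) = ennreal c * (ennreal x * (ennreal l * ennreal y))"
          if "0 \<le> c" "0 \<le> x" "0 \<le> l" "0 \<le> y" for c x l y :: real
          using that by (simp add: ennreal_mult)
        show ?thesis unfolding abs_D using L0[OF \<rho>] \<rho> r by (intro prod) auto
      qed
      also have "\<dots> \<le> ?c * (ennreal \<rho> * (K \<rho> * J \<rho>))"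
        by (intro mult_left_mono mult_mono LK \<rho> jensen) auto
      finally show ?thesis .
    qed
    \<comment> \<open>Jensen has replaced the power of the mean by the mean of the power;
      \<open>circle_convolution\<close> then recognises the circle integral of
      \<open>F s\<close>.\<close>
    have "(\<integral>\<^sup>+\<rho>\<in>{0<..}. ennreal \<bar>D s \<rho>\<bar> \<partial>lborel) \<le> (\<integral>\<^sup>+\<rho>. ?c * (ennreal \<rho> * (K \<rho> * J \<rho>) * indicator {0<..} \<rho>) \<partial>lborel)"
      by (rule nn_integral_mono_AE, use AE_lborel_singleton[of r] in eventually_elim)
         (use bound in \<open>auto split: split_indicator\<close>)
    also have "\<dots> = ?c * (\<integral>\<^sup>+\<rho>\<in>{0<..}. ennreal \<rho> * (K \<rho> * J \<rho>) \<partial>lborel)"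
      by (rule nn_integral_cmult) simp
    also have "(\<integral>\<^sup>+\<rho>\<in>{0<..}. ennreal \<rho> * (K \<rho> * J \<rho>) \<partial>lborel)
        = (\<integral>\<^sup>+\<theta>\<in>{0..2*pi}. (\<integral>\<^sup>+y. ennreal (\<bar>U s y\<bar> powr p) * G (norm (polar r \<theta> - y)) \<partial>lborel) \<partial>lborel)"
      unfolding K_def J_def a_def by (rule circle_convolution[symmetric]) simp_all
    also have "\<dots> = (\<integral>\<^sup>+\<theta>\<in>{0..2*pi}. ennreal (F s (polar r \<theta>)) \<partial>lborel)"
      unfolding F_nn[OF s] G_def ..
    finally show "(\<integral>\<^sup>+\<rho>\<in>{0<..}. ennreal \<bar>D s \<rho>\<bar> \<partial>lborel) \<le> ?c * (\<integral>\<^sup>+\<theta>\<in>{0..2*pi}. ennreal (F s (polar r \<theta>)) \<partial>lborel)" .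
  qed
  have D_out: "D s \<rho> = 0" if "s \<notin> {0..<t}" for s \<rho>
  proof (cases "s = t")
    case True
    then show ?thesis by (simp add: D_def kernel_D_def kernel_G_def)
  next
    case False
    then have "s \<notin> {0..t}" using that by auto
    then show ?thesis by (simp add: D_def V_def circ_mean_def U_out set_lebesgue_integral_def)
  qed
  have D_int: "set_integrable lborel {0<..} (D s)" if s: "s \<in> {0..<t}" for s
  proof -
    \<comment> \<open>The majorant is finite because \<open>F s\<close> is continuous on the
      circle.\<close>
    have "(\<integral>\<^sup>+\<rho>\<in>{0<..}. ennreal \<bar>D s \<rho>\<bar> \<partial>lborel) < \<infinity>"
      using key[OF s] unfolding nn_circle_integral(1)[OF F_cont F0]
      by (rule order_le_less_trans) (simp add: ennreal_mult_less_top)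
    moreover have "(\<integral>\<^sup>+\<rho>\<in>{0<..}. ennreal \<bar>D s \<rho>\<bar> \<partial>lborel) = (\<integral>\<^sup>+\<rho>. ennreal (norm (indicat_real {0<..} \<rho> *\<^sub>R D s \<rho>)) \<partial>lborel)"
      by (intro nn_integral_cong) (auto split: split_indicator)
    ultimately show ?thesis unfolding set_integrable_def by (intro integrableI_bounded) auto
  qed

  \<comment> \<open>Integration in time and conclusion\<close>
  define E where "E = (\<lambda>s. LINT \<rho>:{0<..}|lborel. D s \<rho>)"
  have E_meas [measurable]: "E \<in> borel_measurable borel"
    unfolding E_def set_lebesgue_integral_def by measurable
  have E_bound: "ennreal \<bar>E s\<bar> \<le> ?c * (\<integral>\<^sup>+\<theta>\<in>{0..2*pi}. ennreal (F s (polar r \<theta>)) \<partial>lborel)" for s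
  proof (cases "s \<in> {0..<t}")
    case True
    have "ennreal (norm (LINT \<rho>|lborel. indicat_real {0<..} \<rho> *\<^sub>R D s \<rho>))
        \<le> (\<integral>\<^sup>+\<rho>. ennreal (norm (indicat_real {0<..} \<rho> *\<^sub>R D s \<rho>)) \<partial>lborel)"
      using D_int[OF True] unfolding set_integrable_def by (rule integral_norm_bound_ennreal)
    also have "\<dots> = (\<integral>\<^sup>+\<rho>\<in>{0<..}. ennreal \<bar>D s \<rho>\<bar> \<partial>lborel)"
      by (intro nn_integral_cong) (auto split: split_indicator)
    also have "\<dots> \<le> ?c * (\<integral>\<^sup>+\<theta>\<in>{0..2*pi}. ennreal (F s (polar r \<theta>)) \<partial>lborel)" by (rule key[OF True])
    finally show ?thesis by (simp add: E_def set_lebesgue_integral_def)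
  next
    case False
    then show ?thesis by (simp add: E_def D_out set_lebesgue_integral_def)
  qed
  \<comment> \<open>After Tonelli in time and angle the Fatou bound applies at each point of the
    circle. The right-hand side is finite, so integrability in time comes out together with the
    estimate.\<close>
  have "(\<integral>\<^sup>+s. ennreal (norm (E s)) \<partial>lborel) \<le> (\<integral>\<^sup>+s. ?c * (\<integral>\<^sup>+\<theta>\<in>{0..2*pi}. ennreal (F s (polar r \<theta>)) \<partial>lborel) \<partial>lborel)"
    using E_bound by (intro nn_integral_mono) simp
  also have "\<dots> = ?c * (\<integral>\<^sup>+s. \<integral>\<^sup>+\<theta>. ennreal (F s (polar r \<theta>)) * indicator {0..2*pi} \<theta> \<partial>lborel \<partial>lborel)"
    by (rule nn_integral_cmult) measurable
  also have "(\<integral>\<^sup>+s. \<integral>\<^sup>+\<theta>. ennreal (F s (polar r \<theta>)) * indicator {0..2*pi} \<theta> \<partial>lborel \<partial>lborel)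
      = (\<integral>\<^sup>+\<theta>. \<integral>\<^sup>+s. ennreal (F s (polar r \<theta>)) * indicator {0..2*pi} \<theta> \<partial>lborel \<partial>lborel)"
    by (rule lborel_pair.Fubini'[symmetric]) measurable
  also have "\<dots> \<le> (\<integral>\<^sup>+\<theta>\<in>{0..2*pi}. ennreal (Y (polar r \<theta>)) \<partial>lborel)"
    by (intro nn_integral_mono) (simp add: nn_integral_multc mult_right_mono Y_lower)
  also have "\<dots> = ennreal (2 * pi * circ_mean Y r)"
    by (rule nn_circle_integral(1)[OF Y Y0])
  also have "?c * ennreal (2 * pi * circ_mean Y r) = ennreal (sqrt r * circ_mean Y r)"
    using r nn_circle_integral(2)[OF Y Y0, of r] by (simp add: ennreal_mult[symmetric])
  finally have total: "(\<integral>\<^sup>+s. ennreal (norm (E s)) \<partial>lborel) \<le> ennreal (sqrt r * circ_mean Y r)"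
    by (simp add: mult_left_mono)
  have E_int: "integrable lborel E"
    using order_le_less_trans[OF total] by (intro integrableI_bounded) auto
  have E_out: "E s = 0" if "s \<notin> {0..t}" for s
  proof -
    have "s \<notin> {0..<t}" using that by auto
    from D_out[OF this] show ?thesis by (simp add: E_def set_lebesgue_integral_def)
  qed
  have "ennreal \<bar>LINT s|lborel. E s\<bar> \<le> ennreal (sqrt r * circ_mean Y r)"
    using integral_norm_bound_ennreal[OF E_int] total by simp
  then have upper: "(LINT s|lborel. E s) \<le> sqrt r * circ_mean Y r"
    using r nn_circle_integral(2)[OF Y Y0, of r] by (subst (asm) ennreal_le_iff) auto
  \<comment> \<open>\<open>Y\<close> is the solution minus its linear part, and circular means are
    linear on continuous functions.\<close>
  have wY: "sqrt r * circ_mean Y r = w t r - W_lin t r"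
    unfolding w W_lin Y_def
    by (subst circ_mean_diff) (auto intro!: continuous_intros cont tI continuous_on_S_op simp: right_diff_distrib)
  have E_eq: "indicat_real {0..t} s *\<^sub>R (LINT \<rho>:{0<..}|lborel. kernel_D (t - s) r \<rho> * \<rho> powr ((1 - p) / 2) * \<bar>w s \<rho>\<bar> powr p) = E s" for s
    by (cases "s \<in> {0..t}") (simp_all add: D_w E_def E_out[unfolded E_def])
  show ?thesis
  proof (intro conjI ballI)
    fix s assume s: "s \<in> {0..<t}"
    then have "s \<in> {0..t}" by simp
    then show "set_integrable lborel {0<..} (\<lambda>\<rho>. kernel_D (t - s) r \<rho> * \<rho> powr ((1 - p) / 2) * \<bar>w s \<rho>\<bar> powr p)"
      using D_int[OF s] by (simp only: D_w) 
  next
    show "set_integrable lborel {0..t} (\<lambda>s. LINT \<rho>:{0<..}|lborel. kernel_D (t - s) r \<rho> * \<rho> powr ((1 - p) / 2) * \<bar>w s \<rho>\<bar> powr p)"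
      unfolding set_integrable_def E_eq by (rule E_int)
    have "(LINT s:{0..t}|lborel. LINT \<rho>:{0<..}|lborel. kernel_D (t - s) r \<rho> * \<rho> powr ((1 - p) / 2) * \<bar>w s \<rho>\<bar> powr p) = (LINT s|lborel. E s)"
      by (subst set_lebesgue_integral_def) (simp only: E_eq)
    then show "w t r \<ge> W_lin t r + (LINT s:{0..t}|lborel. LINT \<rho>:{0<..}|lborel. kernel_D (t - s) r \<rho> * \<rho> powr ((1 - p) / 2) * \<bar>w s \<rho>\<bar> powr p)"
      using upper unfolding wY by simp
  qed
qed

end
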